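(* Let $X_t$ be any process in $\mathbb{R}^d$ with additive components and let $y_t(r)$ be its associated function (see context). Fix $b\in(0,\infty)$ and put $$\delta=\inf\Big\{\eta\ge0:\liminf_{r\to0}r^\eta y_b(r)=0\Big\},\qquad \beta=\inf\Big\{\eta\ge0:\lim_{r\to0}r^\eta y_b(r)=0\Big\}.$$ Let $\varepsilon$ be a small positive constant and $c$ a continuous slow function, and for small $t>0$ define $$\overline v(t)=\inf\{s>0:y_s(t^{1/\eta})\ge c(t)\,t\,y_b(t^{1/\eta})\text{ for all }\eta\in[\delta-\varepsilon,\delta)\},$$ $$\underline v(t)=\sup\{s>0:y_s(t^{1/\eta})\le c(t)^{-1}t\,y_b(t^{1/\eta})\text{ for all }\eta\in(\delta,\delta+\varepsilon]\},$$ $$\overline u(t)=\inf\{s>0:y_s(t^{1/\eta})\ge c(t)\,t\,y_b(t^{1/\eta})\text{ for all }\eta\in[\beta-\varepsilon,\beta)\},$$ $$\underline u(t)=\sup\{s>0:y_s(t^{1/\eta})\le c(t)^{-1}t\,y_b(t^{1/\eta})\text{ for all }\eta\in(\beta,\beta+\varepsilon]\}.$$ Then, for $\eta>0$, with probability $1$: $$\lim_{t\to0}t^{-1/\eta}X^*_{\overline v(t)}=\infty\ \text{ if }\eta<\delta,\qquad \liminf_{t\to0}t^{-1/\eta}X^*_{\underline v(t)}=0\ \text{ if }\eta>\delta,$$ $$\limsup_{t\to0}t^{-1/\eta}X^*_{\overline u(t)}=\infty\ \text{ if }\eta<\beta,\qquad \lim_{t\to0}t^{-1/\eta}X^*_{\underline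 u(t)}=0\ \text{ if }\eta>\beta.$$
   Context: $X_t^*=\sup_{0\le s\le t}|X_s|$. In the definition of $\overline v$ (resp. $\overline u$) "small" $\varepsilon$ includes $\varepsilon<\delta$ (resp. $\varepsilon<\beta$); if $\delta=0$ (resp. $\beta=0$) the assertion about $\overline v$ (resp. $\overline u$) is vacuous. Additive process: a process with independent increments, right-continuous paths with left limits, continuous in probability, with $X_0=0$. A process $X_t=(X_t^{(1)},\dots,X_t^{(d)})$ in $\mathbb{R}^d$ has additive components if each $X_t^{(i)}$ is a real additive process (the vector process itself need not have independent increments). A real additive process has characteristics $(B_t,C_t,\nu_t)$: $E e^{i\lambda X_t}=\exp\{i\lambda B_t-\tfrac12\lambda^2C_t+\int(e^{i\lambda x}-1-i\lambda x1(|x|\le1))\nu_t(dx)\}$, with $B_t$ continuous, $B_0=0$, $C_t$ nondecreasing continuous, $C_0=0$, $\nu_t$ a Lévy measure for each $t$, nondecreasing and continuous in $t$, $\nu_0=0$. For such a process put, for $r>0,t\ge0$, $$G_t(r)=\int_{|x|>r}\nu_t(dx),\quad K_t(r)=r^{-2}\Big[C_t+\int_{|x|\le r}x^2\nu_t(dx)\Big],$$ $$M_t(r)=r^{-1}\Big|B_t+\int_{1<|x|\le r\vee1}x\,\nu_t(dx)-\int_{r\wedge1<|x|\le1}x\,\nu_t(dx)\Big|,\quad M_t^*(r)=\max_{0\le s\le t}M_s(r),$$ and $y_t(r)=G_t(r)+K_t(r)+M_t^*(r)$. For a process in $\mathbb{R}^d$ with additive components, $y_t(r)=\sum_{i=1}^dy_t^{(i)}(r)$,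 where $y_t^{(i)}(r)$ is this function for $X_t^{(i)}$. Slow function: a function $c:(0,1)\to(0,1)$ with $\liminf_{r\to0}c(r)r^{-\eta}>0$ for all $\eta>0$. *)

theory Defs
  imports "HOL-Probability.Probability"
begin

section \<open>Additive processes\<close>

text \<open>Processes are indexed by real times; only times \<open>t \<ge> 0\<close> are ever constrained or used.\<close>

definition independent_increments :: "'w measure \<Rightarrow> (real \<Rightarrow> 'w \<Rightarrow> real) \<Rightarrow> bool" where
  "independent_increments M X \<longleftrightarrow>
     (\<forall>n (\<tau> :: nat \<Rightarrow> real). 0 \<le> \<tau> 0 \<and> (\<forall>i<n. \<tau> i \<le> \<tau> (Suc i)) \<longrightarrow>
        prob_space.indep_vars M (\<lambda>_. borel) (\<lambda>i \<omega>. X (\<tau> (Suc i)) \<omega> - X (\<tau> i) \<omega>) {..<n})"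

definition continuous_in_probability :: "'w measure \<Rightarrow> (real \<Rightarrow> 'w \<Rightarrow> real) \<Rightarrow> bool" where
  "continuous_in_probability M X \<longleftrightarrow>
     (\<forall>t\<ge>0. \<forall>e>0. ((\<lambda>s. measure M {\<omega> \<in> space M. \<bar>X s \<omega> - X t \<omega>\<bar> > e}) \<longlongrightarrow> 0) (at t within {0..}))"

definition cadlag_path :: "(real \<Rightarrow> real) \<Rightarrow> bool" where
  "cadlag_path x \<longleftrightarrow>
     (\<forall>t\<ge>0. continuous (at_right t) x) \<and> (\<forall>t>0. \<exists>l. (x \<longlongrightarrow> l) (at_left t))"

text \<open>The path properties are only required almost surely.\<close>

definition additive_process :: "'w measure \<Rightarrow> (real \<Rightarrow> 'w \<Rightarrow> real) \<Rightarrow> bool" where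
  "additive_process M X \<longleftrightarrow>
     (\<forall>t\<ge>0. X t \<in> borel_measurable M) \<and>
     independent_increments M X \<and>
     continuous_in_probability M X \<and>
     (AE \<omega> in M. X 0 \<omega> = 0 \<and> cadlag_path (\<lambda>t. X t \<omega>))"

definition additive_components :: "'w measure \<Rightarrow> (real \<Rightarrow> 'w \<Rightarrow> real ^ 'd) \<Rightarrow> bool" where
  "additive_components M X \<longleftrightarrow> (\<forall>i. additive_process M (\<lambda>t \<omega>. X t \<omega> $ i))"


section \<open>Characteristics\<close>

definition levy_measure :: "real measure \<Rightarrow> bool" where
  "levy_measure \<mu> \<longleftrightarrow>
     sets \<mu> = sets borel \<and> emeasure \<mu> {0} = 0 \<and> (\<integral>\<^sup>+x. ennreal (min 1 (x\<^sup>2)) \<partial>\<mu>) < \<infinity>"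

text \<open>Continuity of a family of Levy measures in \<open>t\<close> means continuity of \<open>t \<mapsto> \<nu>\<^sub>t A\<close> for every
  Borel set \<open>A\<close> bounded away from \<open>0\<close>; on such sets Levy measures are finite.\<close>

definition has_characteristics ::
  "'w measure \<Rightarrow> (real \<Rightarrow> 'w \<Rightarrow> real) \<Rightarrow>
     (real \<Rightarrow> real) \<Rightarrow> (real \<Rightarrow> real) \<Rightarrow> (real \<Rightarrow> real measure) \<Rightarrow> bool" where
  "has_characteristics M X B C \<nu> \<longleftrightarrow>
     continuous_on {0..} B \<and> B 0 = 0 \<and>
     mono_on {0..} C \<and> continuous_on {0..} C \<and> C 0 = 0 \<and>
     (\<forall>t\<ge>0. levy_measure (\<nu> t)) \<and>
     (\<forall>s t. 0 \<le> s \<and> s \<le> t \<longrightarrow> (\<forall>A\<in>sets borel. emeasure (\<nu> s) A \<le> emeasure (\<nu> t) A)) \<and>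
     (\<forall>e>0. \<forall>A\<in>sets borel. A \<subseteq> {x. \<bar>x\<bar> > e} \<longrightarrow> continuous_on {0..} (\<lambda>t. measure (\<nu> t) A)) \<and>
     (\<forall>A\<in>sets borel. emeasure (\<nu> 0) A = 0) \<and>
     (\<forall>t\<ge>0. \<forall>l::real.
        char (distr M borel (X t)) l =
          exp (\<i> * complex_of_real (l * B t) - complex_of_real (l\<^sup>2 * C t / 2)
               + (CLINT x|\<nu> t. iexp (l * x) - 1
                     - \<i> * complex_of_real (l * x * indicator {x. \<bar>x\<bar> \<le> 1} x))))"


section \<open>The function \<open>y\<close>\<close>

definition G_fun :: "(real \<Rightarrow> real measure) \<Rightarrow> real \<Rightarrow> real \<Rightarrow> real" where
  "G_fun \<nu> t r = measure (\<nu> t) {x. \<bar>x\<bar> > r}"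

definition K_fun :: "(real \<Rightarrow> real) \<Rightarrow> (real \<Rightarrow> real measure) \<Rightarrow> real \<Rightarrow> real \<Rightarrow> real" where
  "K_fun C \<nu> t r = (C t + (LINT x:{x. \<bar>x\<bar> \<le> r}|\<nu> t. x\<^sup>2)) / r\<^sup>2"

definition M_fun :: "(real \<Rightarrow> real) \<Rightarrow> (real \<Rightarrow> real measure) \<Rightarrow> real \<Rightarrow> real \<Rightarrow> real" where
  "M_fun B \<nu> t r =
     \<bar>B t + (LINT x:{x. 1 < \<bar>x\<bar> \<and> \<bar>x\<bar> \<le> max r 1}|\<nu> t. x)
          - (LINT x:{x. min r 1 < \<bar>x\<bar> \<and> \<bar>x\<bar> \<le> 1}|\<nu> t. x)\<bar> / r"

text \<open>\<open>M_fun B \<nu> s r\<close> is continuous in \<open>s\<close> for characteristics, so this supremum is a maximum.\<close>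

definition M_star :: "(real \<Rightarrow> real) \<Rightarrow> (real \<Rightarrow> real measure) \<Rightarrow> real \<Rightarrow> real \<Rightarrow> real" where
  "M_star B \<nu> t r = (SUP s\<in>{0..t}. M_fun B \<nu> s r)"

definition y_real ::
  "(real \<Rightarrow> real) \<Rightarrow> (real \<Rightarrow> real) \<Rightarrow> (real \<Rightarrow> real measure) \<Rightarrow> real \<Rightarrow> real \<Rightarrow> real" where
  "y_real B C \<nu> t r = G_fun \<nu> t r + K_fun C \<nu> t r + M_star B \<nu> t r"

definition y_fun ::
  "('d::finite \<Rightarrow> real \<Rightarrow> real) \<Rightarrow> ('d \<Rightarrow> real \<Rightarrow> real) \<Rightarrow> ('d \<Rightarrow> real \<Rightarrow> real measure) \<Rightarrow>
     real \<Rightarrow> real \<Rightarrow> real" where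
  "y_fun B C \<nu> t r = (\<Sum>i\<in>UNIV. y_real (B i) (C i) (\<nu> i) t r)"


section \<open>Indices, slow functions and time changes\<close>

definition delta_index :: "(real \<Rightarrow> real \<Rightarrow> real) \<Rightarrow> real \<Rightarrow> real" where
  "delta_index y b = Inf {\<eta>. \<eta> \<ge> 0 \<and> Liminf (at_right 0) (\<lambda>r. ereal (r powr \<eta> * y b r)) = 0}"

definition beta_index :: "(real \<Rightarrow> real \<Rightarrow> real) \<Rightarrow> real \<Rightarrow> real" where
  "beta_index y b = Inf {\<eta>. \<eta> \<ge> 0 \<and> ((\<lambda>r. r powr \<eta> * y b r) \<longlongrightarrow> 0) (at_right 0)}"

definition slow_function :: "(real \<Rightarrow> real) \<Rightarrow> bool" where
  "slow_function c \<longleftrightarrow>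
     (\<forall>r\<in>{0<..<1}. 0 < c r \<and> c r < 1) \<and>
     (\<forall>\<eta>>0. Liminf (at_right 0) (\<lambda>r. ereal (c r * r powr (- \<eta>))) > 0)"

text \<open>The time changes take values in \<open>[0, \<infinity>]\<close>, so that \<open>inf \<emptyset> = \<infinity>\<close>, \<open>sup \<emptyset> = 0\<close> and the
  supremum of an unbounded set is \<open>\<infinity>\<close>.  The set \<open>I\<close> is the range of exponents over which the
  defining inequality is imposed; it is a half-open interval ending or starting at
  \<open>delta_index\<close> (for \<open>v\<close>) or \<open>beta_index\<close> (for \<open>u\<close>).\<close>

definition upper_time ::
  "(real \<Rightarrow> real \<Rightarrow> real) \<Rightarrow> real \<Rightarrow> (real \<Rightarrow> real) \<Rightarrow> real set \<Rightarrow> real \<Rightarrow> ennreal" where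
  "upper_time y b c I t =
     Inf {ennreal s | s. s > 0 \<and>
            (\<forall>\<eta>\<in>I. y s (t powr (1 / \<eta>)) \<ge> c t * t * y b (t powr (1 / \<eta>)))}"

definition lower_time ::
  "(real \<Rightarrow> real \<Rightarrow> real) \<Rightarrow> real \<Rightarrow> (real \<Rightarrow> real) \<Rightarrow> real set \<Rightarrow> real \<Rightarrow> ennreal" where
  "lower_time y b c I t =
     Sup {ennreal s | s. s > 0 \<and>
            (\<forall>\<eta>\<in>I. y s (t powr (1 / \<eta>)) \<le> inverse (c t) * t * y b (t powr (1 / \<eta>)))}"

text \<open>\<open>X\<^sup>*\<close> at a time in \<open>[0, \<infinity>]\<close>.\<close>

definition running_sup :: "(real \<Rightarrow> 'w \<Rightarrow> real ^ 'd) \<Rightarrow> ennreal \<Rightarrow> 'w \<Rightarrow> ennreal" where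
  "running_sup X T \<omega> = (SUP s\<in>{s. 0 \<le> s \<and> ennreal s \<le> T}. ennreal (norm (X s \<omega>)))"

end

theory Submission
  imports Defs
begin

text \<open>
  Fix a level \<open>r \<le> 1\<close>.  From the Levy-Khintchine formula one gets two estimates with the same function
  \<open>y\<close>: by truncation and Etemadi's inequality \<open>P(X\<^sup>*\<^sub>T > C r)\<close> is at most a constant times \<open>y\<^sub>T(r)\<close>, and
  \<open>P(X\<^sup>*\<^sub>T \<le> r)\<close> is at most a constant times \<open>y\<^sub>T(r)\<close> to the power \<open>-1/2\<close>.  For the second one, \<open>[0, T]\<close>
  is cut into \<open>n\<close> pieces carrying equal shares of \<open>G + K\<close>.  If \<open>G + K\<close> is large, each share exceeds
  a fixed constant, so each increment leaves \<open>[-2r, 2r]\<close> with probability bounded below, independently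
  of the others.  If \<open>M\<^sup>*\<close> dominates, the shares can be made small while the drift over some piece
  exceeds \<open>4r\<close>, and the increment over that piece stays close to its drift.

  Applied to levels \<open>r\<^sub>j\<close> tending to \<open>0\<close> at least geometrically, and to the first (last) time at which
  \<open>y\<^sub>s(r\<^sub>j)\<close> is at least \<open>r\<^sub>j\<close> to a negative power (at most \<open>r\<^sub>j\<close> to a positive power), both estimates
  are summable.  The time changes are defined by a condition on a whole interval of exponents \<open>\<eta>\<close>, so
  for every small \<open>t\<close> one of the levels has the form \<open>r\<^sub>j = t\<close> to the power \<open>1/\<eta>\<close>; hence countably many
  levels control all \<open>t\<close>, although the time changes need not be monotone in \<open>t\<close>.
\<close>

section \<open>Integrals against increasing measures\<close>

text \<open>The Levy measure of an increment over \<open>[u, v]\<close> would be the difference of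
  \<open>\<nu> v\<close> and \<open>\<nu> u\<close>. It is never formed: each estimate concerns a
  difference of two integrals and rests on monotonicity in time. Characteristic functions are traded
  for probabilities, and for integrals of min(1, (x/r)^2), by averaging 1 - cos(\<theta> x / r) over
  \<theta>, which is comparable with that function from both sides. The power -1/2 is the price for
  not knowing whether \<open>G + K\<close> or the drift dominates. With sqrt(y) as threshold for
  \<open>G + K\<close>, one case decays like 1 / sqrt(y); in the other, about y pieces share a total
  below sqrt(y), which gives sqrt(y) / y again. Coordinates may depend on each other. The upper
  bound for the running supremum is therefore taken in every coordinate, while the lower bound
  follows one coordinate that carries at least the share 1/d of \<open>y\<close>. Measurability of
  the running supremum is avoided: the events involve finitely or countably many times, and
  right-continuous paths do the rest.\<close>

lemma integral_mono_measure_nonneg: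
  fixes f :: "'a \<Rightarrow> real"
  assumes sets: "sets \<mu> = sets \<mu>'"
    and le: "\<And>A. A \<in> sets \<mu>' \<Longrightarrow> emeasure \<mu> A \<le> emeasure \<mu>' A"
    and int: "integrable \<mu>' f" and nonneg: "\<And>x. f x \<ge> 0"
  shows "integrable \<mu> f" "(LINT x|\<mu>. f x) \<le> (LINT x|\<mu>'. f x)"
proof -
  have le': "\<mu> \<le> \<mu>'"
    using sets le sets_eq_imp_space_eq[OF sets] by (simp add: le_measure le_fun_def emeasure_notin_sets)
  have nn: "(\<integral>\<^sup>+x. f x \<partial>\<mu>) \<le> (\<integral>\<^sup>+x. f x \<partial>\<mu>')"
    by (rule nn_integral_mono_measure[OF sets le'])
  have fin: "(\<integral>\<^sup>+x. f x \<partial>\<mu>') < \<infinity>"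
    using int nonneg by (subst nn_integral_eq_integral) auto
  have "f \<in> borel_measurable \<mu>"
    using int measurable_cong_sets[OF sets refl, of borel] by (auto dest: borel_measurable_integrable)
  then show I: "integrable \<mu> f"
    using nn fin nonneg by (intro integrableI_nonneg) auto
  show "(LINT x|\<mu>. f x) \<le> (LINT x|\<mu>'. f x)"
    using nn nonneg by (simp add: nn_integral_eq_integral[OF int] nn_integral_eq_integral[OF I])
qed

text \<open>Monotonicity in the measure is applied to the nonnegative functions g + f and g - f. The
  result replaces the bound of an integral of f by that of g for the measure \<mu>' - \<mu>.\<close>

lemma integral_diff_le_measure_mono:
  fixes f g :: "'a \<Rightarrow> real"
  assumes sets: "sets \<mu> = sets \<mu>'"
    and le: "\<And>A. A \<in> sets \<mu>' \<Longrightarrow> emeasure \<mu> A \<le> emeasure \<mu>' A"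
    and g: "integrable \<mu>' g" and f: "f \<in> borel_measurable \<mu>'" and bound: "\<And>x. \<bar>f x\<bar> \<le> g x"
  shows "\<bar>(LINT x|\<mu>'. f x) - (LINT x|\<mu>. f x)\<bar> \<le> (LINT x|\<mu>'. g x) - (LINT x|\<mu>. g x)"
proof -
  have g0: "g x \<ge> 0" for x using bound[of x] by linarith
  have f': "integrable \<mu>' f" by (rule Bochner_Integration.integrable_bound[OF g f]) (use bound g0 in auto)
  have gi: "integrable \<mu> g" by (rule integral_mono_measure_nonneg(1)[OF sets le g g0])
  have f_meas: "f \<in> borel_measurable \<mu>"
    using f measurable_cong_sets[OF sets refl, of borel] by auto
  have fi: "integrable \<mu> f" by (rule Bochner_Integration.integrable_bound[OF gi f_meas]) (use bound g0 in auto)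
  have "(LINT x|\<mu>. g x + f x) \<le> (LINT x|\<mu>'. g x + f x)"
    by (rule integral_mono_measure_nonneg(2)[OF sets le]) (use g f' bound in \<open>auto simp: abs_le_iff algebra_simps\<close>,
        smt (verit) bound)
  moreover have "(LINT x|\<mu>. g x - f x) \<le> (LINT x|\<mu>'. g x - f x)"
    by (rule integral_mono_measure_nonneg(2)[OF sets le]) (use g f' bound in \<open>auto simp: abs_le_iff\<close>)
  ultimately show ?thesis using g f' gi fi by simp
qed

text \<open>Real and imaginary parts are bounded separately, which costs the factor 2.\<close>

lemma cmod_integral_diff_le_measure_mono:
  fixes f :: "'a \<Rightarrow> complex" and g :: "'a \<Rightarrow> real"
  assumes sets: "sets \<mu> = sets \<mu>'"
    and le: "\<And>A. A \<in> sets \<mu>' \<Longrightarrow> emeasure \<mu> A \<le> emeasure \<mu>' A"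
    and g: "integrable \<mu>' g" and f: "f \<in> borel_measurable \<mu>'" and bound: "\<And>x. cmod (f x) \<le> g x"
  shows "cmod ((CLINT x|\<mu>'. f x) - (CLINT x|\<mu>. f x)) \<le> 2 * ((LINT x|\<mu>'. g x) - (LINT x|\<mu>. g x))"
proof -
  have g0: "g x \<ge> 0" for x using bound[of x] norm_ge_zero[of "f x"] by linarith
  have f': "integrable \<mu>' f" by (rule Bochner_Integration.integrable_bound[OF g f]) (use bound g0 in auto)
  have gi: "integrable \<mu> g" by (rule integral_mono_measure_nonneg(1)[OF sets le g g0])
  have f_meas: "f \<in> borel_measurable \<mu>"
    using f measurable_cong_sets[OF sets refl, of borel] by auto
  have fi: "integrable \<mu> f" by (rule Bochner_Integration.integrable_bound[OF gi f_meas]) (use bound g0 in auto)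
  have "\<bar>(LINT x|\<mu>'. Re (f x)) - (LINT x|\<mu>. Re (f x))\<bar> \<le> (LINT x|\<mu>'. g x) - (LINT x|\<mu>. g x)"
    by (rule integral_diff_le_measure_mono[OF sets le g])
       (use f bound in \<open>auto intro: order_trans[OF abs_Re_le_cmod]\<close>)
  note Re = this
  have "\<bar>(LINT x|\<mu>'. Im (f x)) - (LINT x|\<mu>. Im (f x))\<bar> \<le> (LINT x|\<mu>'. g x) - (LINT x|\<mu>. g x)"
    by (rule integral_diff_le_measure_mono[OF sets le g])
       (use f bound in \<open>auto intro: order_trans[OF abs_Im_le_cmod]\<close>)
  note Im = this
  have "cmod ((CLINT x|\<mu>'. f x) - (CLINT x|\<mu>. f x)) \<le>
      \<bar>(LINT x|\<mu>'. Re (f x)) - (LINT x|\<mu>. Re (f x))\<bar> + \<bar>(LINT x|\<mu>'. Im (f x)) - (LINT x|\<mu>. Im (f x))\<bar>"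
    using f' fi by (intro order_trans[OF cmod_le]) simp
  also note add_mono[OF Re Im]
  finally show ?thesis by (simp add: algebra_simps)
qed


section \<open>Averages of \<open>1 - cos\<close>\<close>

text \<open>The mean of 1 - cos(\<theta> a) over \<theta> in [0, 1]. The value at 0 is set by hand,
  because division by zero would turn the formula into 1.\<close>

definition cos_avg :: "real \<Rightarrow> real" where
  "cos_avg a = (if a = 0 then 0 else 1 - sin a / a)"

lemma cos_avg_measurable [measurable]: "cos_avg \<in> borel_measurable borel"
  unfolding cos_avg_def[abs_def] by measurable

lemma has_integral_cos_avg: "((\<lambda>\<theta>. 1 - cos (\<theta> * a)) has_integral cos_avg a) {0..1}"
proof (cases "a = 0")
  case False
  have "((\<lambda>\<theta>. 1 - cos (\<theta> * a)) has_integral (1 - sin (1 * a) / a) - (0 - sin (0 * a) / a)) {0..1}"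
    using False
    by (intro fundamental_theorem_of_calculus)
       (auto intro!: derivative_eq_intros simp flip: has_real_derivative_iff_has_vector_derivative)
  then show ?thesis using False by (simp add: cos_avg_def)
qed (simp add: cos_avg_def)

lemma cos_avg_nonneg: "cos_avg a \<ge> 0"
  by (rule has_integral_nonneg[OF has_integral_cos_avg]) simp

lemma nn_integral_cos_avg:
  "(\<integral>\<^sup>+\<theta>. ennreal (1 - cos (\<theta> * a)) * indicator {0..1} \<theta> \<partial>lborel) = ennreal (cos_avg a)"
  proof -
  have "(\<lambda>\<theta>. (1 - cos (\<theta> * a)) * indicator {0..1} \<theta>) = (\<lambda>\<theta>. if \<theta> \<in> {0..1} then 1 - cos (\<theta> * a) else 0)"
    by auto
  then have "((\<lambda>\<theta>. (1 - cos (\<theta> * a)) * indicator {0..1} \<theta>) has_integral cos_avg a) UNIV"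
    using has_integral_cos_avg[of a] by (simp only: has_integral_restrict_UNIV)
  then have "(\<integral>\<^sup>+\<theta>. ennreal ((1 - cos (\<theta> * a)) * indicator {0..1} \<theta>) \<partial>lborel) = ennreal (cos_avg a)"
    by (intro nn_integral_has_integral_lborel) auto
  then show ?thesis by (simp add: ennreal_mult' ennreal_indicator)
qed

lemma cos_avg_ge_half: assumes "\<bar>a\<bar> \<ge> 2" shows "cos_avg a \<ge> 1 / 2"
proof -
  have "\<bar>sin a / a\<bar> \<le> 1 / 2"
    using assms abs_sin_le_one[of a] by (auto simp: abs_divide divide_le_eq simp del: abs_sin_le_one)
  moreover have "a \<noteq> 0" using assms by auto
  ultimately show ?thesis unfolding cos_avg_def by (simp only: if_False)
qed

text \<open>For |a| < 2 the Taylor expansion of the sine gives 1 - sin a / a >= a^2/6 - a^4/120, and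
  a^4 <= 4 a^2 leaves (1/6 - 1/30) a^2 >= a^2/8. For larger |a| the bound 1/2 is more than
  enough.\<close>

lemma cos_avg_ge: "cos_avg a \<ge> min 1 (a\<^sup>2) / 8"
proof (cases "\<bar>a\<bar> \<ge> 2")
  case True
  then show ?thesis using cos_avg_ge_half[of a] by (auto simp: min_def)
next
  case False
  show ?thesis
  proof (cases "a = 0")
    case False
    have "\<bar>sin a - (\<Sum>m<5. sin_coeff m * a ^ m)\<bar> \<le> inverse (fact 5) * \<bar>a\<bar> ^ 5"
      by (rule Maclaurin_sin_bound)
    moreover have "(\<Sum>m<5. sin_coeff m * a ^ m) = a - a ^ 3 / 6"
      by (simp add: sin_coeff_def lessThan_nat_numeral lessThan_Suc fact_numeral)
    ultimately have "\<bar>sin a - (a - a ^ 3 / 6)\<bar> \<le> \<bar>a\<bar> ^ 5 / 120"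
      by (simp add: fact_numeral)
    then have "\<bar>(sin a - (a - a ^ 3 / 6)) / a\<bar> \<le> \<bar>a\<bar> ^ 5 / 120 / \<bar>a\<bar>"
      unfolding abs_divide by (rule divide_right_mono) simp
    moreover have "\<bar>a\<bar> ^ 5 / 120 / \<bar>a\<bar> = a ^ 2 * a ^ 2 / 120"
      using False by (simp add: power_eq_if abs_mult[symmetric])
    moreover have "(sin a - (a - a ^ 3 / 6)) / a = sin a / a - 1 + a\<^sup>2 / 6"
      using False by (simp add: field_simps power_eq_if)
    ultimately have "sin a / a \<le> 1 - a\<^sup>2 / 6 + a\<^sup>2 * a\<^sup>2 / 120" by linarith
    moreover have "a\<^sup>2 * a\<^sup>2 \<le> a\<^sup>2 * 4"
      using \<open>\<not> \<bar>a\<bar> \<ge> 2\<close> power_mono[of "\<bar>a\<bar>" 2 2] by (intro mult_left_mono) auto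
    ultimately have "1 - sin a / a \<ge> a\<^sup>2 / 8"
      using zero_le_power2[of a] by linarith
    then have "cos_avg a \<ge> a\<^sup>2 / 8" using False unfolding cos_avg_def by (simp only: if_False)
    then show ?thesis by (simp add: min_def)
  qed (simp add: cos_avg_def)
qed

text \<open>The hypothesis is integrated over \<theta> in [0, 1] and the integrals are exchanged;
  the constant \<open>K\<close> survives because the interval has length 1. The second measure
  stands on the right as a summand, since subtraction of possibly infinite integrals would lose
  information.\<close>

lemma tonelli_cos_avg:
  assumes \<mu>: "sigma_finite_measure \<mu>" "sets \<mu> = sets borel"
    and \<mu>': "sigma_finite_measure \<mu>'" "sets \<mu>' = sets borel"
    and K: "K \<ge> 0"
    and le: "\<And>\<theta>. 0 \<le> \<theta> \<Longrightarrow> \<theta> \<le> 1 \<Longrightarrow>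
      (\<integral>\<^sup>+x. ennreal (1 - cos (\<theta> * (x / r))) \<partial>\<mu>) \<le> (\<integral>\<^sup>+x. ennreal (1 - cos (\<theta> * (x / r))) \<partial>\<mu>') + ennreal K"
  shows "(\<integral>\<^sup>+x. ennreal (cos_avg (x / r)) \<partial>\<mu>) \<le> (\<integral>\<^sup>+x. ennreal (cos_avg (x / r)) \<partial>\<mu>') + ennreal K"
proof -
  have *: "(\<integral>\<^sup>+x. ennreal (cos_avg (x / r)) \<partial>\<rho>) =
      (\<integral>\<^sup>+\<theta>. (\<integral>\<^sup>+x. ennreal (1 - cos (\<theta> * (x / r))) \<partial>\<rho>) * indicator {0..1} \<theta> \<partial>lborel)"
    and meas: "(\<lambda>\<theta>. \<integral>\<^sup>+x. ennreal (1 - cos (\<theta> * (x / r))) \<partial>\<rho>) \<in> borel_measurable borel"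
    if "sigma_finite_measure \<rho>" "sets \<rho> = sets borel" for \<rho> :: "real measure"
  proof -
    interpret \<rho>: sigma_finite_measure \<rho> by fact
    interpret P: pair_sigma_finite \<rho> lborel ..
    note [measurable_cong] = that(2)
    have "(\<integral>\<^sup>+x. ennreal (cos_avg (x / r)) \<partial>\<rho>) =
        (\<integral>\<^sup>+x. (\<integral>\<^sup>+\<theta>. ennreal (1 - cos (\<theta> * (x / r))) * indicator {0..1} \<theta> \<partial>lborel) \<partial>\<rho>)"
      by (simp only: nn_integral_cos_avg)
    also have "\<dots> = (\<integral>\<^sup>+\<theta>. (\<integral>\<^sup>+x. ennreal (1 - cos (\<theta> * (x / r))) * indicator {0..1} \<theta> \<partial>\<rho>) \<partial>lborel)"
      by (rule P.Fubini'[symmetric]) measurable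
    finally show "(\<integral>\<^sup>+x. ennreal (cos_avg (x / r)) \<partial>\<rho>) =
      (\<integral>\<^sup>+\<theta>. (\<integral>\<^sup>+x. ennreal (1 - cos (\<theta> * (x / r))) \<partial>\<rho>) * indicator {0..1} \<theta> \<partial>lborel)"
      by (simp add: nn_integral_multc)
    show "(\<lambda>\<theta>. \<integral>\<^sup>+x. ennreal (1 - cos (\<theta> * (x / r))) \<partial>\<rho>) \<in> borel_measurable borel"
      by measurable
  qed
  note [measurable] = meas[OF \<mu>']
  have "(\<integral>\<^sup>+x. ennreal (cos_avg (x / r)) \<partial>\<mu>) \<le>
     (\<integral>\<^sup>+\<theta>. ((\<integral>\<^sup>+x. ennreal (1 - cos (\<theta> * (x / r))) \<partial>\<mu>') + ennreal K) * indicator {0..1} \<theta> \<partial>lborel)"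
    unfolding *[OF \<mu>] by (intro nn_integral_mono) (auto simp: le[simplified] split: split_indicator)
  also have "\<dots> = (\<integral>\<^sup>+x. ennreal (cos_avg (x / r)) \<partial>\<mu>') + ennreal K"
    unfolding *[OF \<mu>'] by (simp add: distrib_right nn_integral_add nn_integral_cmult del: times_divide_eq_right)
  finally show ?thesis .
qed

text \<open>The truncation inequality. The real part of 1 - char at \<theta>/r is the expectation of
  1 - cos(\<theta> Y / r); averaging over \<theta> bounds the expectation of \<open>cos_avg\<close>
  at Y / r by \<open>D\<close>, and this variable is at least 1/2 where |Y| >= 2r. Choosing the null
  measure as second measure in \<open>tonelli_cos_avg\<close> turns the comparison into a bound for
  one measure.\<close>

lemma (in prob_space) prob_ge_le_char:
  assumes [measurable]: "Y \<in> borel_measurable M" and r: "r > 0" and D: "D \<ge> 0"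
    and char: "\<And>\<theta>. 0 \<le> \<theta> \<Longrightarrow> \<theta> \<le> 1 \<Longrightarrow> cmod (1 - char (distr M borel Y) (\<theta> / r)) \<le> D"
  shows "prob {\<omega> \<in> space M. \<bar>Y \<omega>\<bar> \<ge> 2 * r} \<le> 2 * D"
proof -
  interpret Y: prob_space "distr M borel Y" by (rule prob_space_distr) simp
  interpret Y: real_distribution "distr M borel Y" by unfold_locales simp_all
  have "(\<integral>\<^sup>+x. ennreal (cos_avg (x / r)) \<partial>distr M borel Y) \<le>
      (\<integral>\<^sup>+x. ennreal (cos_avg (x / r)) \<partial>null_measure borel) + ennreal D"
  proof (rule tonelli_cos_avg)
    show "sigma_finite_measure (null_measure (borel :: real measure))"
      by (intro finite_measure.axioms(1) finite_measureI) simp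
    fix \<theta> :: real assume \<theta>: "0 \<le> \<theta>" "\<theta> \<le> 1"
    have int: "integrable (distr M borel Y) (\<lambda>x. iexp (\<theta> / r * x))"
      by (rule Y.integrable_iexp) auto
    have int': "integrable (distr M borel Y) (\<lambda>x. 1 - cos (\<theta> * (x / r)))"
    proof (rule Y.integrable_const_bound[where B=2], rule AE_I2)
      show "norm (1 - cos (\<theta> * (x / r))) \<le> 2" for x
        using cos_ge_minus_one[of "\<theta> * (x / r)"] cos_le_one[of "\<theta> * (x / r)"] unfolding real_norm_def by linarith
    qed simp
    have "(LINT x|distr M borel Y. 1 - cos (\<theta> * (x / r))) =
        (LINT x|distr M borel Y. Re (1 - iexp (\<theta> / r * x)))"
      by (simp add: Re_exp)
    also have "\<dots> = Re (CLINT x|distr M borel Y. 1 - iexp (\<theta> / r * x))"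
      using int by (intro integral_Re) auto
    also have "\<dots> = Re (1 - char (distr M borel Y) (\<theta> / r))"
      using int Y.prob_space by (simp add: char_def Bochner_Integration.integral_diff)
    also have "\<dots> \<le> D" using char[OF \<theta>] complex_Re_le_cmod order_trans by blast
    finally show "(\<integral>\<^sup>+x. ennreal (1 - cos (\<theta> * (x / r))) \<partial>distr M borel Y) \<le>
      (\<integral>\<^sup>+x. ennreal (1 - cos (\<theta> * (x / r))) \<partial>null_measure borel) + ennreal D"
      by (subst nn_integral_eq_integral[OF int']) (auto simp: ennreal_leI)
  qed (use D in \<open>simp_all add: Y.sigma_finite_measure_axioms\<close>)
  then have le: "(\<integral>\<^sup>+x. ennreal (cos_avg (x / r)) \<partial>distr M borel Y) \<le> ennreal D" by simp
  have "ennreal (1 / 2) * emeasure M {\<omega> \<in> space M. \<bar>Y \<omega>\<bar> \<ge> 2 * r} =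
      (\<integral>\<^sup>+\<omega>. ennreal (1 / 2) * indicator {\<omega> \<in> space M. \<bar>Y \<omega>\<bar> \<ge> 2 * r} \<omega> \<partial>M)"
    by (rule nn_integral_cmult_indicator[symmetric]) measurable
  also have "\<dots> \<le> (\<integral>\<^sup>+\<omega>. ennreal (cos_avg (Y \<omega> / r)) \<partial>M)"
    using r cos_avg_ge_half
    by (intro nn_integral_mono) (auto split: split_indicator simp: ennreal_leI abs_divide le_divide_eq simp del: ennreal_half)
  also have "\<dots> = (\<integral>\<^sup>+x. ennreal (cos_avg (x / r)) \<partial>distr M borel Y)"
    by (subst nn_integral_distr) auto
  also note le
  finally have "ennreal (1 / 2 * prob {\<omega> \<in> space M. \<bar>Y \<omega>\<bar> \<ge> 2 * r}) \<le> ennreal D"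
    by (subst ennreal_mult) (simp_all add: emeasure_eq_measure)
  then show ?thesis using D by (subst (asm) ennreal_le_iff) auto
qed


section \<open>Levy measures\<close>

text \<open>Its integral against \<open>\<nu> t\<close> is \<open>G_fun\<close> plus the jump part
  of \<open>K_fun\<close>, so one integrand serves for both.\<close>

definition trunc :: "real \<Rightarrow> real \<Rightarrow> real" where
  "trunc r x = min 1 ((x / r)\<^sup>2)"

lemma trunc_measurable [measurable]: "trunc r \<in> borel_measurable borel"
  unfolding trunc_def[abs_def] by measurable

lemma trunc_nonneg [simp]: "trunc r x \<ge> 0" by (simp add: trunc_def)

lemma trunc_le_1: "trunc r x \<le> 1" by (simp add: trunc_def)

lemma trunc_eq_1: "r > 0 \<Longrightarrow> \<bar>x\<bar> > r \<Longrightarrow> trunc r x = 1"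
  using one_le_power[of "\<bar>x\<bar> / r" 2] by (simp add: trunc_def power_divide)

lemma trunc_eq_square: "r > 0 \<Longrightarrow> \<bar>x\<bar> \<le> r \<Longrightarrow> trunc r x = (x / r)\<^sup>2"
  using power_le_one[of "\<bar>x\<bar> / r" 2] by (simp add: trunc_def power_divide)

lemma trunc_le:
  assumes "0 < r" "r \<le> 1" shows "trunc r x \<le> trunc 1 x / r\<^sup>2"
proof -
  have "1 \<le> 1 / r\<^sup>2" using assms power_le_one[of r 2] by simp
  then show ?thesis by (auto simp: trunc_def min_def power_divide)
qed

lemma levy_sets: "levy_measure \<mu> \<Longrightarrow> sets \<mu> = sets borel"
  by (simp add: levy_measure_def)

lemma integrable_trunc:
  assumes \<mu>: "levy_measure \<mu>" and r: "r > 0"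
  shows "integrable \<mu> (trunc r)"
proof -
  note [measurable_cong] = levy_sets[OF \<mu>]
  have 1: "integrable \<mu> (trunc 1)"
    using \<mu> by (intro integrableI_nonneg) (auto simp: levy_measure_def trunc_def)
  have "trunc r x \<le> (1 + 1 / r\<^sup>2) * trunc 1 x" for x
  proof (cases "\<bar>x\<bar> \<le> 1")
    case True
    have "trunc r x \<le> x\<^sup>2 / r\<^sup>2" by (simp add: trunc_def power_divide)
    also have "\<dots> \<le> (1 + 1 / r\<^sup>2) * x\<^sup>2" by (simp add: algebra_simps)
    finally show ?thesis using True by (simp add: trunc_eq_square)
  next
    case False
    then show ?thesis using r trunc_le_1[of r x] by (simp add: trunc_eq_1) (smt (verit) divide_nonneg_nonneg zero_le_power2)
  qed
  then show ?thesis
    by (intro Bochner_Integration.integrable_bound[OF integrable_mult_right[OF 1, of "1 + 1 / r\<^sup>2"]]) auto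
qed

lemma emeasure_levy_finite:
  assumes \<mu>: "levy_measure \<mu>" and r: "r > 0"
  shows "emeasure \<mu> {x. \<bar>x\<bar> > r} < \<infinity>"
proof -
  note [measurable_cong] = levy_sets[OF \<mu>]
  have "emeasure \<mu> {x. \<bar>x\<bar> > r} = (\<integral>\<^sup>+x. indicator {x. \<bar>x\<bar> > r} x \<partial>\<mu>)" by simp
  also have "\<dots> \<le> (\<integral>\<^sup>+x. trunc r x \<partial>\<mu>)"
    using r by (intro nn_integral_mono) (auto simp: trunc_eq_1 split: split_indicator)
  also have "\<dots> < \<infinity>"
    using integrable_trunc[OF \<mu> r] by (subst nn_integral_eq_integral) auto
  finally show ?thesis .
qed

lemma integrable_levy_away:
  fixes f :: "real \<Rightarrow> real"
  assumes \<mu>: "levy_measure \<mu>" and r: "r > 0"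
    and [measurable]: "f \<in> borel_measurable borel" and f: "\<And>x. \<bar>f x\<bar> \<le> K * indicator {x. \<bar>x\<bar> > r} x"
  shows "integrable \<mu> f"
proof -
  note [measurable_cong] = levy_sets[OF \<mu>]
  show ?thesis
  proof (rule Bochner_Integration.integrable_bound)
    show "integrable \<mu> (\<lambda>x. K * indicator {x. \<bar>x\<bar> > r} x)"
      using emeasure_levy_finite[OF \<mu> r] by (intro integrable_mult_right) (simp add: integrable_indicator_iff)
    show "AE x in \<mu>. norm (f x) \<le> norm (K * indicator {x. \<bar>x\<bar> > r} x)"
      unfolding real_norm_def by (intro AE_I2 order_trans[OF f] abs_ge_self)
  qed measurable
qed

lemma sigma_finite_levy:
  assumes \<mu>: "levy_measure \<mu>" shows "sigma_finite_measure \<mu>"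
proof
  let ?A = "insert {0} (range (\<lambda>n::nat. {x::real. \<bar>x\<bar> > 1 / Suc n}))"
  have "\<exists>n::nat. \<bar>x\<bar> > 1 / Suc n" if "x \<noteq> 0" for x :: real
    using that reals_Archimedean[of "\<bar>x\<bar>"] by (auto simp: inverse_eq_divide)
  then have "\<Union>?A = UNIV" by blast
  moreover have "emeasure \<mu> a \<noteq> \<infinity>" if "a \<in> ?A" for a
    using that \<mu> emeasure_levy_finite[OF \<mu>] by (auto simp: levy_measure_def less_top)
  ultimately show "\<exists>A. countable A \<and> A \<subseteq> sets \<mu> \<and> \<Union>A = space \<mu> \<and> (\<forall>a\<in>A. emeasure \<mu> a \<noteq> \<infinity>)"
    using levy_sets[OF \<mu>] sets_eq_imp_space_eq[OF levy_sets[OF \<mu>]]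
    by (intro exI[of _ ?A]) auto
qed

text \<open>The Levy-Khintchine integrand with the compensator cut at r instead of 1. With this cut
  it is dominated by a multiple of \<open>trunc r\<close> that stays bounded as long as |l| r
  does.\<close>

definition char_kernel :: "real \<Rightarrow> real \<Rightarrow> real \<Rightarrow> complex" where
  "char_kernel r l x = iexp (l * x) - 1 - \<i> * complex_of_real (l * x * indicator {x. \<bar>x\<bar> \<le> r} x)"

lemma char_kernel_measurable [measurable]: "char_kernel r l \<in> borel_measurable borel"
  unfolding char_kernel_def[abs_def] by measurable

lemma cmod_char_kernel_le:
  assumes "r > 0"
  shows "cmod (char_kernel r l x) \<le> (2 + (l * r)\<^sup>2 / 2) * trunc r x"
proof (cases "\<bar>x\<bar> \<le> r")
  case True
  have "cmod (char_kernel r l x) \<le> (l * x)\<^sup>2 / 2"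
    using iexp_approx1[of "l * x" 1] True by (simp add: char_kernel_def power2_eq_square diff_diff_eq)
  also have "\<dots> = (l * r)\<^sup>2 / 2 * (x / r)\<^sup>2" using assms by (simp add: power2_eq_square)
  also have "\<dots> \<le> (2 + (l * r)\<^sup>2 / 2) * (x / r)\<^sup>2" by (intro mult_right_mono) auto
  finally show ?thesis using True assms by (simp add: trunc_eq_square)
next
  case False
  have "cmod (char_kernel r l x) \<le> 2"
    using False norm_triangle_ineq4[of "iexp (l * x)" 1] by (simp add: char_kernel_def)
  also have "\<dots> \<le> 2 + (l * r)\<^sup>2 / 2" by simp
  finally show ?thesis using False assms by (simp add: trunc_eq_1)
qed

lemma integrable_char_kernel:
  assumes "levy_measure \<mu>" "r > 0"
  shows "integrable \<mu> (char_kernel r l)"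
proof -
  note [measurable_cong] = levy_sets[OF assms(1)]
  show ?thesis
  proof (rule Bochner_Integration.integrable_bound)
    show "integrable \<mu> (\<lambda>x. (2 + (l * r)\<^sup>2 / 2) * trunc r x)"
      by (intro integrable_mult_right integrable_trunc assms)
    show "AE x in \<mu>. cmod (char_kernel r l x) \<le> norm ((2 + (l * r)\<^sup>2 / 2) * trunc r x)"
      unfolding real_norm_def by (intro AE_I2 order_trans[OF cmod_char_kernel_le[OF assms(2)]] abs_ge_self)
  qed measurable
qed

text \<open>The derivative of exp has modulus at most 1 on the convex left half-plane. So the
  distance of a characteristic function from 1 is linear in its exponent, without any smallness
  assumption.\<close>

lemma cmod_one_minus_exp_le:
  assumes "Re w \<le> 0" shows "cmod (1 - exp w) \<le> cmod w"
proof -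
  have "cmod (exp 0 - exp w) \<le> 1 * cmod (0 - w)"
  proof (rule field_differentiable_bound[of "{z. Re z \<le> 0}" exp exp])
    show "convex {z. Re z \<le> 0}" by (rule convex_halfspace_Re_le)
    show "(exp has_field_derivative exp z) (at z within {z. Re z \<le> 0})" for z :: complex
      by (rule DERIV_subset[OF DERIV_exp]) simp
    show "cmod (exp z) \<le> 1" if "z \<in> {z. Re z \<le> 0}" for z using that by (simp add: norm_exp_eq_Re)
  qed (use assms in simp_all)
  then show ?thesis by simp
qed

lemma continuous_on_dominated_increments:
  fixes F m :: "real \<Rightarrow> real"
  assumes m: "continuous_on S m" and le: "\<And>s t. s \<in> S \<Longrightarrow> t \<in> S \<Longrightarrow> \<bar>F t - F s\<bar> \<le> K * \<bar>m t - m s\<bar>"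
  shows "continuous_on S F"
  unfolding continuous_on_def
proof
  fix s assume s: "s \<in> S"
  have "(m \<longlongrightarrow> m s) (at s within S)" using m s by (auto simp: continuous_on_def)
  then have "((\<lambda>t. K * \<bar>m t - m s\<bar>) \<longlongrightarrow> K * \<bar>m s - m s\<bar>) (at s within S)" by (intro tendsto_intros)
  then have lim: "((\<lambda>t. K * \<bar>m t - m s\<bar>) \<longlongrightarrow> 0) (at s within S)" by simp
  have "\<forall>\<^sub>F t in at s within S. norm (F t - F s) \<le> K * \<bar>m t - m s\<bar>"
    by (simp add: eventually_at_filter le[OF s])
  then have "((\<lambda>t. F t - F s) \<longlongrightarrow> 0) (at s within S)" using lim by (rule Lim_null_comparison)
  then show "(F \<longlongrightarrow> F s) (at s within S)" by (simp add: LIM_zero_iff)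
qed

text \<open>Bounds the mean through the pointwise estimates 1 - cos <= 2 and 1 - cos x = 2
  sin^2(x/2). It serves to integrate \<open>cos_avg\<close> against a Levy measure, so the constant
  is crude.\<close>

lemma cos_avg_le_trunc: "cos_avg (x / r) \<le> 2 * trunc r x"
proof -
  let ?a = "x / r"
  have "cos_avg ?a \<le> 2"
  proof (rule has_integral_le[OF has_integral_cos_avg, of "\<lambda>_. 2"])
    show "((\<lambda>_. 2) has_integral (2::real)) {0..1::real}" using has_integral_const_real[of "2::real" 0 1] by simp
    show "1 - cos (\<theta> * ?a) \<le> 2" for \<theta> using cos_ge_minus_one[of "\<theta> * ?a"] by linarith
  qed
  moreover have "cos_avg ?a \<le> 2 * ?a\<^sup>2"
  proof (rule has_integral_le[OF has_integral_cos_avg, of "\<lambda>_. 2 * ?a\<^sup>2"])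
    show "((\<lambda>_. 2 * ?a\<^sup>2) has_integral 2 * ?a\<^sup>2) {0..1::real}"
      using has_integral_const_real[of "2 * ?a\<^sup>2" 0 1] by simp
    fix \<theta> :: real assume \<theta>: "\<theta> \<in> {0..1}"
    have "1 - cos (\<theta> * ?a) = 2 * (sin (\<theta> * ?a / 2))\<^sup>2"
      using cos_double_sin[of "\<theta> * ?a / 2"] by simp
    also have "\<dots> \<le> 2 * (\<theta> * ?a / 2)\<^sup>2"
      using abs_sin_x_le_abs_x[of "\<theta> * ?a / 2"] unfolding abs_le_square_iff by (rule mult_left_mono) simp
    also have "\<dots> = \<theta>\<^sup>2 / 4 * (2 * ?a\<^sup>2)" by (simp add: power2_eq_square)
    also have "\<dots> \<le> 1 * (2 * ?a\<^sup>2)"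
      using \<theta> power_le_one[of \<theta> 2] by (intro mult_right_mono) auto
    finally show "1 - cos (\<theta> * ?a) \<le> 2 * ?a\<^sup>2" by simp
  qed
  ultimately show ?thesis by (simp add: trunc_def min_def)
qed


section \<open>Real additive processes with characteristics\<close>

locale additive_char = prob_space M for M :: "'w measure" +
  fixes X :: "real \<Rightarrow> 'w \<Rightarrow> real" and B C :: "real \<Rightarrow> real" and \<nu> :: "real \<Rightarrow> real measure"
  assumes additive: "additive_process M X" and characteristics: "has_characteristics M X B C \<nu>"
begin

text \<open>This is \<open>G_fun\<close> plus \<open>K_fun\<close> for r > 0, see
  \<open>G_K_eq_mass\<close>. In this form continuity and monotonicity in time are visible.\<close>

definition mass :: "real \<Rightarrow> real \<Rightarrow> real" where
  "mass r t = C t / r\<^sup>2 + (LINT x|\<nu> t. trunc r x)"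

text \<open>The centring that remains when the compensator is cut at r instead of 1. For r <= 1 its
  absolute value divided by r is \<open>M_fun\<close>, see \<open>M_fun_eq_drift\<close>.\<close>

definition drift :: "real \<Rightarrow> real \<Rightarrow> real" where
  "drift r t = B t - (LINT x|\<nu> t. x * indicator {x. r < \<bar>x\<bar> \<and> \<bar>x\<bar> \<le> 1} x)"

lemma levy: "t \<ge> 0 \<Longrightarrow> levy_measure (\<nu> t)"
  and B_cont: "continuous_on {0..} B" and B_0: "B 0 = 0"
  and C_cont: "continuous_on {0..} C" and C_0: "C 0 = 0" and C_mono: "mono_on {0..} C"
  and \<nu>_mono: "0 \<le> s \<Longrightarrow> s \<le> t \<Longrightarrow> A \<in> sets borel \<Longrightarrow> emeasure (\<nu> s) A \<le> emeasure (\<nu> t) A"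
  and \<nu>_cont: "e > 0 \<Longrightarrow> A \<in> sets borel \<Longrightarrow> A \<subseteq> {x. \<bar>x\<bar> > e} \<Longrightarrow> continuous_on {0..} (\<lambda>t. measure (\<nu> t) A)"
  and \<nu>_0: "A \<in> sets borel \<Longrightarrow> emeasure (\<nu> 0) A = 0"
  using characteristics unfolding has_characteristics_def by blast+

lemma \<nu>_mono':
  assumes "0 \<le> s" "s \<le> t" shows "sets (\<nu> s) = sets (\<nu> t)"
    "\<And>A. A \<in> sets (\<nu> t) \<Longrightarrow> emeasure (\<nu> s) A \<le> emeasure (\<nu> t) A"
  using assms levy_sets[OF levy[of s]] levy_sets[OF levy[of t]] \<nu>_mono by auto

lemma measurable_X: "t \<ge> 0 \<Longrightarrow> X t \<in> borel_measurable M"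
  using additive by (simp add: additive_process_def)

lemma integral_\<nu>_0:
  fixes f :: "real \<Rightarrow> real"
  shows "(LINT x|\<nu> 0. f x) = 0"
proof -
  have "\<nu> 0 = null_measure borel"
    by (rule measure_eqI) (use levy_sets[OF levy[of 0]] \<nu>_0 in auto)
  then show ?thesis by simp
qed

lemma mass_0: "mass r 0 = 0" by (simp add: mass_def C_0 integral_\<nu>_0)

lemma drift_0: "drift r 0 = 0" by (simp add: drift_def B_0 integral_\<nu>_0)

text \<open>The increments in time are dominated by \<open>K\<close> times those of the measure of
  {|x| > e}, which is continuous by hypothesis.\<close>

lemma continuous_integral_away:
  fixes f :: "real \<Rightarrow> real"
  assumes e: "e > 0" and [measurable]: "f \<in> borel_measurable borel"
    and f: "\<And>x. \<bar>f x\<bar> \<le> K * indicator {x. \<bar>x\<bar> > e} x"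
  shows "continuous_on {0..} (\<lambda>t. LINT x|\<nu> t. f x)"
proof -
  have le: "\<bar>(LINT x|\<nu> t. f x) - (LINT x|\<nu> s. f x)\<bar>
      \<le> K * \<bar>measure (\<nu> t) {x. \<bar>x\<bar> > e} - measure (\<nu> s) {x. \<bar>x\<bar> > e}\<bar>"
    if st: "0 \<le> s" "s \<le> t" for s t
  proof -
    note [measurable_cong] = levy_sets[OF levy[of t]]
    have K: "K \<ge> 0" using f[of "e + 1"] e by auto
    have I: "integrable (\<nu> t) (\<lambda>x. K * indicator {x. \<bar>x\<bar> > e} x)"
      using levy[of t] st e K by (intro integrable_levy_away[of _ e _ K]) (auto simp: abs_mult)
    have "\<bar>(LINT x|\<nu> t. f x) - (LINT x|\<nu> s. f x)\<bar> \<le>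
        (LINT x|\<nu> t. K * indicator {x. \<bar>x\<bar> > e} x) - (LINT x|\<nu> s. K * indicator {x. \<bar>x\<bar> > e} x)"
      by (rule integral_diff_le_measure_mono[OF \<nu>_mono'[OF st] I _ f])
         (use st levy_sets[OF levy[of t]] measurable_cong_sets[of "\<nu> t" borel borel borel] in auto)
    also have "\<dots> = K * (measure (\<nu> t) {x. \<bar>x\<bar> > e} - measure (\<nu> s) {x. \<bar>x\<bar> > e})"
      using sets_eq_imp_space_eq[OF levy_sets[OF levy[of t]]] sets_eq_imp_space_eq[OF levy_sets[OF levy[of s]]] st
      by (simp add: algebra_simps)
    finally show ?thesis using K by (meson abs_ge_self mult_left_mono order_trans)
  qed
  show ?thesis
  proof (rule continuous_on_dominated_increments[of _ "\<lambda>t. measure (\<nu> t) {x. \<bar>x\<bar> > e}"])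
    show "continuous_on {0..} (\<lambda>t. measure (\<nu> t) {x. \<bar>x\<bar> > e})" by (rule \<nu>_cont[OF e]) auto
    show "\<bar>(LINT x|\<nu> t. f x) - (LINT x|\<nu> s. f x)\<bar>
      \<le> K * \<bar>measure (\<nu> t) {x. \<bar>x\<bar> > e} - measure (\<nu> s) {x. \<bar>x\<bar> > e}\<bar>"
      if "s \<in> {0..}" "t \<in> {0..}" for s t
      using le[of s t] le[of t s] that by (cases "s \<le> t") (auto simp: abs_minus_commute)
  qed
qed

lemma drift_continuous: assumes "r > 0" shows "continuous_on {0..} (drift r)"
  unfolding drift_def[abs_def]
  by (intro continuous_intros B_cont continuous_integral_away[OF assms, where K=1])
     (auto split: split_indicator)

text \<open>Continuity of \<open>\<nu>\<close> is given only away from 0, so a neighbourhood of 0 is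
  cut out. The integral over that neighbourhood is nondecreasing in t, hence at most its value at b,
  and this value tends to 0 by dominated convergence. The cut integrals thus converge uniformly on
  {0..b}.\<close>

lemma integral_trunc_continuous:
  assumes r: "r > 0"
  shows "continuous_on {0..b} (\<lambda>t. LINT x|\<nu> t. trunc r x)"
proof (cases "b \<ge> 0")
  case b: True
  let ?c = "\<lambda>n::nat. {x::real. \<bar>x\<bar> > 1 / Suc n}"
  show ?thesis
  proof (rule uniform_limit_theorem)
    show "\<forall>\<^sub>F n in sequentially. continuous_on {0..b} (\<lambda>t. LINT x|\<nu> t. trunc r x * indicator (?c n) x)"
    proof (intro always_eventually allI)
      fix n :: nat
      show "continuous_on {0..b} (\<lambda>t. LINT x|\<nu> t. trunc r x * indicator (?c n) x)"
        by (rule continuous_on_subset[OF continuous_integral_away[of "1 / Suc n" _ 1]])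
           (auto split: split_indicator simp: trunc_le_1)
    qed
    let ?e = "\<lambda>n t. LINT x|\<nu> t. trunc r x * indicator (- ?c n) x"
    note [measurable_cong] = levy_sets[OF levy[OF b]]
    have "(\<lambda>n. ?e n b) \<longlonglongrightarrow> (LINT x|\<nu> b. 0)"
    proof (rule integral_dominated_convergence[where w="trunc r"])
      show "integrable (\<nu> b) (trunc r)" by (rule integrable_trunc[OF levy[OF b] r])
      show "AE x in \<nu> b. (\<lambda>n. trunc r x * indicator (- ?c n) x) \<longlonglongrightarrow> 0"
      proof (rule AE_I2)
        fix x :: real
        show "(\<lambda>n. trunc r x * indicator (- ?c n) x) \<longlonglongrightarrow> 0"
        proof (cases "x = 0")
          case False
          have "(\<lambda>n. 1 / real (Suc n)) \<longlonglongrightarrow> 0"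
            using LIMSEQ_inverse_real_of_nat by (simp add: inverse_eq_divide)
          then have "\<forall>\<^sub>F n in sequentially. 1 / real (Suc n) < \<bar>x\<bar>"
            using False by (intro order_tendstoD) auto
          then have "\<forall>\<^sub>F n in sequentially. trunc r x * indicator (- ?c n) x = 0"
            by eventually_elim auto
          then show ?thesis by (rule tendsto_eventually)
        qed (simp add: trunc_def)
      qed
    qed (auto split: split_indicator)
    then have lim: "(\<lambda>n. ?e n b) \<longlonglongrightarrow> 0" by simp
    show "uniform_limit {0..b} (\<lambda>n t. LINT x|\<nu> t. trunc r x * indicator (?c n) x) (\<lambda>t. LINT x|\<nu> t. trunc r x) sequentially"
    proof (rule uniform_limitI)
      fix e :: real assume "e > 0"
      then have "\<forall>\<^sub>F n in sequentially. ?e n b < e" using lim by (intro order_tendstoD) auto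
      then show "\<forall>\<^sub>F n in sequentially. \<forall>t\<in>{0..b}.
          dist (LINT x|\<nu> t. trunc r x * indicator (?c n) x) (LINT x|\<nu> t. trunc r x) < e"
      proof eventually_elim
        case (elim n)
        show ?case
        proof
          fix t assume t: "t \<in> {0..b}"
          note [measurable_cong] = levy_sets[OF levy[of t]]
          have I: "integrable (\<nu> s) (trunc r)" if "s \<ge> 0" for s by (rule integrable_trunc[OF levy[OF that] r])
          have I1: "integrable (\<nu> s) (\<lambda>x. trunc r x * indicator (?c n) x)"
            and I2: "integrable (\<nu> s) (\<lambda>x. trunc r x * indicator (- ?c n) x)" if "s \<ge> 0" for s
            using I[OF that] levy_sets[OF levy[OF that]]
            by (intro integrable_real_mult_indicator; simp)+
          have "(LINT x|\<nu> t. trunc r x) = (LINT x|\<nu> t. trunc r x * indicator (?c n) x + trunc r x * indicator (- ?c n) x)"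
            by (intro Bochner_Integration.integral_cong refl) (simp split: split_indicator)
          also have "\<dots> = (LINT x|\<nu> t. trunc r x * indicator (?c n) x) + ?e n t"
            using t I1 I2 by (intro Bochner_Integration.integral_add) auto
          finally have "dist (LINT x|\<nu> t. trunc r x * indicator (?c n) x) (LINT x|\<nu> t. trunc r x) = \<bar>?e n t\<bar>"
            by (simp add: dist_real_def)
          moreover have "?e n t \<ge> 0" by (intro Bochner_Integration.integral_nonneg) auto
          moreover have "?e n t \<le> ?e n b"
            using t by (intro integral_mono_measure_nonneg(2) \<nu>_mono' I2) auto
          ultimately show "dist (LINT x|\<nu> t. trunc r x * indicator (?c n) x) (LINT x|\<nu> t. trunc r x) < e"
            using elim by simp
        qed
      qed
    qed
  qed simp
qed simp

lemma mass_continuous: "r > 0 \<Longrightarrow> continuous_on {0..b} (mass r)"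
  unfolding mass_def[abs_def]
  by (intro continuous_intros integral_trunc_continuous continuous_on_subset[OF C_cont]) auto

lemma mass_mono: assumes r: "r > 0" and st: "0 \<le> s" "s \<le> t" shows "mass r s \<le> mass r t"
  unfolding mass_def
proof (intro add_mono divide_right_mono)
  show "C s \<le> C t" using st by (intro mono_onD[OF C_mono]) auto
  show "(LINT x|\<nu> s. trunc r x) \<le> (LINT x|\<nu> t. trunc r x)"
    using st by (intro integral_mono_measure_nonneg(2) \<nu>_mono' integrable_trunc levy r) auto
qed simp

lemma mass_nonneg: "r > 0 \<Longrightarrow> t \<ge> 0 \<Longrightarrow> mass r t \<ge> 0"
  using mass_mono[of r 0 t] by (simp add: mass_0)

lemma G_K_eq_mass:
  assumes r: "r > 0" and t: "t \<ge> 0"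
  shows "G_fun \<nu> t r + K_fun C \<nu> t r = mass r t"
proof -
  note [measurable_cong] = levy_sets[OF levy[OF t]]
  have sp: "space (\<nu> t) = UNIV" using sets_eq_imp_space_eq[OF levy_sets[OF levy[OF t]]] by simp
  let ?a = "{x. \<bar>x\<bar> > r}" and ?b = "{x. \<bar>x\<bar> \<le> r}"
  have "(LINT x|\<nu> t. trunc r x) = (LINT x|\<nu> t. indicator ?a x + trunc r x * indicator ?b x)"
    using r by (intro Bochner_Integration.integral_cong) (auto simp: trunc_eq_1 split: split_indicator)
  also have "\<dots> = (LINT x|\<nu> t. indicator ?a x) + (LINT x|\<nu> t. trunc r x * indicator ?b x)"
    using emeasure_levy_finite[OF levy[OF t] r]
    by (intro Bochner_Integration.integral_add integrable_real_mult_indicator integrable_trunc levy r t)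
       (auto simp: integrable_indicator_iff)
  also have "(LINT x|\<nu> t. indicator ?a x) = G_fun \<nu> t r" by (simp add: G_fun_def sp)
  also have "(LINT x|\<nu> t. trunc r x * indicator ?b x) = (LINT x|\<nu> t. (indicator ?b x *\<^sub>R x\<^sup>2) / r\<^sup>2)"
    using r by (intro Bochner_Integration.integral_cong) (auto simp: trunc_eq_square power_divide split: split_indicator)
  finally show ?thesis
    by (simp add: mass_def K_fun_def set_lebesgue_integral_def add_divide_distrib)
qed

lemma M_fun_eq_drift:
  assumes "0 < r" "r \<le> 1" shows "M_fun B \<nu> t r = \<bar>drift r t\<bar> / r"
proof -
  have "{x::real. 1 < \<bar>x\<bar> \<and> \<bar>x\<bar> \<le> max r 1} = {}" "min r 1 = r" using assms by auto
  then show ?thesis using assms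
    by (simp add: M_fun_def drift_def set_lebesgue_integral_def mult.commute)
qed

end


section \<open>Characteristic functions of increments\<close>

lemma mono_equipartition:
  fixes h :: "real \<Rightarrow> real"
  assumes cont: "continuous_on {0..s} h" and mono: "\<And>u v. 0 \<le> u \<Longrightarrow> u \<le> v \<Longrightarrow> v \<le> s \<Longrightarrow> h u \<le> h v"
    and h0: "h 0 = 0" and s: "s \<ge> 0" and n: "n \<ge> 1"
  obtains \<tau> :: "nat \<Rightarrow> real" where "\<tau> 0 = 0" "\<tau> n = s" "\<And>i. i < n \<Longrightarrow> \<tau> i \<le> \<tau> (Suc i)"
    "\<And>i. i \<le> n \<Longrightarrow> 0 \<le> \<tau> i \<and> \<tau> i \<le> s" "\<And>i. i < n \<Longrightarrow> h (\<tau> (Suc i)) - h (\<tau> i) = h s / n"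
proof (cases "h s = 0")
  case True
  show ?thesis
    using that[of "\<lambda>i. if i = 0 then 0 else s"] n s h0 True by auto
next
  case False
  then have hs: "h s > 0" using mono[of 0 s] h0 s by auto
  have "\<exists>x. 0 \<le> x \<and> x \<le> s \<and> h x = real i * (h s / n)" if "i \<le> n" for i :: nat
  proof (rule IVT')
    show "h 0 \<le> real i * (h s / n)" using h0 hs by simp
    show "real i * (h s / n) \<le> h s" using that hs n by (simp add: field_simps)
  qed (use s cont in auto)
  then obtain \<sigma> where \<sigma>: "\<And>i. i \<le> n \<Longrightarrow> 0 \<le> \<sigma> i \<and> \<sigma> i \<le> s \<and> h (\<sigma> i) = real i * (h s / n)" by metis
  \<comment> \<open>\<open>h\<close> may be flat, so the points from the intermediate value theorem
    need not be the end points for i = 0 and i = n; these two are prescribed.\<close>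
  define \<tau> where "\<tau> i = (if i = 0 then 0 else if i = n then s else \<sigma> i)" for i
  have \<tau>: "0 \<le> \<tau> i \<and> \<tau> i \<le> s \<and> h (\<tau> i) = real i * (h s / n)" if "i \<le> n" for i
    using that \<sigma>[of i] s h0 n by (auto simp: \<tau>_def)
  show ?thesis
  proof (rule that[of \<tau>])
    fix i assume i: "i < n"
    show "\<tau> i \<le> \<tau> (Suc i)"
    proof (rule ccontr)
      assume "\<not> \<tau> i \<le> \<tau> (Suc i)"
      then have "h (\<tau> (Suc i)) \<le> h (\<tau> i)" using \<tau>[of i] \<tau>[of "Suc i"] i by (intro mono) auto
      then have "real (Suc i) * (h s / n) \<le> real i * (h s / n)" using \<tau>[of i] \<tau>[of "Suc i"] i by simp
      moreover have "h s / n > 0" using hs n by simp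
      ultimately show False using mult_le_cancel_right_pos[of "h s / n" "real (Suc i)" "real i"] by linarith
    qed
    show "h (\<tau> (Suc i)) - h (\<tau> i) = h s / n"
      using \<tau>[of i] \<tau>[of "Suc i"] i by (simp add: algebra_simps add_divide_distrib)
  qed (use \<tau> n in \<open>auto simp: \<tau>_def\<close>)
qed

text \<open>Bernoulli's inequality for 8/7 = 1 + 1/7. It turns the exponential decay in the number
  of pieces into decay like 1/n, which is all that the small ball bound uses.\<close>

lemma power_7_8_le: "(7 / 8 :: real) ^ n * real n \<le> 7"
proof -
  have "1 + real n * (1 / 7) \<le> (1 + 1 / 7) ^ n" by (rule Bernoulli_inequality) simp
  then have "real n \<le> 7 * (8 / 7) ^ n" by simp
  then have "(7 / 8) ^ n * real n \<le> (7 / 8) ^ n * (7 * (8 / 7) ^ n)" by (intro mult_left_mono) auto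
  also have "\<dots> = 7 * ((7 / 8 * (8 / 7)) ^ n)" by (simp only: power_mult_distrib mult_ac)
  finally show ?thesis by simp
qed

lemma (in prob_space) char_distr_shift:
  assumes [measurable]: "Y \<in> borel_measurable M"
  shows "char (distr M borel (\<lambda>\<omega>. Y \<omega> - d)) l = iexp (- l * d) * char (distr M borel Y) l"
proof -
  have "char (distr M borel (\<lambda>\<omega>. Y \<omega> - d)) l = (CLINT \<omega>|M. iexp (- l * d) * iexp (l * Y \<omega>))"
    unfolding char_def by (subst integral_distr) (auto simp: algebra_simps exp_diff exp_minus divide_inverse)
  also have "\<dots> = iexp (- l * d) * char (distr M borel Y) l"
    unfolding char_def by (subst integral_distr) auto
  finally show ?thesis .
qed

text \<open>The direction opposite to \<open>prob_ge_le_char\<close>: where |Y| <= a the integrand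
  is at most |l| a, elsewhere at most 2.\<close>

lemma (in prob_space) cmod_one_minus_char_le:
  assumes [measurable]: "Y \<in> borel_measurable M" and a: "a \<ge> 0"
  shows "cmod (1 - char (distr M borel Y) l) \<le> \<bar>l\<bar> * a + 2 * prob {\<omega> \<in> space M. \<bar>Y \<omega>\<bar> > a}"
proof -
  let ?A = "{\<omega> \<in> space M. \<bar>Y \<omega>\<bar> > a}"
  have int: "integrable M (\<lambda>\<omega>. iexp (l * Y \<omega>))" by (rule integrable_iexp) auto
  have "1 - char (distr M borel Y) l = (CLINT \<omega>|M. 1 - iexp (l * Y \<omega>))"
    using int prob_space unfolding char_def by (subst integral_distr) auto
  also have "cmod \<dots> \<le> (LINT \<omega>|M. cmod (1 - iexp (l * Y \<omega>)))" by (rule integral_norm_bound)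
  also have "\<dots> \<le> (LINT \<omega>|M. \<bar>l\<bar> * a + 2 * indicator ?A \<omega>)"
  proof (rule integral_mono)
    show "integrable M (\<lambda>\<omega>. cmod (1 - iexp (l * Y \<omega>)))" using int by auto
    show "integrable M (\<lambda>\<omega>. \<bar>l\<bar> * a + 2 * indicator ?A \<omega>)"
      by (intro Bochner_Integration.integrable_add integrable_mult_right integrable_const)
         (simp add: integrable_indicator_iff emeasure_eq_measure)
    fix \<omega> assume \<omega>: "\<omega> \<in> space M"
    show "cmod (1 - iexp (l * Y \<omega>)) \<le> \<bar>l\<bar> * a + 2 * indicator ?A \<omega>"
    proof (cases "\<omega> \<in> ?A")
      case True
      then show ?thesis using norm_triangle_ineq4[of 1 "iexp (l * Y \<omega>)"] a by simp (smt (verit) mult_nonneg_nonneg)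
    next
      case False
      have "cmod (1 - iexp (l * Y \<omega>)) \<le> \<bar>l * Y \<omega>\<bar>"
        using iexp_approx1[of "l * Y \<omega>" 0] by (simp add: norm_minus_commute)
      also have "\<dots> \<le> \<bar>l\<bar> * a" using False \<omega> by (auto simp: abs_mult intro!: mult_left_mono)
      finally show ?thesis using False by simp
    qed
  qed
  also have "\<dots> = \<bar>l\<bar> * a + 2 * prob ?A"
  proof -
    have "integrable M (\<lambda>\<omega>. 2 * indicat_real ?A \<omega>)"
      by (intro integrable_mult_right) (simp add: integrable_indicator_iff emeasure_eq_measure)
    then show ?thesis using prob_space by (subst Bochner_Integration.integral_add) auto
  qed
  finally show ?thesis .
qed

section \<open>The Levy-Khintchine exponent at level r and its increments\<close>

context additive_char
begin

text \<open>The exponent of \<open>X t\<close> after moving the cut of the compensator from 1 to r: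
  the integral of l x over r < |x| <= 1 is taken out of the compensator and makes \<open>B\<close>
  into \<open>drift r\<close>. See \<open>char_X\<close>.\<close>

definition expo :: "real \<Rightarrow> real \<Rightarrow> real \<Rightarrow> complex" where
  "expo r t l = \<i> * complex_of_real (l * drift r t) - complex_of_real (l\<^sup>2 * C t / 2)
     + (CLINT x|\<nu> t. char_kernel r l x)"

lemma char_X:
  assumes r: "0 < r" "r \<le> 1" and t: "t \<ge> 0"
  shows "char (distr M borel (X t)) l = exp (expo r t l)"
proof -
  note [measurable_cong] = levy_sets[OF levy[OF t]]
  let ?f = "\<lambda>x. x * indicator {x. r < \<bar>x\<bar> \<and> \<bar>x\<bar> \<le> 1} x :: real"
  have I: "integrable (\<nu> t) ?f"
    using r by (intro integrable_levy_away[OF levy[OF t], of r _ 1]) (auto split: split_indicator)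
  have I': "integrable (\<nu> t) (\<lambda>x. \<i> * complex_of_real (l * ?f x))"
    using I by (intro integrable_mult_right integrable_of_real)
  have "(CLINT x|\<nu> t. char_kernel 1 l x) = (CLINT x|\<nu> t. char_kernel r l x - \<i> * complex_of_real (l * ?f x))"
    using r by (intro Bochner_Integration.integral_cong refl)
      (auto simp: char_kernel_def split: split_indicator)
  also have "\<dots> = (CLINT x|\<nu> t. char_kernel r l x) - (CLINT x|\<nu> t. \<i> * complex_of_real (l * ?f x))"
    using r by (intro Bochner_Integration.integral_diff integrable_char_kernel levy t I')
  also have "(CLINT x|\<nu> t. \<i> * complex_of_real (l * ?f x)) = \<i> * complex_of_real (l * (LINT x|\<nu> t. ?f x))"
    by (simp only: integral_mult_right_zero integral_complex_of_real)
  finally have *: "(CLINT x|\<nu> t. char_kernel 1 l x) =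
    (CLINT x|\<nu> t. char_kernel r l x) - \<i> * complex_of_real (l * (LINT x|\<nu> t. ?f x))" .
  have "char (distr M borel (X t)) l = exp (\<i> * complex_of_real (l * B t) - complex_of_real (l\<^sup>2 * C t / 2)
               + (CLINT x|\<nu> t. char_kernel 1 l x))"
    using characteristics t unfolding has_characteristics_def char_kernel_def by simp
  then show ?thesis unfolding * expo_def drift_def by (simp add: algebra_simps)
qed

lemma indep_increments:
  assumes "0 \<le> \<tau> 0" "\<And>i. i < n \<Longrightarrow> \<tau> i \<le> \<tau> (Suc i)"
  shows "indep_vars (\<lambda>_. borel) (\<lambda>i \<omega>. X (\<tau> (Suc i)) \<omega> - X (\<tau> i) \<omega>) {..<n}"
  using additive assms unfolding additive_process_def independent_increments_def by blast

lemma AE_X_0: "AE \<omega> in M. X 0 \<omega> = 0"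
  using additive by (auto simp: additive_process_def)

text \<open>Independence of the increments over [0, u] and [u, v] makes the characteristic functions
  multiply, and exp has no zeros, so one may divide.\<close>

lemma char_increment:
  assumes r: "0 < r" "r \<le> 1" and uv: "0 \<le> u" "u \<le> v"
  shows "char (distr M borel (\<lambda>\<omega>. X v \<omega> - X u \<omega>)) l = exp (expo r v l - expo r u l)"
proof -
  have [measurable]: "X 0 \<in> borel_measurable M" "X u \<in> borel_measurable M" "X v \<in> borel_measurable M"
    using uv by (auto intro: measurable_X)
  have shift0: "char (distr M borel (\<lambda>\<omega>. X t \<omega> - X 0 \<omega>)) l = exp (expo r t l)" if t: "t \<ge> 0" for t
  proof -
    have [measurable]: "X t \<in> borel_measurable M" using t by (rule measurable_X)
    \<comment> \<open>The process starts at 0 only almost surely, so \<open>X 0\<close> is removed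
      at the level of distributions.\<close>
    have "distr M borel (\<lambda>\<omega>. X t \<omega> - X 0 \<omega>) = distr M borel (X t)"
      by (rule distr_cong_AE) (use AE_X_0 in auto)
    then show ?thesis using char_X[OF r t] by simp
  qed
  define \<tau> :: "nat \<Rightarrow> real" where "\<tau> i = (if i = 0 then 0 else if i = 1 then u else v)" for i
  have "indep_vars (\<lambda>_. borel) (\<lambda>i \<omega>. X (\<tau> (Suc i)) \<omega> - X (\<tau> i) \<omega>) {..<2}"
    using uv by (intro indep_increments) (auto simp: \<tau>_def)
  from char_distr_sum[OF this, of l]
  have "exp (expo r v l) = exp (expo r u l) * char (distr M borel (\<lambda>\<omega>. X v \<omega> - X u \<omega>)) l"
    using shift0[of u] shift0[of v] uv by (simp add: numeral_2_eq_2 \<tau>_def)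
  then show ?thesis by (simp add: exp_diff field_simps)
qed

text \<open>With |l| r <= 1 the kernel is at most 5/2 times \<open>trunc r\<close>, and the passage
  to complex integrands doubles this to 5. The Gaussian part needs only the factor 1/2.\<close>

lemma cmod_expo_increment_le:
  assumes r: "0 < r" "r \<le> 1" and uv: "0 \<le> u" "u \<le> v" and l: "\<bar>l\<bar> \<le> 1 / r"
  shows "cmod (expo r v l - expo r u l - \<i> * complex_of_real (l * (drift r v - drift r u))) \<le>
    5 * (mass r v - mass r u)"
proof -
  have v: "0 \<le> v" using uv by simp
  have lr: "(l * r)\<^sup>2 \<le> 1" using l r power_le_one[of "\<bar>l\<bar> * r" 2] by (simp add: power_mult_distrib field_simps)
  have *: "expo r v l - expo r u l - \<i> * complex_of_real (l * (drift r v - drift r u)) =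
     complex_of_real (- (l\<^sup>2 * (C v - C u) / 2)) + ((CLINT x|\<nu> v. char_kernel r l x) - (CLINT x|\<nu> u. char_kernel r l x))"
    by (simp add: expo_def algebra_simps diff_divide_distrib)
  have bound: "cmod (char_kernel r l x) \<le> 5 / 2 * trunc r x" for x
    using cmod_char_kernel_le[OF r(1), of l x] mult_right_mono[of "2 + (l * r)\<^sup>2 / 2" "5 / 2" "trunc r x"] lr by simp
  have "cmod ((CLINT x|\<nu> v. char_kernel r l x) - (CLINT x|\<nu> u. char_kernel r l x)) \<le>
     2 * ((LINT x|\<nu> v. 5 / 2 * trunc r x) - (LINT x|\<nu> u. 5 / 2 * trunc r x))"
    using r levy_sets[OF levy[OF v]]
    by (intro cmod_integral_diff_le_measure_mono \<nu>_mono' uv integrable_mult_right integrable_trunc levy v bound)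
       (auto cong: measurable_cong_sets)
  also have "\<dots> = 5 * ((LINT x|\<nu> v. trunc r x) - (LINT x|\<nu> u. trunc r x))" by simp
  finally have 1: "cmod ((CLINT x|\<nu> v. char_kernel r l x) - (CLINT x|\<nu> u. char_kernel r l x)) \<le>
    5 * ((LINT x|\<nu> v. trunc r x) - (LINT x|\<nu> u. trunc r x))" .
  have CC: "C u \<le> C v" using uv by (intro mono_onD[OF C_mono]) auto
  have l2: "l\<^sup>2 \<le> 1 / r\<^sup>2" using lr r by (simp add: power_mult_distrib field_simps)
  have "cmod (complex_of_real (- (l\<^sup>2 * (C v - C u) / 2))) = l\<^sup>2 * (C v - C u) / 2"
    using CC by (simp only: norm_of_real) simp
  also have "\<dots> \<le> 1 / r\<^sup>2 * (C v - C u) / 2" using CC l2 by (intro divide_right_mono mult_right_mono) auto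
  also have "\<dots> = 1 / 2 * ((C v - C u) / r\<^sup>2)" by simp
  also have "\<dots> \<le> 5 * ((C v - C u) / r\<^sup>2)" using CC by (intro mult_right_mono) auto
  also have "\<dots> = 5 * (C v / r\<^sup>2 - C u / r\<^sup>2)" by (simp add: diff_divide_distrib)
  finally show ?thesis unfolding * using 1 unfolding mass_def
    by (intro order_trans[OF norm_triangle_ineq]) (simp add: algebra_simps)
qed

text \<open>Subtracting the drift increment leaves a variable with characteristic function exp w,
  where |w| is at most 5 times the mass increment. A characteristic function has modulus at most 1,
  hence Re w <= 0 and \<open>cmod_one_minus_exp_le\<close> applies. The constant is 10 = 2 *
  5.\<close>

lemma increment_tail:
  assumes r: "0 < r" "r \<le> 1" and uv: "0 \<le> u" "u \<le> v"
  shows "prob {\<omega> \<in> space M. \<bar>X v \<omega> - X u \<omega> - (drift r v - drift r u)\<bar> \<ge> 2 * r} \<le> 10 * (mass r v - mass r u)"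
proof -
  have [measurable]: "X u \<in> borel_measurable M" "X v \<in> borel_measurable M"
    using uv by (auto intro: measurable_X)
  let ?d = "drift r v - drift r u"
  have "prob {\<omega> \<in> space M. \<bar>X v \<omega> - X u \<omega> - ?d\<bar> \<ge> 2 * r} \<le> 2 * (5 * (mass r v - mass r u))"
  proof (rule prob_ge_le_char[OF _ r(1)])
    fix \<theta> :: real assume \<theta>: "0 \<le> \<theta>" "\<theta> \<le> 1"
    let ?l = "\<theta> / r"
    let ?Y = "\<lambda>\<omega>. X v \<omega> - X u \<omega> - ?d"
    have l: "\<bar>?l\<bar> \<le> 1 / r" using \<theta> r by (simp add: divide_right_mono)
    define w where "w = expo r v ?l - expo r u ?l - \<i> * complex_of_real (?l * ?d)"
    interpret Y: prob_space "distr M borel ?Y" by (rule prob_space_distr) simp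
    interpret Y: real_distribution "distr M borel ?Y" by unfold_locales simp_all
    have ch: "char (distr M borel ?Y) ?l = exp w"
      unfolding w_def
      by (subst char_distr_shift) (auto simp: char_increment[OF r uv] exp_diff exp_minus divide_inverse)
    have "cmod (exp w) \<le> 1" using Y.cmod_char_le_1[of ?l] unfolding ch .
    then have "Re w \<le> 0" by (simp add: norm_exp_eq_Re)
    then have "cmod (1 - exp w) \<le> cmod w" by (rule cmod_one_minus_exp_le)
    also have "\<dots> \<le> 5 * (mass r v - mass r u)" unfolding w_def by (rule cmod_expo_increment_le[OF r uv l])
    finally show "cmod (1 - char (distr M borel ?Y) ?l) \<le> 5 * (mass r v - mass r u)" unfolding ch .
  qed (use mass_mono[OF r(1) uv] in auto)
  then show ?thesis by simp
qed

text \<open>Without centring, the drift enters the exponent as an additional term of modulus at most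
  |drift| / r for frequencies up to 1/r. Only the drift at the time t itself occurs, not its
  maximum.\<close>

lemma tail:
  assumes r: "0 < r" "r \<le> 1" and t: "0 \<le> t"
  shows "prob {\<omega> \<in> space M. \<bar>X t \<omega>\<bar> \<ge> 2 * r} \<le> 10 * (mass r t + \<bar>drift r t\<bar> / r)"
proof -
  have [measurable]: "X t \<in> borel_measurable M" using t by (rule measurable_X)
  have "prob {\<omega> \<in> space M. \<bar>X t \<omega>\<bar> \<ge> 2 * r} \<le> 2 * (5 * mass r t + \<bar>drift r t\<bar> / r)"
  proof (rule prob_ge_le_char[OF _ r(1)])
    fix \<theta> :: real assume \<theta>: "0 \<le> \<theta>" "\<theta> \<le> 1"
    let ?l = "\<theta> / r" and ?d = "drift r t"
    have l: "\<bar>?l\<bar> \<le> 1 / r" using \<theta> r by (simp add: divide_right_mono)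
    interpret Y: prob_space "distr M borel (X t)" by (rule prob_space_distr) simp
    interpret Y: real_distribution "distr M borel (X t)" by unfold_locales simp_all
    have ch: "char (distr M borel (X t)) ?l = exp (expo r t ?l)" by (rule char_X[OF r t])
    have "cmod (exp (expo r t ?l)) \<le> 1" using Y.cmod_char_le_1[of ?l] unfolding ch .
    then have "Re (expo r t ?l) \<le> 0" by (simp add: norm_exp_eq_Re)
    then have "cmod (1 - exp (expo r t ?l)) \<le> cmod (expo r t ?l)" by (rule cmod_one_minus_exp_le)
    also have "\<dots> \<le> cmod (expo r t ?l - \<i> * complex_of_real (?l * ?d)) + cmod (\<i> * complex_of_real (?l * ?d))"
      using norm_triangle_ineq[of "expo r t ?l - \<i> * complex_of_real (?l * ?d)" "\<i> * complex_of_real (?l * ?d)"]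
      by simp
    also have "cmod (expo r t ?l - \<i> * complex_of_real (?l * ?d)) \<le> 5 * mass r t"
    proof -
      have "expo r 0 ?l = 0"
      proof -
        have "\<nu> 0 = null_measure borel"
          by (rule measure_eqI) (use levy_sets[OF levy[of 0]] \<nu>_0 in auto)
        then show ?thesis by (simp add: expo_def drift_0 C_0)
      qed
      then show ?thesis
        using cmod_expo_increment_le[OF r order_refl t l] by (simp add: drift_0 mass_0)
    qed
    also have "cmod (\<i> * complex_of_real (?l * ?d)) = \<bar>?l\<bar> * \<bar>?d\<bar>"
      unfolding norm_mult norm_ii norm_of_real by (simp add: abs_mult)
    also have "\<bar>?l\<bar> * \<bar>?d\<bar> \<le> 1 / r * \<bar>?d\<bar>" using l by (rule mult_right_mono) simp
    finally show "cmod (1 - char (distr M borel (X t)) ?l) \<le> 5 * mass r t + \<bar>?d\<bar> / r"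
      unfolding ch by simp
  qed (use mass_nonneg[OF r(1) t] r in auto)
  also have "\<dots> \<le> 10 * (mass r t + \<bar>drift r t\<bar> / r)"
  proof -
    have "0 \<le> \<bar>drift r t\<bar> / r" using r by simp
    then show ?thesis unfolding distrib_left by linarith
  qed
  finally show ?thesis .
qed

lemma Re_expo:
  assumes "0 < r" "t \<ge> 0"
  shows "Re (expo r t l) = - (l\<^sup>2 * C t / 2) - (LINT x|\<nu> t. 1 - cos (l * x))"
    and "integrable (\<nu> t) (\<lambda>x. 1 - cos (l * x))"
proof -
  have I: "integrable (\<nu> t) (char_kernel r l)" using assms by (intro integrable_char_kernel levy)
  have Re: "Re (char_kernel r l x) = - (1 - cos (l * x))" for x
    by (simp add: char_kernel_def Re_exp)
  have "integrable (\<nu> t) (\<lambda>x. Re (char_kernel r l x))" using I by simp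
  then have "integrable (\<nu> t) (\<lambda>x. - (1 - cos (l * x)))" unfolding Re .
  from Bochner_Integration.integrable_minus[OF this]
  show "integrable (\<nu> t) (\<lambda>x. 1 - cos (l * x))" by simp
  have "Re (CLINT x|\<nu> t. char_kernel r l x) = (LINT x|\<nu> t. Re (char_kernel r l x))"
    using I by (rule integral_Re[symmetric])
  also have "\<dots> = - (LINT x|\<nu> t. 1 - cos (l * x))"
    unfolding Re by (rule Bochner_Integration.integral_minus)
  finally show "Re (expo r t l) = - (l\<^sup>2 * C t / 2) - (LINT x|\<nu> t. 1 - cos (l * x))"
    by (simp add: expo_def)
qed

text \<open>Converse of \<open>increment_tail\<close>. A concentrated increment has a characteristic
  function of modulus at least 1/2 near 0. The modulus is exp of the real part of the exponent, in
  which the drift does not appear, so the bound on the mass holds whatever the drift does.\<close>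

lemma small_increment_mass:
  assumes r: "0 < r" "r \<le> 1" and uv: "0 \<le> u" "u \<le> v"
    and p: "prob {\<omega> \<in> space M. \<bar>X v \<omega> - X u \<omega>\<bar> > 2 * r} \<le> 1 / 8"
  shows "mass r v - mass r u \<le> 640"
proof -
  have [measurable]: "X u \<in> borel_measurable M" "X v \<in> borel_measurable M"
    using uv by (auto intro: measurable_X)
  have v: "0 \<le> v" using uv by simp
  have CC: "C u \<le> C v" using uv by (intro mono_onD[OF C_mono]) auto
  \<comment> \<open>At frequencies up to 1/(8r) the two error terms are 2r / (8r) = 1/4 and 2 *
    (1/8) = 1/4, which keeps |1 - exp w| at most 1/2; then Re w >= ln(1/2) >= -1.\<close>
  define \<rho> where "\<rho> = 8 * r"
  have \<rho>: "\<rho> > 0" using r by (simp add: \<rho>_def)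
  have key: "(\<theta> / \<rho>)\<^sup>2 * (C v - C u) / 2 + (LINT x|\<nu> v. 1 - cos (\<theta> / \<rho> * x)) - (LINT x|\<nu> u. 1 - cos (\<theta> / \<rho> * x)) \<le> 1"
    if \<theta>: "0 \<le> \<theta>" "\<theta> \<le> 1" for \<theta>
  proof -
    let ?l = "\<theta> / \<rho>" and ?w = "expo r v (\<theta> / \<rho>) - expo r u (\<theta> / \<rho>)"
    have "cmod (1 - exp ?w) \<le> \<bar>?l\<bar> * (2 * r) + 2 * prob {\<omega> \<in> space M. \<bar>X v \<omega> - X u \<omega>\<bar> > 2 * r}"
      unfolding char_increment[OF r uv, symmetric] using r by (intro cmod_one_minus_char_le) auto
    also have "\<dots> \<le> 1 / 4 + 2 * (1 / 8)"
      using \<theta> r p by (intro add_mono mult_left_mono) (auto simp: \<rho>_def)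
    finally have "cmod (1 - exp ?w) \<le> 1 / 2" by simp
    then have "1 / 2 \<le> cmod (exp ?w)" using norm_triangle_ineq[of "1 - exp ?w" "exp ?w"] by simp
    then have "ln (1 / 2) \<le> ln (exp (Re ?w))" by (subst ln_le_cancel_iff) (simp_all add: norm_exp_eq_Re)
    then have "ln (1 / 2) \<le> Re ?w" by simp
    moreover have "ln (1 / 2) \<ge> (- 1 :: real)" using ln_le_minus_one[of "2::real"] by (simp add: ln_div)
    ultimately have "- 1 \<le> Re ?w" by linarith
    then show ?thesis using Re_expo(1)[OF r(1) uv(1), of ?l] Re_expo(1)[OF r(1) v, of ?l]
      by (simp add: right_diff_distrib diff_divide_distrib)
  qed
  have "(\<integral>\<^sup>+x. ennreal (cos_avg (x / \<rho>)) \<partial>\<nu> v) \<le> (\<integral>\<^sup>+x. ennreal (cos_avg (x / \<rho>)) \<partial>\<nu> u) + ennreal 1"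
  proof (rule tonelli_cos_avg)
    fix \<theta> :: real assume \<theta>: "0 \<le> \<theta>" "\<theta> \<le> 1"
    have I: "integrable (\<nu> t) (\<lambda>x. 1 - cos (\<theta> / \<rho> * x))" if "t \<ge> 0" for t
      using Re_expo(2)[OF r(1) that] .
    have "0 \<le> (\<theta> / \<rho>)\<^sup>2 * (C v - C u) / 2" using CC by simp
    then have "(LINT x|\<nu> v. 1 - cos (\<theta> / \<rho> * x)) \<le> (LINT x|\<nu> u. 1 - cos (\<theta> / \<rho> * x)) + 1"
      using key[OF \<theta>] by linarith
    then have "ennreal (LINT x|\<nu> v. 1 - cos (\<theta> / \<rho> * x)) \<le> ennreal ((LINT x|\<nu> u. 1 - cos (\<theta> / \<rho> * x)) + 1)"
      by (rule ennreal_leI)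
    also have "\<dots> = ennreal (LINT x|\<nu> u. 1 - cos (\<theta> / \<rho> * x)) + ennreal 1"
      by (intro ennreal_plus Bochner_Integration.integral_nonneg) auto
    finally show "(\<integral>\<^sup>+x. ennreal (1 - cos (\<theta> * (x / \<rho>))) \<partial>\<nu> v) \<le> (\<integral>\<^sup>+x. ennreal (1 - cos (\<theta> * (x / \<rho>))) \<partial>\<nu> u) + ennreal 1"
      using nn_integral_eq_integral[OF I[OF uv(1)]] nn_integral_eq_integral[OF I[OF v]] by simp
  qed (simp_all add: sigma_finite_levy levy levy_sets uv v)
  moreover have I: "integrable (\<nu> t) (\<lambda>x. cos_avg (x / \<rho>))" if t: "t \<ge> 0" for t
  proof (rule Bochner_Integration.integrable_bound)
    note [measurable_cong] = levy_sets[OF levy[OF t]]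
    show "integrable (\<nu> t) (\<lambda>x. 2 * trunc \<rho> x)" by (intro integrable_mult_right integrable_trunc levy t \<rho>)
    show "(\<lambda>x. cos_avg (x / \<rho>)) \<in> borel_measurable (\<nu> t)" by measurable
  qed (simp add: cos_avg_le_trunc cos_avg_nonneg)
  ultimately have "ennreal (LINT x|\<nu> v. cos_avg (x / \<rho>)) \<le> ennreal ((LINT x|\<nu> u. cos_avg (x / \<rho>)) + 1)"
    using nn_integral_eq_integral[OF I[OF uv(1)]] nn_integral_eq_integral[OF I[OF v]]
    by (subst ennreal_plus) (auto simp: cos_avg_nonneg)
  moreover have "(LINT x|\<nu> u. cos_avg (x / \<rho>)) \<ge> 0" by (simp add: cos_avg_nonneg)
  ultimately have diff: "(LINT x|\<nu> v. cos_avg (x / \<rho>)) - (LINT x|\<nu> u. cos_avg (x / \<rho>)) \<le> 1"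
    by (subst (asm) ennreal_le_iff) auto
  \<comment> \<open>512 = 8 * 64: the factor 8 comes from \<open>cos_avg_ge\<close>, and 64 = 8^2
    from the change of scale between r and 8r.\<close>
  have "trunc r x \<le> 512 * cos_avg (x / \<rho>)" for x
    using cos_avg_ge[of "x / \<rho>"] by (auto simp: trunc_def \<rho>_def min_def power_divide power_mult_distrib split: if_splits)
  then have "\<bar>(LINT x|\<nu> v. trunc r x) - (LINT x|\<nu> u. trunc r x)\<bar> \<le>
      (LINT x|\<nu> v. 512 * cos_avg (x / \<rho>)) - (LINT x|\<nu> u. 512 * cos_avg (x / \<rho>))"
    using uv levy_sets[OF levy[OF v]]
    by (intro integral_diff_le_measure_mono \<nu>_mono' integrable_mult_right I v) (auto cong: measurable_cong_sets)
  then have 1: "(LINT x|\<nu> v. trunc r x) - (LINT x|\<nu> u. trunc r x) \<le> 512" using diff by simp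
  \<comment> \<open>At \<theta> = 1 the jump terms of \<open>key\<close> contribute a nonnegative
    amount. Dropping it bounds the increment of C / r^2 by 2 * 64 = 128, and 512 + 128 =
    640.\<close>
  have "(LINT x|\<nu> u. 1 - cos (1 / \<rho> * x)) \<le> (LINT x|\<nu> v. 1 - cos (1 / \<rho> * x))"
    using uv by (intro integral_mono_measure_nonneg(2) \<nu>_mono' Re_expo(2)[OF r(1) v]) auto
  then have "(1 / \<rho>)\<^sup>2 * (C v - C u) / 2 \<le> 1" using key[of 1] by simp
  then have "C v / r\<^sup>2 - C u / r\<^sup>2 \<le> 128"
    by (simp add: \<rho>_def power_divide power_mult_distrib diff_divide_distrib)
  then show ?thesis using 1 by (simp add: mass_def)
qed

end


section \<open>Maximal and small ball inequalities\<close>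

text \<open>Let k be the first index with |S k| > 3a. Either |S n| >= a, or the remaining sum
  exceeds 2a in modulus. The latter event is independent of what happened up to k, and has
  probability at most 2p because |S n| >= a or |S k| >= a on it. Summing over the disjoint
  first-passage events gives p + 2p.\<close>

lemma (in prob_space) etemadi_maximal_inequality:
  fixes D :: "nat \<Rightarrow> 'a \<Rightarrow> real"
  assumes ind: "indep_vars (\<lambda>_. borel) D {..<n}"
  defines "S \<equiv> \<lambda>k \<omega>. \<Sum>i<k. D i \<omega>"
  assumes p: "\<And>k. k \<le> n \<Longrightarrow> prob {\<omega> \<in> space M. \<bar>S k \<omega>\<bar> \<ge> a} \<le> p"
  shows "prob {\<omega> \<in> space M. \<exists>k\<le>n. \<bar>S k \<omega>\<bar> > 3 * a} \<le> 3 * p"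
proof -
  have D[measurable]: "D i \<in> borel_measurable M" if "i < n" for i
    using ind that by (auto simp: indep_vars_def)
  have S[measurable]: "S k \<in> borel_measurable M" if "k \<le> n" for k
    unfolding S_def using that by (intro borel_measurable_sum D) auto
  define B where "B k = {\<omega> \<in> space M. (\<forall>j<k. \<bar>S j \<omega>\<bar> \<le> 3 * a) \<and> \<bar>S k \<omega>\<bar> > 3 * a}" for k
  have B[measurable]: "B k \<in> events" if "k \<le> n" for k
  proof -
    have "{\<omega> \<in> space M. \<forall>j\<in>{..<k}. \<bar>S j \<omega>\<bar> \<le> 3 * a} \<in> events"
      using that by (intro sets.sets_Collect_finite_All) auto
    moreover have "B k = {\<omega> \<in> space M. \<forall>j\<in>{..<k}. \<bar>S j \<omega>\<bar> \<le> 3 * a} \<inter> {\<omega> \<in> space M. \<bar>S k \<omega>\<bar> > 3 * a}"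
      by (auto simp: B_def)
    ultimately show ?thesis using that by auto
  qed
  define E where "E k = {\<omega> \<in> space M. \<bar>S n \<omega> - S k \<omega>\<bar> > 2 * a}" for k
  have E[measurable]: "E k \<in> events" if "k \<le> n" for k
    using that unfolding E_def by measurable
  define A where "A = {\<omega> \<in> space M. \<bar>S n \<omega>\<bar> \<ge> a}"
  have A[measurable]: "A \<in> events" unfolding A_def by measurable
  have disj: "disjoint_family_on B {..n}"
    unfolding disjoint_family_on_def B_def
  proof (intro ballI impI)
    fix k l :: nat assume "k \<noteq> l"
    then show "{\<omega> \<in> space M. (\<forall>j<k. \<bar>S j \<omega>\<bar> \<le> 3 * a) \<and> \<bar>S k \<omega>\<bar> > 3 * a} \<inter>
        {\<omega> \<in> space M. (\<forall>j<l. \<bar>S j \<omega>\<bar> \<le> 3 * a) \<and> \<bar>S l \<omega>\<bar> > 3 * a} = {}"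
      by (cases "k < l") (auto simp: not_less_iff_gr_or_eq not_le[symmetric])
  qed
  have sub: "{\<omega> \<in> space M. \<exists>k\<le>n. \<bar>S k \<omega>\<bar> > 3 * a} \<subseteq> A \<union> (\<Union>k\<in>{..n}. B k \<inter> E k)"
  proof
    fix \<omega> assume "\<omega> \<in> {\<omega> \<in> space M. \<exists>k\<le>n. \<bar>S k \<omega>\<bar> > 3 * a}"
    then have \<omega>: "\<omega> \<in> space M" and ex: "\<exists>k. k \<le> n \<and> \<bar>S k \<omega>\<bar> > 3 * a" by auto
    define k where "k = (LEAST k. k \<le> n \<and> \<bar>S k \<omega>\<bar> > 3 * a)"
    have k: "k \<le> n" "\<bar>S k \<omega>\<bar> > 3 * a" using LeastI_ex[OF ex] by (auto simp: k_def)
    have "\<bar>S j \<omega>\<bar> \<le> 3 * a" if "j < k" for j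
      using not_less_Least[of j "\<lambda>k. k \<le> n \<and> \<bar>S k \<omega>\<bar> > 3 * a"] that k(1) by (fastforce simp: k_def)
    then have "\<omega> \<in> B k" using \<omega> k by (simp add: B_def)
    moreover have "\<omega> \<in> E k" if "\<omega> \<notin> A" using that \<omega> k by (auto simp: A_def E_def)
    ultimately show "\<omega> \<in> A \<union> (\<Union>k\<in>{..n}. B k \<inter> E k)" using k by blast
  qed
  have "prob {\<omega> \<in> space M. \<exists>k\<le>n. \<bar>S k \<omega>\<bar> > 3 * a} \<le> prob (A \<union> (\<Union>k\<in>{..n}. B k \<inter> E k))"
    by (rule finite_measure_mono[OF sub]) (auto intro!: sets.Un sets.finite_UN sets.Int)
  also have "\<dots> \<le> prob A + prob (\<Union>k\<in>{..n}. B k \<inter> E k)"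
    by (rule measure_Un_le) (auto intro!: sets.finite_UN sets.Int)
  also have "prob (\<Union>k\<in>{..n}. B k \<inter> E k) \<le> (\<Sum>k\<le>n. prob (B k \<inter> E k))"
    by (rule finite_measure_subadditive_finite) auto
  also have "(\<Sum>k\<le>n. prob (B k \<inter> E k)) \<le> (\<Sum>k\<le>n. prob (B k) * (2 * p))"
  proof (rule sum_mono)
    fix k assume "k \<in> {..n}"
    then have k: "k \<le> n" by simp
    \<comment> \<open>\<open>B k\<close> depends on the terms with index below k, \<open>E k\<close>
      on those from k to n - 1; both are written as preimages under restrictions of the family to
      these disjoint index sets.\<close>
    have indep: "prob (B k \<inter> E k) = prob (B k) * prob (E k)"
    proof -
      let ?I = "{..<k}" and ?J = "{k..<n}"
      let ?U = "{f \<in> space (PiM ?I (\<lambda>_. borel)). (\<forall>j\<in>?I. \<bar>\<Sum>i<j. f i\<bar> \<le> 3 * a) \<and> \<bar>\<Sum>i<k. f i\<bar> > 3 * a} :: (nat \<Rightarrow> real) set"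
      let ?V = "{f \<in> space (PiM ?J (\<lambda>_. borel)). \<bar>\<Sum>i\<in>?J. f i\<bar> > 2 * a} :: (nat \<Rightarrow> real) set"
      have proj: "(\<lambda>f. f i) \<in> borel_measurable (PiM K (\<lambda>_. borel :: real measure))" if "i \<in> K" for i :: nat and K
        using measurable_component_singleton[OF that, of "\<lambda>_. borel :: real measure"] .
      have "{f \<in> space (PiM ?I (\<lambda>_. borel)). \<forall>j\<in>?I. \<bar>\<Sum>i<j. f i\<bar> \<le> 3 * a} \<in> sets (PiM ?I (\<lambda>_. borel :: real measure))"
        by (intro sets.sets_Collect_finite_All borel_measurable_le borel_measurable_abs borel_measurable_sum proj) auto
      moreover have "{f \<in> space (PiM ?I (\<lambda>_. borel)). \<bar>\<Sum>i<k. f i\<bar> > 3 * a} \<in> sets (PiM ?I (\<lambda>_. borel :: real measure))"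
        by (intro borel_measurable_less borel_measurable_abs borel_measurable_sum proj) auto
      ultimately have U: "?U \<in> sets (PiM ?I (\<lambda>_. borel))" by (intro sets.sets_Collect_conj)
      have V: "?V \<in> sets (PiM ?J (\<lambda>_. borel))"
        by (intro borel_measurable_less borel_measurable_abs borel_measurable_sum proj) auto
      have "indep_var (PiM ?I (\<lambda>_. borel)) (\<lambda>\<omega>. restrict (\<lambda>i. D i \<omega>) ?I) (PiM ?J (\<lambda>_. borel)) (\<lambda>\<omega>. restrict (\<lambda>i. D i \<omega>) ?J)"
        using k by (intro indep_var_restrict[OF ind]) auto
      note indep_varD[OF this U V]
      moreover have "(\<Sum>i<j. restrict (\<lambda>i. D i \<omega>) ?I i) = S j \<omega>" if "j \<le> k" for j \<omega>
        unfolding S_def using that by (intro sum.cong) auto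
      then have "(\<lambda>\<omega>. restrict (\<lambda>i. D i \<omega>) ?I) -` ?U \<inter> space M = B k"
        by (auto simp: B_def space_PiM simp del: restrict_apply restrict_apply')
      moreover have "S n \<omega> - S k \<omega> = (\<Sum>i\<in>?J. D i \<omega>)" for \<omega>
        using k sum_diff_nat_ivl[of 0 k n "\<lambda>i. D i \<omega>"] by (simp add: S_def atLeast0LessThan)
      then have "(\<lambda>\<omega>. restrict (\<lambda>i. D i \<omega>) ?J) -` ?V \<inter> space M = E k"
        by (auto simp: E_def space_PiM)
      moreover have "(\<lambda>x. (restrict (\<lambda>i. D i x) ?I, restrict (\<lambda>i. D i x) ?J)) -` (?U \<times> ?V) \<inter> space M =
        ((\<lambda>\<omega>. restrict (\<lambda>i. D i \<omega>) ?I) -` ?U \<inter> space M) \<inter> ((\<lambda>\<omega>. restrict (\<lambda>i. D i \<omega>) ?J) -` ?V \<inter> space M)"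
        by blast
      ultimately show ?thesis by simp
    qed
    have "E k \<subseteq> A \<union> {\<omega> \<in> space M. \<bar>S k \<omega>\<bar> \<ge> a}" by (auto simp: E_def A_def)
    then have "prob (E k) \<le> prob (A \<union> {\<omega> \<in> space M. \<bar>S k \<omega>\<bar> \<ge> a})"
      using k by (intro finite_measure_mono) auto
    also have "\<dots> \<le> prob A + prob {\<omega> \<in> space M. \<bar>S k \<omega>\<bar> \<ge> a}"
      using k by (intro measure_Un_le) auto
    also have "\<dots> \<le> 2 * p" using p[OF k] p[of n] unfolding A_def by simp
    finally show "prob (B k \<inter> E k) \<le> prob (B k) * (2 * p)" unfolding indep by (intro mult_left_mono) auto
  qed
  also have "\<dots> = prob (\<Union>k\<in>{..n}. B k) * (2 * p)"
    using disj by (subst finite_measure_finite_Union) (auto simp: sum_distrib_right)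
  also have "\<dots> \<le> 1 * (2 * p)"
    using order_trans[OF measure_nonneg p[of n]] by (intro mult_right_mono) auto
  finally show ?thesis using p[of n] unfolding A_def by simp
qed

context additive_char
begin

lemma measurable_small_ball:
  assumes "finite F" "F \<subseteq> {0..}"
  shows "{\<omega> \<in> space M. \<forall>s\<in>F. \<bar>X s \<omega>\<bar> \<le> r} \<in> events"
proof (rule sets.sets_Collect_finite_All[OF _ assms(1)])
  fix s assume "s \<in> F"
  then have [measurable]: "X s \<in> borel_measurable M" using assms by (intro measurable_X) auto
  show "{\<omega> \<in> space M. \<bar>X s \<omega>\<bar> \<le> r} \<in> events" by measurable
qed

text \<open>If the path is within r of 0 at all partition points, every increment is at most 2r. By
  the contrapositive of \<open>small_increment_mass\<close> each increment does so with probability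
  at most 7/8, and the increments are independent. A finite set of times keeps the event
  measurable.\<close>

lemma small_ball_mass:
  assumes r: "0 < r" "r \<le> 1" and T: "T \<ge> 0"
  obtains F where "finite F" "F \<subseteq> {0..T}"
    "prob {\<omega> \<in> space M. \<forall>s\<in>F. \<bar>X s \<omega>\<bar> \<le> r} * mass r T \<le> 10000"
proof (cases "mass r T \<le> 10000")
  case True
  have "prob {\<omega> \<in> space M. \<forall>s\<in>{}. \<bar>X s \<omega>\<bar> \<le> r} * mass r T \<le> 1 * mass r T"
    using mass_nonneg[OF r(1) T] by (intro mult_right_mono) auto
  then show ?thesis using that[of "{}"] True by simp
next
  case False
  \<comment> \<open>With this n each piece carries mass at least 641, strictly above the 640 of
    \<open>small_increment_mass\<close>.\<close>
  define n where "n = nat \<lfloor>mass r T / 641\<rfloor>"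
  have n: "real n \<le> mass r T / 641" "mass r T / 641 < real n + 1"
    using False by (auto simp: n_def) linarith
  then have n1: "n \<ge> 1" using False by (cases n) auto
  obtain \<tau> where \<tau>: "\<tau> 0 = 0" "\<tau> n = T" "\<And>i. i < n \<Longrightarrow> \<tau> i \<le> \<tau> (Suc i)"
    "\<And>i. i \<le> n \<Longrightarrow> 0 \<le> \<tau> i \<and> \<tau> i \<le> T" "\<And>i. i < n \<Longrightarrow> mass r (\<tau> (Suc i)) - mass r (\<tau> i) = mass r T / n"
    using mono_equipartition[of T "mass r" n] mass_continuous[OF r(1)] mass_mono[OF r(1)] mass_0 T n1 by metis
  let ?F = "\<tau> ` {..n}" and ?D = "\<lambda>i \<omega>. X (\<tau> (Suc i)) \<omega> - X (\<tau> i) \<omega>"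
  have [measurable]: "X (\<tau> i) \<in> borel_measurable M" if "i \<le> n" for i
    using \<tau>(4)[OF that] by (intro measurable_X) auto
  have big: "mass r T / n > 640" using n n1 by (simp add: field_simps)
  have each: "prob (?D i -` {x. \<bar>x\<bar> \<le> 2 * r} \<inter> space M) \<le> 7 / 8" if i: "i < n" for i
  proof -
    have "\<not> mass r (\<tau> (Suc i)) - mass r (\<tau> i) \<le> 640" using \<tau>(5)[OF i] big by simp
    then have "\<not> prob {\<omega> \<in> space M. \<bar>?D i \<omega>\<bar> > 2 * r} \<le> 1 / 8"
      using small_increment_mass[OF r, of "\<tau> i" "\<tau> (Suc i)"] \<tau>(3,4) i by auto
    moreover have "prob {\<omega> \<in> space M. \<bar>?D i \<omega>\<bar> \<le> 2 * r} = 1 - prob {\<omega> \<in> space M. \<bar>?D i \<omega>\<bar> > 2 * r}"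
      using i by (subst prob_neg[symmetric]) (auto simp: not_less)
    ultimately show ?thesis by (simp add: vimage_def Int_def conj_commute)
  qed
  have ind: "indep_vars (\<lambda>_. borel) ?D {..<n}" using \<tau> by (intro indep_increments) auto
  have "{\<omega> \<in> space M. \<forall>s\<in>?F. \<bar>X s \<omega>\<bar> \<le> r} \<subseteq> (\<Inter>i\<in>{..<n}. ?D i -` {x. \<bar>x\<bar> \<le> 2 * r} \<inter> space M)"
  proof (intro subsetI INT_I IntI vimageI2 CollectI)
    fix \<omega> i assume \<omega>: "\<omega> \<in> {\<omega> \<in> space M. \<forall>s\<in>?F. \<bar>X s \<omega>\<bar> \<le> r}" and i: "i \<in> {..<n}"
    then have "\<bar>X (\<tau> i) \<omega>\<bar> \<le> r" "\<bar>X (\<tau> (Suc i)) \<omega>\<bar> \<le> r" by auto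
    then show "\<bar>?D i \<omega>\<bar> \<le> 2 * r" by linarith
  qed auto
  then have "prob {\<omega> \<in> space M. \<forall>s\<in>?F. \<bar>X s \<omega>\<bar> \<le> r} \<le> prob (\<Inter>i\<in>{..<n}. ?D i -` {x. \<bar>x\<bar> \<le> 2 * r} \<inter> space M)"
    using n1 by (intro finite_measure_mono sets.finite_INT) (auto simp: vimage_def Int_def conj_commute lessThan_empty_iff)
  also have "\<dots> = (\<Prod>i<n. prob (?D i -` {x. \<bar>x\<bar> \<le> 2 * r} \<inter> space M))"
    using n1 by (intro indep_varsD_finite[OF ind]) (auto simp: lessThan_empty_iff)
  also have "\<dots> \<le> (\<Prod>i<n. 7 / 8)" using each by (intro prod_mono) auto
  also have "\<dots> = (7 / 8) ^ n" by simp
  \<comment> \<open>The mass is below 641 (n + 1) <= 1282 n, and 1282 * 7 = 8974 is below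
    10000.\<close>
  finally have "prob {\<omega> \<in> space M. \<forall>s\<in>?F. \<bar>X s \<omega>\<bar> \<le> r} * mass r T \<le> (7 / 8) ^ n * (1282 * real n)"
    using n n1 False by (intro mult_mono) auto
  also have "\<dots> \<le> 10000" using power_7_8_le[of n] by (simp only: mult.left_commute[of _ 1282])
  finally show ?thesis using \<tau>(4) by (intro that[of ?F]) auto
qed

text \<open>Among n pieces of equal mass one has a drift of at least 4r in modulus. If the path is
  within r of 0 at both ends of that piece, its increment is at most 2r and so misses its drift by
  at least 2r, which \<open>increment_tail\<close> makes unlikely. The two end points are the whole
  set \<open>F\<close>.\<close>

lemma small_ball_drift:
  assumes r: "0 < r" "r \<le> 1" and s: "s \<ge> 0" and n: "n \<ge> 1" and d: "\<bar>drift r s\<bar> \<ge> 4 * r * real n"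
  obtains F where "finite F" "F \<subseteq> {0..s}"
    "prob {\<omega> \<in> space M. \<forall>s\<in>F. \<bar>X s \<omega>\<bar> \<le> r} \<le> 10 * mass r s / n"
proof -
  obtain \<tau> where \<tau>: "\<tau> 0 = 0" "\<tau> n = s" "\<And>i. i < n \<Longrightarrow> \<tau> i \<le> \<tau> (Suc i)"
    "\<And>i. i \<le> n \<Longrightarrow> 0 \<le> \<tau> i \<and> \<tau> i \<le> s" "\<And>i. i < n \<Longrightarrow> mass r (\<tau> (Suc i)) - mass r (\<tau> i) = mass r s / n"
    using mono_equipartition[of s "mass r" n] mass_continuous[OF r(1)] mass_mono[OF r(1)] mass_0 s n by metis
  have "\<exists>i<n. \<bar>drift r (\<tau> (Suc i)) - drift r (\<tau> i)\<bar> \<ge> 4 * r"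
  proof (rule ccontr)
    assume neg: "\<not> ?thesis"
    have "drift r s = (\<Sum>i<n. drift r (\<tau> (Suc i)) - drift r (\<tau> i))"
      by (subst sum_lessThan_telescope) (simp add: \<tau> drift_0)
    then have "\<bar>drift r s\<bar> \<le> (\<Sum>i<n. \<bar>drift r (\<tau> (Suc i)) - drift r (\<tau> i)\<bar>)" by simp
    also have "\<dots> < (\<Sum>i<n. 4 * r)" using neg n by (intro sum_strict_mono) (auto simp: lessThan_empty_iff)
    finally show False using d by (simp add: mult_ac)
  qed
  then obtain i where i: "i < n" "\<bar>drift r (\<tau> (Suc i)) - drift r (\<tau> i)\<bar> \<ge> 4 * r" by blast
  let ?u = "\<tau> i" and ?v = "\<tau> (Suc i)"
  have [measurable]: "X ?u \<in> borel_measurable M" "X ?v \<in> borel_measurable M"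
    using \<tau>(4)[of i] \<tau>(4)[of "Suc i"] i by (auto intro: measurable_X)
  have "prob {\<omega> \<in> space M. \<forall>s\<in>{?u, ?v}. \<bar>X s \<omega>\<bar> \<le> r} \<le>
      prob {\<omega> \<in> space M. \<bar>X ?v \<omega> - X ?u \<omega> - (drift r ?v - drift r ?u)\<bar> \<ge> 2 * r}"
    using i(2) by (intro finite_measure_mono) auto
  also have "\<dots> \<le> 10 * (mass r ?v - mass r ?u)" using \<tau>(3,4) i by (intro increment_tail r) auto
  also have "\<dots> = 10 * mass r s / n" using \<tau>(5)[OF i(1)] by simp
  finally show ?thesis using \<tau>(4)[of i] \<tau>(4)[of "Suc i"] i by (intro that[of "{?u, ?v}"]) auto
qed

text \<open>The time s is meant to be one where the maximum in \<open>M_star\<close> is attained,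
  possibly before T. For y < 16 the bound exceeds 1 and says nothing; otherwise mass at least
  sqrt(y) leads to \<open>small_ball_mass\<close> and smaller mass to
  \<open>small_ball_drift\<close>.\<close>

lemma small_ball:
  assumes r: "0 < r" "r \<le> 1" and s: "0 \<le> s" "s \<le> T" and y: "0 < y" "y \<le> mass r T + \<bar>drift r s\<bar> / r"
  obtains F where "finite F" "F \<subseteq> {0..T}"
    "prob {\<omega> \<in> space M. \<forall>s\<in>F. \<bar>X s \<omega>\<bar> \<le> r} \<le> 10000 / sqrt y"
proof -
  have T: "T \<ge> 0" using s by simp
  have sq: "sqrt y > 0" "sqrt y * sqrt y = y" using y by simp_all
  consider "y < 16" | "mass r T \<ge> sqrt y" | "y \<ge> 16" "mass r T < sqrt y" by linarith
  then show ?thesis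
  proof cases
    case 1
    then have "sqrt y < sqrt 16" by (simp only: real_sqrt_less_iff)
    then have "1 \<le> 10000 / sqrt y" using sq by (simp add: field_simps)
    then show ?thesis by (intro that[of "{}"]) (auto simp: prob_space)
  next
    case 2
    obtain F where F: "finite F" "F \<subseteq> {0..T}" "prob {\<omega> \<in> space M. \<forall>s\<in>F. \<bar>X s \<omega>\<bar> \<le> r} * mass r T \<le> 10000"
      using small_ball_mass[OF r T] .
    have "prob {\<omega> \<in> space M. \<forall>s\<in>F. \<bar>X s \<omega>\<bar> \<le> r} * sqrt y \<le> prob {\<omega> \<in> space M. \<forall>s\<in>F. \<bar>X s \<omega>\<bar> \<le> r} * mass r T"
      using 2 by (intro mult_left_mono) auto
    also note F(3)
    finally show ?thesis using sq F by (intro that[of F]) (auto simp: field_simps)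
  next
    case 3
    \<comment> \<open>For y >= 16 one has sqrt(y) <= y/4, so |drift| / r is at least y/2, which pays
      for y/8 pieces at 4 each. Also n >= y/8 - 1 >= y/16, whence the bound 160 / sqrt(y).\<close>
    define n where "n = nat \<lfloor>y / 8\<rfloor>"
    have n: "real n \<le> y / 8" "y / 8 < real n + 1" using 3 by (auto simp: n_def) linarith
    then have n1: "n \<ge> 1" using 3 by (cases n) auto
    have n2: "real n \<ge> y / 16" using n 3 by linarith
    have "sqrt 16 \<le> sqrt y" using 3 by (simp only: real_sqrt_le_iff)
    then have "4 * sqrt y \<le> sqrt y * sqrt y" using sq by (intro mult_right_mono) auto
    then have "y / 2 \<le> \<bar>drift r s\<bar> / r" using y(2) 3 sq by linarith
    then have "4 * real n \<le> \<bar>drift r s\<bar> / r" using n by linarith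
    then have "4 * r * real n \<le> \<bar>drift r s\<bar>" using r by (simp add: field_simps)
    from small_ball_drift[OF r s(1) n1 this]
    obtain F where F: "finite F" "F \<subseteq> {0..s}" "prob {\<omega> \<in> space M. \<forall>s\<in>F. \<bar>X s \<omega>\<bar> \<le> r} \<le> 10 * mass r s / n" .
    have "10 * mass r s / n \<le> 10 * sqrt y / (y / 16)"
      using mass_mono[OF r(1) s] 3 n2 sq n1 y by (intro frac_le) auto
    also have "\<dots> = 160 * (sqrt y / y)" by simp
    also have "sqrt y / y = 1 / sqrt y" using sq y(1) by (simp add: field_simps)
    also have "160 * (1 / sqrt y) \<le> 10000 / sqrt y" using sq(1) by (simp add: divide_right_mono)
    finally show ?thesis using F s by (intro that[of F]) auto
  qed
qed

text \<open>Etemadi's inequality with level 2r from \<open>tail\<close>, which yields 6r = 3 * 2r.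
  Time 0 is inserted so that the partial sums of the increments are values of the path.\<close>

lemma finite_max_tail:
  assumes r: "0 < r" "r \<le> 1" and F: "finite F" "F \<subseteq> {0..}"
    and a: "\<And>s. s \<in> insert 0 F \<Longrightarrow> 10 * (mass r s + \<bar>drift r s\<bar> / r) \<le> a"
  shows "prob {\<omega> \<in> space M. \<exists>s\<in>F. \<bar>X s \<omega>\<bar> > 6 * r} \<le> 3 * a"
proof -
  let ?G = "insert 0 F"
  define xs where "xs = sorted_list_of_set ?G"
  define n where "n = length xs - 1"
  \<comment> \<open>The minimum clamps the index at the last entry, which makes the sequence
    nondecreasing for all natural numbers.\<close>
  define \<tau> where "\<tau> i = xs ! min i n" for i
  have xs: "set xs = ?G" "sorted xs"
    using F set_sorted_list_of_set[of ?G] sorted_sorted_list_of_set[of ?G] unfolding xs_def by blast+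
  then have len: "length xs = Suc n" by (cases xs) (auto simp: n_def)
  have \<tau>G: "\<tau> i \<in> ?G" for i using len xs(1) nth_mem[of "min i n" xs] by (auto simp: \<tau>_def)
  have \<tau>0: "\<tau> i \<ge> 0" for i using \<tau>G[of i] F by auto
  have mono: "\<tau> i \<le> \<tau> (Suc i)" for i unfolding \<tau>_def using len by (intro sorted_nth_mono[OF xs(2)]) auto
  have G: "\<exists>i\<le>n. s = \<tau> i" if s: "s \<in> ?G" for s
  proof -
    obtain i where "i < length xs" "xs ! i = s" using s xs(1) in_set_conv_nth[of s xs] by auto
    then show ?thesis using len by (intro exI[of _ i]) (auto simp: \<tau>_def)
  qed
  have start: "\<tau> 0 = 0"
  proof -
    obtain i where i: "i \<le> n" "0 = \<tau> i" using G[OF insertI1] by blast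
    have "\<tau> 0 \<le> \<tau> i" by (rule lift_Suc_mono_le[of \<tau>, OF mono]) simp
    then show ?thesis using i(2) \<tau>0[of 0] by linarith
  qed
  have [measurable]: "X (\<tau> i) \<in> borel_measurable M" for i using \<tau>0 by (rule measurable_X)
  have [measurable]: "X 0 \<in> borel_measurable M" by (rule measurable_X) simp
  let ?D = "\<lambda>i \<omega>. X (\<tau> (Suc i)) \<omega> - X (\<tau> i) \<omega>"
  have tel: "(\<Sum>i<k. ?D i \<omega>) = X (\<tau> k) \<omega> - X 0 \<omega>" for k \<omega>
    by (subst sum_lessThan_telescope) (simp add: start)
  \<comment> \<open>The telescoping sum contains \<open>X 0\<close>, which vanishes only almost
    surely; this lets it be replaced by 0 inside a probability.\<close>
  have AE_eq: "prob {\<omega> \<in> space M. P (X 0 \<omega>) \<omega>} = prob {\<omega> \<in> space M. P 0 \<omega>}"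
    if "{\<omega> \<in> space M. P (X 0 \<omega>) \<omega>} \<in> events" "{\<omega> \<in> space M. P 0 \<omega>} \<in> events" for P
    by (rule finite_measure_eq_AE) (use AE_X_0 that in auto)
  have "prob {\<omega> \<in> space M. \<exists>k\<le>n. \<bar>\<Sum>i<k. ?D i \<omega>\<bar> > 3 * (2 * r)} \<le> 3 * a"
  proof (rule etemadi_maximal_inequality)
    show "indep_vars (\<lambda>_. borel) ?D {..<n}" using mono \<tau>0 by (intro indep_increments) auto
    fix k assume "k \<le> n"
    have "prob {\<omega> \<in> space M. \<bar>\<Sum>i<k. ?D i \<omega>\<bar> \<ge> 2 * r} = prob {\<omega> \<in> space M. \<bar>X (\<tau> k) \<omega> - 0\<bar> \<ge> 2 * r}"
      unfolding tel by (rule AE_eq) measurable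
    also have "\<dots> \<le> 10 * (mass r (\<tau> k) + \<bar>drift r (\<tau> k)\<bar> / r)" using tail[OF r \<tau>0] by simp
    also have "\<dots> \<le> a" by (rule a[OF \<tau>G])
    finally show "prob {\<omega> \<in> space M. \<bar>\<Sum>i<k. ?D i \<omega>\<bar> \<ge> 2 * r} \<le> a" .
  qed
  also have "prob {\<omega> \<in> space M. \<exists>k\<le>n. \<bar>\<Sum>i<k. ?D i \<omega>\<bar> > 3 * (2 * r)} =
      prob {\<omega> \<in> space M. \<exists>k\<le>n. \<bar>X (\<tau> k) \<omega> - 0\<bar> > 3 * (2 * r)}"
    unfolding tel by (rule AE_eq) measurable
  finally have "prob {\<omega> \<in> space M. \<exists>k\<le>n. \<bar>X (\<tau> k) \<omega>\<bar> > 6 * r} \<le> 3 * a" by simp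
  moreover have "prob {\<omega> \<in> space M. \<exists>s\<in>F. \<bar>X s \<omega>\<bar> > 6 * r} \<le> prob {\<omega> \<in> space M. \<exists>k\<le>n. \<bar>X (\<tau> k) \<omega>\<bar> > 6 * r}"
  proof (rule finite_measure_mono)
    show "{\<omega> \<in> space M. \<exists>s\<in>F. \<bar>X s \<omega>\<bar> > 6 * r} \<subseteq> {\<omega> \<in> space M. \<exists>k\<le>n. \<bar>X (\<tau> k) \<omega>\<bar> > 6 * r}"
      using G by blast
  qed measurable
  ultimately show ?thesis by linarith
qed

text \<open>The finite bound is uniform in the finite set, so it passes to an increasing union over
  a countable dense set and then, by right-continuity, to the path. \<open>T\<close> may be
  infinite.\<close>

lemma path_max_tail:
  fixes T :: ennreal
  assumes r: "0 < r" "r \<le> 1"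
    and a: "\<And>s. 0 \<le> s \<Longrightarrow> ennreal s \<le> T \<Longrightarrow> 10 * (mass r s + \<bar>drift r s\<bar> / r) \<le> a"
  obtains N where "N \<in> events" "prob N \<le> 3 * a"
    "AE \<omega> in M. \<omega> \<notin> N \<longrightarrow> (\<forall>s\<ge>0. ennreal s \<le> T \<longrightarrow> \<bar>X s \<omega>\<bar> \<le> 6 * r)"
proof -
  \<comment> \<open>A finite \<open>T\<close> is added separately: right-continuity reaches a time s
    only through later times in the interval, and there are none after \<open>T\<close>.\<close>
  define D where "D = {q. q \<in> \<rat> \<and> 0 \<le> q \<and> ennreal q \<le> T} \<union> {t. 0 \<le> t \<and> ennreal t = T}"
  have "countable D"
    unfolding D_def
  proof (intro countable_Un)
    show "countable {q. q \<in> \<rat> \<and> 0 \<le> q \<and> ennreal q \<le> T}"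
      by (rule countable_subset[OF _ countable_rat]) auto
    have "{t. 0 \<le> t \<and> ennreal t = T} \<subseteq> {enn2real T}" by auto
    then show "countable {t. 0 \<le> t \<and> ennreal t = T}" by (rule countable_subset) simp
  qed
  have D0: "0 \<in> D" by (simp add: D_def)
  define d where "d = from_nat_into D"
  have d: "range d = D" unfolding d_def using D0 \<open>countable D\<close> by (intro range_from_nat_into) auto
  have dD: "0 \<le> d i" "ennreal (d i) \<le> T" for i
  proof -
    have "d i \<in> D" using d by auto
    then show "0 \<le> d i" "ennreal (d i) \<le> T" by (auto simp: D_def)
  qed
  have [measurable]: "X (d i) \<in> borel_measurable M" for i using dD by (intro measurable_X) auto
  define A where "A n = {\<omega> \<in> space M. \<exists>s\<in>d ` {..n}. \<bar>X s \<omega>\<bar> > 6 * r}" for n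
  have A[measurable]: "A n \<in> events" for n
  proof -
    have "A n = {\<omega> \<in> space M. \<exists>i\<in>{..n}. \<bar>X (d i) \<omega>\<bar> > 6 * r}" by (auto simp: A_def)
    also have "\<dots> \<in> events" by measurable
    finally show ?thesis .
  qed
  have "prob (A n) \<le> 3 * a" for n
    unfolding A_def
  proof (rule finite_max_tail[OF r])
    show "10 * (mass r s + \<bar>drift r s\<bar> / r) \<le> a" if "s \<in> insert 0 (d ` {..n})" for s
      using that dD by (intro a) auto
  qed (use dD in auto)
  moreover have "(\<lambda>n. prob (A n)) \<longlonglongrightarrow> prob (\<Union>n. A n)"
    by (rule finite_Lim_measure_incseq) (auto simp: A_def incseq_def)
  ultimately have "prob (\<Union>n. A n) \<le> 3 * a" by (intro LIMSEQ_le_const2) auto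
  moreover have "AE \<omega> in M. \<omega> \<notin> (\<Union>n. A n) \<longrightarrow> (\<forall>s\<ge>0. ennreal s \<le> T \<longrightarrow> \<bar>X s \<omega>\<bar> \<le> 6 * r)"
  proof -
    have "AE \<omega> in M. cadlag_path (\<lambda>t. X t \<omega>)" using additive by (auto simp: additive_process_def)
    then show ?thesis
    proof (rule AE_mp, intro AE_I2 impI allI)
      fix \<omega> s assume \<omega>: "\<omega> \<in> space M" "cadlag_path (\<lambda>t. X t \<omega>)" "\<omega> \<notin> (\<Union>n. A n)" and s: "0 \<le> s" "ennreal s \<le> T"
      have onD: "\<bar>X q \<omega>\<bar> \<le> 6 * r" if q: "q \<in> D" for q
      proof -
        obtain n where "q = d n" using q d by auto
        then show ?thesis using \<omega>(1,3) by (auto simp: A_def not_less)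
      qed
      show "\<bar>X s \<omega>\<bar> \<le> 6 * r"
      proof (cases "ennreal s = T")
        case True
        then show ?thesis using s by (intro onD) (auto simp: D_def)
      next
        case False
        then have sT: "ennreal s < T" using s by simp
        have lim: "((\<lambda>t. X t \<omega>) \<longlongrightarrow> X s \<omega>) (at_right s)"
          using \<omega>(2) s by (auto simp: cadlag_path_def continuous_within)
        have ev: "\<forall>\<^sub>F q in at_right s. ennreal q < T"
        proof (cases T)
          case (real t)
          then have "s < t" using sT s by (simp add: ennreal_less_iff)
          then show ?thesis using real s
            by (intro eventually_at_rightI[of s t]) (auto simp: ennreal_less_iff)
        qed simp
        show ?thesis
        proof (rule ccontr)
          assume "\<not> \<bar>X s \<omega>\<bar> \<le> 6 * r"
          then have "\<forall>\<^sub>F q in at_right s. \<bar>X q \<omega>\<bar> > 6 * r"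
            using tendsto_rabs[OF lim] by (intro order_tendstoD(1)) auto
          with ev have "\<forall>\<^sub>F q in at_right s. ennreal q < T \<and> \<bar>X q \<omega>\<bar> > 6 * r" by (rule eventually_conj)
          then obtain b where b: "b > s" "\<And>q. s < q \<Longrightarrow> q < b \<Longrightarrow> ennreal q < T \<and> \<bar>X q \<omega>\<bar> > 6 * r"
            unfolding eventually_at_right_field by blast
          obtain q where q: "q \<in> \<rat>" "s < q" "q < b" using Rats_dense_in_real[OF b(1)] by blast
          then have "q \<in> D" using b(2)[of q] s by (auto simp: D_def less_imp_le)
          then show False using onD[of q] b(2)[of q] q by simp
        qed
      qed
    qed
  qed
  ultimately show ?thesis using A by (intro that[of "\<Union>n. A n"]) auto
qed

end


section \<open>Dependence of \<open>y_real\<close> on time, and its growth as the level tends to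
  0\<close>

context additive_char
begin

lemma y_real_eq:
  assumes "0 < r" "r \<le> 1" "t \<ge> 0"
  shows "y_real B C \<nu> t r = mass r t + M_star B \<nu> t r"
  using G_K_eq_mass[of r t] assms by (simp add: y_real_def)

lemma M_fun_continuous:
  assumes "0 < r" "r \<le> 1" shows "continuous_on {0..t} (\<lambda>s. M_fun B \<nu> s r)"
  unfolding M_fun_eq_drift[OF assms]
  using assms by (intro continuous_intros continuous_on_subset[OF drift_continuous]) auto

lemma M_star_attained:
  assumes r: "0 < r" "r \<le> 1" and t: "t \<ge> 0"
  shows "\<exists>s\<in>{0..t}. M_star B \<nu> t r = \<bar>drift r s\<bar> / r \<and> (\<forall>u\<in>{0..t}. \<bar>drift r u\<bar> / r \<le> M_star B \<nu> t r)"
proof -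
  obtain s where s: "s \<in> {0..t}" "\<And>u. u \<in> {0..t} \<Longrightarrow> M_fun B \<nu> u r \<le> M_fun B \<nu> s r"
    using continuous_attains_sup[of "{0..t}" "\<lambda>s. M_fun B \<nu> s r"] M_fun_continuous[OF r] t by auto
  have "M_star B \<nu> t r = M_fun B \<nu> s r"
    unfolding M_star_def by (rule cSup_eq_maximum) (use s in auto)
  then show ?thesis using s M_fun_eq_drift[OF r] by auto
qed

lemma drift_le_M_star:
  assumes "0 < r" "r \<le> 1" "0 \<le> s" "s \<le> t" shows "\<bar>drift r s\<bar> / r \<le> M_star B \<nu> t r"
  using M_star_attained[OF assms(1,2), of t] assms by auto

lemma M_star_mono:
  assumes "0 < r" "r \<le> 1" "0 \<le> s" "s \<le> t" shows "M_star B \<nu> s r \<le> M_star B \<nu> t r"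
proof -
  obtain u where "u \<in> {0..s}" "M_star B \<nu> s r = \<bar>drift r u\<bar> / r"
    using M_star_attained[OF assms(1-3)] by blast
  then show ?thesis using drift_le_M_star[OF assms(1,2), of u t] assms by auto
qed

lemma y_real_mono:
  assumes "0 < r" "r \<le> 1" "0 \<le> s" "s \<le> t" shows "y_real B C \<nu> s r \<le> y_real B C \<nu> t r"
  using M_star_mono[OF assms] mass_mono[of r s t] assms by (simp add: y_real_eq)

lemma y_real_nonneg:
  assumes "0 < r" "r \<le> 1" "0 \<le> t" shows "0 \<le> y_real B C \<nu> t r"
  using drift_le_M_star[OF assms(1,2), of 0 t] mass_nonneg[of r t] assms by (simp add: y_real_eq drift_0)

text \<open>Needed at the infimum of the times at which \<open>y\<close> exceeds a bound. The
  maximum over the longer interval is attained either before t, where it does not exceed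
  \<open>M_star\<close> at t, or just after t, where \<open>M_fun\<close> is close to its value at
  t.\<close>

lemma y_real_right_continuous:
  assumes r: "0 < r" "r \<le> 1" and t: "0 \<le> t" and e: "e > 0"
  shows "\<exists>d>0. \<forall>s. t \<le> s \<and> s < t + d \<longrightarrow> y_real B C \<nu> s r \<le> y_real B C \<nu> t r + e"
proof -
  have "continuous_on {0..t+1} (\<lambda>s. mass r s)" by (rule mass_continuous[OF r(1)])
  then obtain d1 where d1: "d1 > 0" "\<And>s. s \<in> {0..t+1} \<Longrightarrow> dist s t < d1 \<Longrightarrow> dist (mass r s) (mass r t) < e / 2"
    using e t unfolding continuous_on_iff by (metis atLeastAtMost_iff half_gt_zero le_add_same_cancel1 zero_le_one)
  have "continuous_on {0..t+1} (\<lambda>s. M_fun B \<nu> s r)" by (rule M_fun_continuous[OF r])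
  then obtain d2 where d2: "d2 > 0" "\<And>s. s \<in> {0..t+1} \<Longrightarrow> dist s t < d2 \<Longrightarrow> dist (M_fun B \<nu> s r) (M_fun B \<nu> t r) < e / 2"
    using e t unfolding continuous_on_iff by (metis atLeastAtMost_iff half_gt_zero le_add_same_cancel1 zero_le_one)
  show ?thesis
  proof (intro exI[of _ "min 1 (min d1 d2)"] conjI allI impI)
    fix s assume s: "t \<le> s \<and> s < t + min 1 (min d1 d2)"
    then have s': "s \<in> {0..t+1}" "dist s t < d1" using t by (auto simp: dist_real_def)
    have "mass r s \<le> mass r t + e / 2" using d1(2)[OF s'] unfolding dist_real_def by linarith
    moreover have "M_star B \<nu> s r \<le> M_star B \<nu> t r + e / 2"
    proof -
      obtain u where u: "u \<in> {0..s}" "M_star B \<nu> s r = \<bar>drift r u\<bar> / r"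
        using M_star_attained[OF r, of s] s' by auto
      show ?thesis
      proof (cases "u \<le> t")
        case True
        then show ?thesis using drift_le_M_star[OF r, of u t] u e by auto
      next
        case False
        then have "dist (M_fun B \<nu> u r) (M_fun B \<nu> t r) < e / 2" using u s t by (intro d2(2)) (auto simp: dist_real_def)
        then show ?thesis
          using drift_le_M_star[OF r t order_refl] u(2) unfolding M_fun_eq_drift[OF r] dist_real_def by linarith
      qed
    qed
    ultimately show "y_real B C \<nu> s r \<le> y_real B C \<nu> t r + e" using r t s by (simp add: y_real_eq)
  qed (use d1 d2 in auto)
qed

text \<open>The tail bound involves \<open>M\<close> rather than \<open>M\<^sup>*\<close>, so that it extends to the end point
  \<open>s = T\<close> by continuity.\<close>

lemma mass_drift_le_of_less:
  assumes r: "0 < r" "r \<le> 1" and s: "0 < s"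
    and le: "\<And>u. 0 \<le> u \<Longrightarrow> u < s \<Longrightarrow> mass r u + \<bar>drift r u\<bar> / r \<le> a"
  shows "mass r s + \<bar>drift r s\<bar> / r \<le> a"
proof (rule tendsto_upperbound)
  have "continuous_on {0..s} (\<lambda>u. mass r u + \<bar>drift r u\<bar> / r)"
    using r by (intro continuous_intros mass_continuous continuous_on_subset[OF drift_continuous]) auto
  then have "((\<lambda>u. mass r u + \<bar>drift r u\<bar> / r) \<longlongrightarrow> mass r s + \<bar>drift r s\<bar> / r) (at s within {0..s})"
    using s by (auto simp: continuous_on_def)
  then show "((\<lambda>u. mass r u + \<bar>drift r u\<bar> / r) \<longlongrightarrow> mass r s + \<bar>drift r s\<bar> / r) (at_left s)"
    using s by (simp add: at_within_Icc_at_left)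
  show "\<forall>\<^sub>F u in at_left s. mass r u + \<bar>drift r u\<bar> / r \<le> a"
    using s by (intro eventually_at_leftI[of 0]) (auto intro!: le)
qed simp

text \<open>Mass scales at worst like r^(-2). The integral inside the drift is O(1/r), and
  \<open>M_star\<close> divides by r once more.\<close>

lemma y_real_growth:
  assumes b: "b \<ge> 0"
  shows "\<exists>K. \<forall>r. 0 < r \<and> r \<le> 1 \<longrightarrow> y_real B C \<nu> b r \<le> K / r\<^sup>2"
proof -
  obtain B0 where B0: "\<And>s. s \<in> {0..b} \<Longrightarrow> \<bar>B s\<bar> \<le> B0"
  proof -
    have "bounded (B ` {0..b})"
      by (intro compact_imp_bounded compact_continuous_image continuous_on_subset[OF B_cont]) auto
    then obtain a where "\<forall>x\<in>{0..b}. \<bar>B x\<bar> \<le> a" unfolding bounded_iff by auto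
    then show ?thesis by (intro that[of a]) blast
  qed
  have B00: "B0 \<ge> 0" using B0[of 0] b by (auto simp: B_0)
  define I where "I = (LINT x|\<nu> b. trunc 1 x)"
  have I0: "I \<ge> 0" by (simp add: I_def)
  have C0: "C b \<ge> 0" using mono_onD[OF C_mono, of 0 b] b by (simp add: C_0)
  have "y_real B C \<nu> b r \<le> (C b + I + (B0 + I)) / r\<^sup>2" if r: "0 < r" "r \<le> 1" for r
  proof -
    have "(LINT x|\<nu> b. trunc r x) \<le> (LINT x|\<nu> b. trunc 1 x / r\<^sup>2)"
      using trunc_le[OF r] r by (intro integral_mono integrable_trunc levy b integrable_divide) auto
    then have m: "mass r b \<le> (C b + I) / r\<^sup>2" by (simp add: mass_def I_def add_divide_distrib)
    obtain s where s: "s \<in> {0..b}" "M_star B \<nu> b r = \<bar>drift r s\<bar> / r" using M_star_attained[OF r b] by blast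
    let ?f = "\<lambda>x. x * indicator {x. r < \<bar>x\<bar> \<and> \<bar>x\<bar> \<le> 1} x :: real"
    have f: "\<bar>?f x\<bar> \<le> trunc 1 x / r" for x
    proof (cases "r < \<bar>x\<bar> \<and> \<bar>x\<bar> \<le> 1")
      case True
      \<comment> \<open>On r < |x| the first power of |x| is at most x^2 / r, which is where the
        factor 1/r comes from.\<close>
      have "\<bar>x\<bar> * r \<le> \<bar>x\<bar> * \<bar>x\<bar>" using True by (intro mult_left_mono) auto
      then show ?thesis using True r by (simp add: trunc_eq_square power2_eq_square field_simps)
    qed (use r in auto)
    have Is: "integrable (\<nu> s) (trunc 1)" using s by (intro integrable_trunc levy) auto
    have "\<bar>LINT x|\<nu> s. ?f x\<bar> \<le> (LINT x|\<nu> s. trunc 1 x / r)"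
    proof (rule order_trans[OF integral_abs_bound integral_mono])
      show "integrable (\<nu> s) (\<lambda>x. \<bar>?f x\<bar>)"
        using s r by (intro integrable_abs integrable_levy_away[of _ r _ 1] levy) (auto split: split_indicator)
      show "integrable (\<nu> s) (\<lambda>x. trunc 1 x / r)" using Is by (rule integrable_divide)
    qed (rule f)
    also have "\<dots> = (LINT x|\<nu> s. trunc 1 x) / r" by simp
    also have "\<dots> \<le> I / r"
    proof (rule divide_right_mono)
      show "(LINT x|\<nu> s. trunc 1 x) \<le> I"
        unfolding I_def
        using s b by (intro integral_mono_measure_nonneg(2) \<nu>_mono' integrable_trunc levy) simp_all
    qed (use r in simp)
    finally have "\<bar>drift r s\<bar> \<le> B0 + I / r" using B0[OF s(1)] unfolding drift_def by linarith
    also have "\<dots> \<le> (B0 + I) / r"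
    proof -
      have "B0 * r \<le> B0 * 1" using r B00 by (intro mult_left_mono) auto
      then have "B0 \<le> B0 / r" using r by (simp add: le_divide_eq)
      then show ?thesis by (simp add: add_divide_distrib)
    qed
    finally have "M_star B \<nu> b r \<le> (B0 + I) / r / r" unfolding s(2) using r by (intro divide_right_mono) auto
    then show ?thesis using m r b by (simp add: y_real_eq add_divide_distrib power2_eq_square)
  qed
  then show ?thesis by blast
qed

end


section \<open>Vector processes with additive components\<close>

locale additive_vec = prob_space M for M :: "'w measure" +
  fixes X :: "real \<Rightarrow> 'w \<Rightarrow> real ^ 'd" and B C :: "'d \<Rightarrow> real \<Rightarrow> real" and \<nu> :: "'d \<Rightarrow> real \<Rightarrow> real measure"
    and y :: "real \<Rightarrow> real \<Rightarrow> real"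
  assumes comp: "\<And>i. additive_char M (\<lambda>t \<omega>. X t \<omega> $ i) (B i) (C i) (\<nu> i)"
    and y: "y = y_fun B C \<nu>"
begin

sublocale comp: additive_char M "\<lambda>t \<omega>. X t \<omega> $ i" "B i" "C i" "\<nu> i" for i
  by (rule comp)

lemma y_nonneg: "0 < r \<Longrightarrow> r \<le> 1 \<Longrightarrow> 0 \<le> t \<Longrightarrow> 0 \<le> y t r"
  unfolding y y_fun_def by (intro sum_nonneg comp.y_real_nonneg)

lemma y_real_le_y: "0 < r \<Longrightarrow> r \<le> 1 \<Longrightarrow> 0 \<le> t \<Longrightarrow> y_real (B i) (C i) (\<nu> i) t r \<le> y t r"
  unfolding y y_fun_def by (rule member_le_sum) (auto intro: comp.y_real_nonneg)

lemma y_right_continuous: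
  assumes r: "0 < r" "r \<le> 1" and t: "0 \<le> t" and e: "e > 0"
  shows "\<exists>d>0. \<forall>s. t \<le> s \<and> s < t + d \<longrightarrow> y s r \<le> y t r + e"
proof -
  have "\<forall>i. \<exists>d>0. \<forall>s. t \<le> s \<and> s < t + d \<longrightarrow> y_real (B i) (C i) (\<nu> i) s r \<le> y_real (B i) (C i) (\<nu> i) t r + e / CARD('d)"
    using e by (intro allI comp.y_real_right_continuous r t) simp
  then obtain d where d: "\<And>i. d i > 0"
    "\<And>i s. t \<le> s \<Longrightarrow> s < t + d i \<Longrightarrow> y_real (B i) (C i) (\<nu> i) s r \<le> y_real (B i) (C i) (\<nu> i) t r + e / CARD('d)"
    by metis
  show ?thesis
  proof (intro exI[of _ "Min (range d)"] conjI allI impI)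
    show "Min (range d) > 0" using d(1) by simp
    fix s assume s: "t \<le> s \<and> s < t + Min (range d)"
    have "s < t + d i" for i
    proof -
      have "Min (range d) \<le> d i" by (rule Min_le) auto
      then show ?thesis using s by linarith
    qed
    then have "y s r \<le> (\<Sum>i\<in>UNIV. y_real (B i) (C i) (\<nu> i) t r + e / CARD('d))"
      unfolding y y_fun_def using s by (intro sum_mono d(2)) auto
    also have "\<dots> = y t r + e" unfolding y y_fun_def by (simp add: sum.distrib)
    finally show "y s r \<le> y t r + e" .
  qed
qed

lemma y_growth:
  assumes b: "b \<ge> 0"
  obtains K where "\<And>r. 0 < r \<Longrightarrow> r \<le> 1 \<Longrightarrow> y b r \<le> K / r\<^sup>2"
proof -
  obtain K where K: "\<And>i r. 0 < r \<Longrightarrow> r \<le> 1 \<Longrightarrow> y_real (B i) (C i) (\<nu> i) b r \<le> K i / r\<^sup>2"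
    using comp.y_real_growth[OF b] by metis
  have "y b r \<le> (\<Sum>i\<in>UNIV. K i) / r\<^sup>2" if "0 < r" "r \<le> 1" for r
    unfolding y y_fun_def sum_divide_distrib using that by (intro sum_mono K)
  then show ?thesis by (rule that)
qed

text \<open>\<open>path_max_tail\<close> bounds the exceptional event for each coordinate by 3 * 10
  * a j = 30 a j, and Borel-Cantelli applies. The norm is estimated by the sum of the coordinates,
  hence the factor \<open>CARD('d)\<close>.\<close>

lemma running_sup_lower_AE:
  fixes r a :: "nat \<Rightarrow> real"
  assumes r: "\<And>j. 0 < r j" "\<And>j. r j \<le> 1" and a: "\<And>j. 0 \<le> a j" "summable a"
  shows "AE \<omega> in M. \<forall>\<^sub>F j in sequentially.
    running_sup X (Sup {ennreal s | s. s > 0 \<and> y s (r j) \<le> a j}) \<omega> \<le> ennreal (6 * CARD('d) * r j)"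
proof -
  let ?T = "\<lambda>j. Sup {ennreal s | s. s > 0 \<and> y s (r j) \<le> a j}"
  have le: "10 * (comp.mass i (r j) s + \<bar>comp.drift i (r j) s\<bar> / r j) \<le> 10 * a j"
    if s: "0 \<le> s" "ennreal s \<le> ?T j" for i j s
  proof -
    \<comment> \<open>The supremum need not be attained. Strictly below it there is a later
      admissible time, and \<open>y\<close> is nondecreasing in time; the supremum itself is then
      reached by continuity of mass and drift.\<close>
    have less: "comp.mass i (r j) u + \<bar>comp.drift i (r j) u\<bar> / r j \<le> a j" if u: "0 \<le> u" "ennreal u < ?T j" for u
    proof -
      obtain w where w: "w \<in> {ennreal s | s. s > 0 \<and> y s (r j) \<le> a j}" "ennreal u < w"
        using u(2) unfolding less_Sup_iff ..
      then obtain v where v: "v > 0" "y v (r j) \<le> a j" "ennreal u < ennreal v" by blast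
      then have uv: "u \<le> v" using u by (simp add: ennreal_less_iff)
      have "comp.mass i (r j) u + \<bar>comp.drift i (r j) u\<bar> / r j \<le> y_real (B i) (C i) (\<nu> i) u (r j)"
        using comp.drift_le_M_star[OF r u(1) order_refl] by (simp add: comp.y_real_eq r u)
      also have "\<dots> \<le> y_real (B i) (C i) (\<nu> i) v (r j)" by (rule comp.y_real_mono[OF r u(1) uv])
      also have "\<dots> \<le> y v (r j)" using v by (intro y_real_le_y r) auto
      finally show ?thesis using v by simp
    qed
    have "comp.mass i (r j) s + \<bar>comp.drift i (r j) s\<bar> / r j \<le> a j"
    proof (cases "s = 0")
      case True
      then show ?thesis using a by (simp add: comp.mass_0 comp.drift_0)
    next
      case False
      show ?thesis
      proof (rule comp.mass_drift_le_of_less[OF r])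
        fix u assume u: "0 \<le> u" "u < s"
        then have "ennreal u < ?T j" using s by (intro less_le_trans[OF _ s(2)]) (simp add: ennreal_less_iff)
        then show "comp.mass i (r j) u + \<bar>comp.drift i (r j) u\<bar> / r j \<le> a j" using u by (intro less)
      qed (use False s in auto)
    qed
    then show ?thesis by simp
  qed
  have "\<forall>i j. \<exists>N. N \<in> events \<and> prob N \<le> 30 * a j \<and>
      (AE \<omega> in M. \<omega> \<notin> N \<longrightarrow> (\<forall>s\<ge>0. ennreal s \<le> ?T j \<longrightarrow> \<bar>X s \<omega> $ i\<bar> \<le> 6 * r j))"
  proof (intro allI)
    fix i j
    obtain N where "N \<in> events" "prob N \<le> 3 * (10 * a j)"
      "AE \<omega> in M. \<omega> \<notin> N \<longrightarrow> (\<forall>s\<ge>0. ennreal s \<le> ?T j \<longrightarrow> \<bar>X s \<omega> $ i\<bar> \<le> 6 * r j)"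
      using comp.path_max_tail[where r="r j" and T="?T j" and a="10 * a j" and i=i, OF r le] by blast
    then show "\<exists>N. N \<in> events \<and> prob N \<le> 30 * a j \<and>
      (AE \<omega> in M. \<omega> \<notin> N \<longrightarrow> (\<forall>s\<ge>0. ennreal s \<le> ?T j \<longrightarrow> \<bar>X s \<omega> $ i\<bar> \<le> 6 * r j))"
      by (intro exI[of _ N] conjI) simp_all
  qed
  then obtain N where "\<forall>i j. N i j \<in> events \<and> prob (N i j) \<le> 30 * a j \<and>
      (AE \<omega> in M. \<omega> \<notin> N i j \<longrightarrow> (\<forall>s\<ge>0. ennreal s \<le> ?T j \<longrightarrow> \<bar>X s \<omega> $ i\<bar> \<le> 6 * r j))"
    unfolding choice_iff ..
  then have N: "\<And>i j. N i j \<in> events" "\<And>i j. prob (N i j) \<le> 30 * a j"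
      "\<And>i j. AE \<omega> in M. \<omega> \<notin> N i j \<longrightarrow> (\<forall>s\<ge>0. ennreal s \<le> ?T j \<longrightarrow> \<bar>X s \<omega> $ i\<bar> \<le> 6 * r j)"
    by simp_all
  have "AE \<omega> in M. \<forall>\<^sub>F j in sequentially. \<omega> \<in> space M - N i j" for i
  proof (rule borel_cantelli_AE1)
    show "summable (\<lambda>j. prob (N i j))"
      by (rule summable_comparison_test'[OF summable_mult[OF a(2), of 30], of 0]) (simp add: N(2))
  qed (simp_all add: N(1) emeasure_eq_measure)
  then have "AE \<omega> in M. \<forall>i. \<forall>\<^sub>F j in sequentially. \<omega> \<in> space M - N i j"
    by (simp add: AE_all_countable)
  moreover have "AE \<omega> in M. \<forall>i j. \<omega> \<notin> N i j \<longrightarrow> (\<forall>s\<ge>0. ennreal s \<le> ?T j \<longrightarrow> \<bar>X s \<omega> $ i\<bar> \<le> 6 * r j)"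
    using N(3) by (simp add: AE_all_countable)
  ultimately show ?thesis
  proof eventually_elim
    case (elim \<omega>)
    have "\<forall>\<^sub>F j in sequentially. \<forall>i. \<omega> \<in> space M - N i j"
      using elim(1) by (intro eventually_all_finite) blast
    then show ?case
    proof eventually_elim
      case (elim j)
      show ?case unfolding running_sup_def
      proof (rule SUP_least)
        fix s assume "s \<in> {s. 0 \<le> s \<and> ennreal s \<le> ?T j}"
        then have "\<bar>X s \<omega> $ i\<bar> \<le> 6 * r j" for i
          using elim \<open>\<forall>i j. \<omega> \<notin> N i j \<longrightarrow> (\<forall>s\<ge>0. ennreal s \<le> ?T j \<longrightarrow> \<bar>X s \<omega> $ i\<bar> \<le> 6 * r j)\<close> by blast
        then have "(\<Sum>i\<in>UNIV. \<bar>X s \<omega> $ i\<bar>) \<le> (\<Sum>i\<in>(UNIV :: 'd set). 6 * r j)" by (intro sum_mono)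
        then have "norm (X s \<omega>) \<le> 6 * CARD('d) * r j"
          using norm_le_l1_cart[of "X s \<omega>"] by simp
        then show "ennreal (norm (X s \<omega>)) \<le> ennreal (6 * CARD('d) * r j)" by (rule ennreal_leI)
      qed
    qed
  qed
qed

text \<open>The time b is admissible, so the infimum is finite. \<open>small_ball\<close> is applied
  to one coordinate, which may change with j but not with the sample point, and Borel-Cantelli uses
  summability of the square-root bound.\<close>

lemma running_sup_upper_AE:
  fixes r a :: "nat \<Rightarrow> real"
  assumes r: "\<And>j. 0 < r j" "\<And>j. r j \<le> 1" and a: "\<And>j. 0 < a j" "summable (\<lambda>j. 1 / sqrt (a j))"
    and b: "b > 0" "\<And>j. a j \<le> y b (r j)"
  shows "AE \<omega> in M. \<forall>\<^sub>F j in sequentially.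
    ennreal (r j) < running_sup X (Inf {ennreal s | s. s > 0 \<and> a j \<le> y s (r j)}) \<omega>"
proof -
  let ?T = "\<lambda>j. Inf {ennreal s | s. s > 0 \<and> a j \<le> y s (r j)}"
  let ?c = "10000 * sqrt (2 * CARD('d))"
  have "\<forall>j. \<exists>F i. finite F \<and> F \<subseteq> {0..} \<and> (\<forall>s\<in>F. ennreal s \<le> ?T j) \<and>
    prob {\<omega> \<in> space M. \<forall>s\<in>F. \<bar>X s \<omega> $ i\<bar> \<le> r j} \<le> ?c * (1 / sqrt (a j))"
  proof
    fix j
    define S where "S = {s. s > 0 \<and> a j \<le> y s (r j)}"
    define T where "T = Inf S"
    have ne: "S \<noteq> {}" using b(1) b(2)[of j] by (auto simp: S_def)
    have bdd: "bdd_below S" by (rule bdd_belowI[of _ 0]) (auto simp: S_def)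
    have T0: "T \<ge> 0" unfolding T_def by (rule cInf_greatest[OF ne]) (auto simp: S_def)
    \<comment> \<open>Admissible times accumulate at T from the right or include T. Right-continuity
      with error a j / 2 keeps half of the bound at T itself.\<close>
    have yT: "a j / 2 \<le> y T (r j)"
    proof -
      obtain d where d: "d > 0" "\<And>s. T \<le> s \<Longrightarrow> s < T + d \<Longrightarrow> y s (r j) \<le> y T (r j) + a j / 2"
        using y_right_continuous[OF r T0, of "a j / 2" j] a by auto
      have "Inf S < T + d" using d by (simp add: T_def)
      then obtain s where s: "s \<in> S" "s < T + d" using cInf_lessD[OF ne] by blast
      have "T \<le> s" unfolding T_def by (rule cInf_lower[OF s(1) bdd])
      then show ?thesis using d(2)[of s] s by (auto simp: S_def)
    qed
    have TT: "ennreal T \<le> ?T j"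
      by (rule Inf_greatest) (auto simp: T_def S_def intro!: ennreal_leI cInf_lower bdd[unfolded S_def])
    \<comment> \<open>Pigeonhole over the coordinates; the share a j / (2d) explains the factor
      sqrt(2d) in \<open>?c\<close>.\<close>
    have "\<exists>i. a j / (2 * CARD('d)) \<le> y_real (B i) (C i) (\<nu> i) T (r j)"
    proof (rule ccontr)
      assume "\<not> ?thesis"
      then have "y T (r j) < (\<Sum>i\<in>(UNIV :: 'd set). a j / (2 * CARD('d)))"
        unfolding y y_fun_def by (intro sum_strict_mono) (auto simp: not_le)
      then show False using yT by simp
    qed
    then obtain i where i: "a j / (2 * CARD('d)) \<le> y_real (B i) (C i) (\<nu> i) T (r j)" ..
    obtain s where s: "s \<in> {0..T}" "M_star (B i) (\<nu> i) T (r j) = \<bar>comp.drift i (r j) s\<bar> / r j"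
      using comp.M_star_attained[OF r T0] by blast
    have le: "a j / (2 * CARD('d)) \<le> comp.mass i (r j) T + \<bar>comp.drift i (r j) s\<bar> / r j"
      using i s by (simp add: comp.y_real_eq r T0)
    have pos: "0 < a j / (2 * CARD('d))" using a(1)[of j] by simp
    have s': "0 \<le> s" "s \<le> T" using s by auto
    obtain F where F: "finite F" "F \<subseteq> {0..T}"
      "prob {\<omega> \<in> space M. \<forall>s\<in>F. \<bar>X s \<omega> $ i\<bar> \<le> r j} \<le> 10000 / sqrt (a j / (2 * CARD('d)))"
      using comp.small_ball[OF r s' pos le] by blast
    have "10000 / sqrt (a j / (2 * CARD('d))) = ?c * (1 / sqrt (a j))"
      by (simp add: real_sqrt_divide)
    moreover have "ennreal s \<le> ?T j" if "s \<in> F" for s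
      using that F(2) by (intro order_trans[OF _ TT] ennreal_leI) auto
    ultimately show "\<exists>F i. finite F \<and> F \<subseteq> {0..} \<and> (\<forall>s\<in>F. ennreal s \<le> ?T j) \<and>
      prob {\<omega> \<in> space M. \<forall>s\<in>F. \<bar>X s \<omega> $ i\<bar> \<le> r j} \<le> ?c * (1 / sqrt (a j))"
      using F by (intro exI[of _ F] exI[of _ i] conjI ballI) (auto intro: order_trans)
  qed
  then obtain F i where "\<forall>j. finite (F j) \<and> F j \<subseteq> {0..} \<and> (\<forall>s\<in>F j. ennreal s \<le> ?T j) \<and>
    prob {\<omega> \<in> space M. \<forall>s\<in>F j. \<bar>X s \<omega> $ i j\<bar> \<le> r j} \<le> ?c * (1 / sqrt (a j))"
    unfolding choice_iff by (elim exE) (rule that)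
  then have F: "\<And>j. finite (F j)" "\<And>j. F j \<subseteq> {0..}" "\<And>j s. s \<in> F j \<Longrightarrow> ennreal s \<le> ?T j"
    "\<And>j. prob {\<omega> \<in> space M. \<forall>s\<in>F j. \<bar>X s \<omega> $ i j\<bar> \<le> r j} \<le> ?c * (1 / sqrt (a j))" by blast+
  let ?A = "\<lambda>j. {\<omega> \<in> space M. \<forall>s\<in>F j. \<bar>X s \<omega> $ i j\<bar> \<le> r j}"
  have "AE \<omega> in M. \<forall>\<^sub>F j in sequentially. \<omega> \<in> space M - ?A j"
  proof (rule borel_cantelli_AE1)
    show "?A j \<in> events" for j by (rule comp.measurable_small_ball[OF F(1,2)])
    show "summable (\<lambda>j. prob (?A j))"
      by (rule summable_comparison_test'[OF summable_mult[OF a(2), of ?c], of 0])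
         (simp only: real_norm_def abs_of_nonneg[OF measure_nonneg] F(4))
  qed (simp add: emeasure_eq_measure)
  then show ?thesis
  proof eventually_elim
    case (elim \<omega>)
    then show ?case
    proof eventually_elim
      case (elim j)
      then obtain s where s: "s \<in> F j" "r j < \<bar>X s \<omega> $ i j\<bar>" by (auto simp: not_le)
      have "ennreal (r j) < ennreal (norm (X s \<omega>))"
        using s r[of j] component_le_norm_cart[of "X s \<omega>" "i j"] by (simp add: ennreal_less_iff)
      also have "\<dots> \<le> running_sup X (?T j) \<omega>"
        unfolding running_sup_def using s F(2,3) by (intro SUP_upper) auto
      finally show ?case .
    qed
  qed
qed

end


section \<open>Indices and slow functions\<close>

lemma Liminf_at_right_pos:
  fixes f :: "real \<Rightarrow> real"
  assumes "0 < Liminf (at_right 0) (\<lambda>r. ereal (f r))"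
  shows "\<exists>\<kappa>>0. \<exists>r0>0. \<forall>r. 0 < r \<and> r < r0 \<longrightarrow> \<kappa> \<le> f r"
proof -
  obtain \<kappa> where \<kappa>: "0 < ereal \<kappa>" "ereal \<kappa> < Liminf (at_right 0) (\<lambda>r. ereal (f r))"
    using ereal_dense2[OF assms] by auto
  have "\<forall>\<^sub>F r in at_right 0. \<kappa> < f r" using less_LiminfD[OF \<kappa>(2)] by simp
  then obtain r0 where "r0 > 0" "\<And>r. 0 < r \<Longrightarrow> r < r0 \<Longrightarrow> \<kappa> < f r"
    unfolding eventually_at_right_field by blast
  then show ?thesis using \<kappa>(1) by (intro exI[of _ \<kappa>] conjI exI[of _ r0]) (auto intro: less_imp_le)
qed

lemma slow_function_lower:
  assumes "slow_function c" "\<rho> > 0"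
  obtains \<kappa> t0 where "0 < \<kappa>" "\<kappa> \<le> 1" "t0 > 0" "\<And>t. 0 < t \<Longrightarrow> t < t0 \<Longrightarrow> \<kappa> * t powr \<rho> \<le> c t"
proof -
  have "0 < Liminf (at_right 0) (\<lambda>r. ereal (c r * r powr (- \<rho>)))"
    using assms by (simp add: slow_function_def)
  from Liminf_at_right_pos[OF this]
  obtain \<kappa> t0 where \<kappa>: "\<kappa> > 0" "t0 > 0" "\<And>t. 0 < t \<Longrightarrow> t < t0 \<Longrightarrow> \<kappa> \<le> c t * t powr (- \<rho>)" by blast
  show ?thesis
  proof (rule that[of "min 1 \<kappa>" t0])
    fix t :: real assume t: "0 < t" "t < t0"
    have "min 1 \<kappa> * t powr \<rho> \<le> (c t * t powr (- \<rho>)) * t powr \<rho>"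
      using \<kappa>(3)[OF t] by (intro mult_right_mono) auto
    also have "\<dots> = c t" using t by (simp add: mult.assoc flip: powr_add)
    finally show "min 1 \<kappa> * t powr \<rho> \<le> c t" .
  qed (use \<kappa> in auto)
qed

lemma ennreal_powr_top: "p < 0 \<Longrightarrow> ((\<lambda>t. ennreal (t powr p)) \<longlongrightarrow> \<infinity>) (at_right 0)"
proof -
  assume p: "p < 0"
  have "filterlim (\<lambda>t::real. (- p) * ln t) at_bot (at_right 0)"
    by (rule filterlim_tendsto_pos_mult_at_bot[OF tendsto_const _ ln_at_0]) (use p in simp)
  then have "filterlim (\<lambda>t::real. p * ln t) at_top (at_right 0)"
    by (subst filterlim_uminus_at_top) simp
  then have "filterlim (\<lambda>t::real. exp (p * ln t)) at_top (at_right 0)"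
    by (rule filterlim_compose[OF exp_at_top])
  moreover have "\<forall>\<^sub>F t in at_right 0. exp (p * ln t) = t powr p"
    using eventually_at_right_less[of "0::real"] by eventually_elim (simp add: powr_def)
  ultimately have "filterlim (\<lambda>t. t powr p) at_top (at_right 0)"
    by (simp cong: filterlim_cong)
  then show ?thesis by (simp add: ennreal_tendsto_top_eq_at_top)
qed

lemma ennreal_powr_zero: "p > 0 \<Longrightarrow> ((\<lambda>t. ennreal (K * t powr p)) \<longlongrightarrow> 0) (at_right 0)"
proof -
  assume p: "p > 0"
  have "((\<lambda>t. exp (p * ln t)) \<longlongrightarrow> 0) (at_right 0)"
    by (rule filterlim_compose[OF exp_at_bot filterlim_tendsto_pos_mult_at_bot[OF tendsto_const p ln_at_0]])
  moreover have "\<forall>\<^sub>F t in at_right 0. exp (p * ln t) = t powr p"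
    using eventually_at_right_less[of "0::real"] by eventually_elim (simp add: powr_def)
  ultimately have "((\<lambda>t. t powr p) \<longlongrightarrow> 0) (at_right 0)"
    by (simp cong: filterlim_cong)
  then have "((\<lambda>t. K * t powr p) \<longlongrightarrow> K * 0) (at_right 0)" by (intro tendsto_intros)
  then have "((\<lambda>t. ennreal (K * t powr p)) \<longlongrightarrow> ennreal (K * 0)) (at_right 0)" by (rule tendsto_ennrealI)
  then show ?thesis by simp
qed

text \<open>With L the negative binary logarithm of t, the equation means \<eta> = L / n. The
  admissible n fill the interval from L / \<eta>2 to L / \<eta>1, whose length is a multiple of L,
  so for small t it contains an integer.\<close>

lemma eventually_dyadic_powr:
  assumes \<eta>: "0 < \<eta>1" "\<eta>1 < \<eta>2"
  shows "\<forall>\<^sub>F t in at_right 0. \<exists>n\<ge>N. \<exists>\<eta>\<in>{\<eta>1..\<eta>2}. t = ((1 / 2 :: real) ^ n) powr \<eta>"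
proof -
  define c where "c = 1 / \<eta>1 - 1 / \<eta>2"
  have c: "c > 0" using \<eta> by (simp add: c_def divide_strict_left_mono)
  \<comment> \<open>The three entries ensure in turn that the interval has length at least 1, that n
    >= N, and that n >= 1.\<close>
  define L0 where "L0 = max (1 / c) (max (\<eta>2 * real N) \<eta>2)"
  have "\<forall>\<^sub>F t in at_right 0. ln t < - (L0 * ln 2)"
    using ln_at_0 unfolding filterlim_at_bot_dense by blast
  then show ?thesis using eventually_at_right_less[of "0::real"]
  proof eventually_elim
    case (elim t)
    define L where "L = - ln t / ln 2"
    have L: "L \<ge> L0" using elim by (simp add: L_def field_simps)
    then have Lc: "L \<ge> 1 / c" "L \<ge> \<eta>2 * real N" "L \<ge> \<eta>2" by (auto simp: L0_def)
    define n where "n = nat \<lceil>L / \<eta>2\<rceil>"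
    have L1: "L / \<eta>2 \<ge> 1" using Lc \<eta> by (simp add: le_divide_eq)
    have n: "real n \<ge> L / \<eta>2" "real n \<le> L / \<eta>2 + 1" using L1 unfolding n_def by linarith+
    have n0: "real n > 0" using n L1 by linarith
    have "L * c \<ge> 1" using Lc(1) c by (simp add: field_simps)
    then have "L / \<eta>2 + 1 \<le> L / \<eta>1" by (simp add: c_def right_diff_distrib)
    then have n': "real n \<le> L / \<eta>1" using n by linarith
    have "real N \<le> L / \<eta>2" using Lc(2) \<eta> by (simp add: le_divide_eq mult.commute)
    then have N: "N \<le> n" using n by linarith
    have "\<eta>1 \<le> L / n" using n' n0 \<eta> by (simp add: field_simps)
    moreover have "L / n \<le> \<eta>2" using n(1) n0 \<eta> by (simp add: field_simps)
    moreover have "t = ((1 / 2) ^ n) powr (L / n)"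
    proof -
      have "((1 / 2 :: real) ^ n) powr (L / n) = ((1 / 2) powr n) powr (L / n)" by (simp add: powr_realpow)
      also have "\<dots> = (1 / 2) powr L" using n0 by (simp add: powr_powr)
      also have "\<dots> = exp (L * ln (1 / 2))" by (simp add: powr_def)
      also have "L * ln (1 / 2) = ln t" by (simp add: L_def ln_div)
      also have "exp (ln t) = t" using elim by simp
      finally show ?thesis by simp
    qed
    ultimately show ?case using N by (intro exI[of _ n] conjI bexI[of _ "L / n"]) auto
  qed
qed

lemma Limsup_seq_infinity:
  fixes f :: "'a \<Rightarrow> ennreal"
  assumes t: "filterlim t F sequentially" and f: "(\<lambda>j::nat. f (t j)) \<longlonglongrightarrow> \<infinity>"
  shows "Limsup F f = \<infinity>"
proof (rule ccontr)
  assume "Limsup F f \<noteq> \<infinity>"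
  then have "Limsup F f < \<infinity>" by (simp add: less_top)
  then obtain e where e: "Limsup F f < e" "e < \<infinity>" using dense by blast
  have "\<forall>\<^sub>F j in sequentially. f (t j) < e"
    using Limsup_lessD[OF e(1)] t by (auto simp: filterlim_iff)
  moreover have "\<forall>\<^sub>F j in sequentially. e < f (t j)" by (rule order_tendstoD(1)[OF f e(2)])
  ultimately have "\<forall>\<^sub>F j in sequentially. False" by eventually_elim auto
  then show False by simp
qed

lemma Liminf_seq_zero:
  fixes f :: "'a \<Rightarrow> ennreal"
  assumes t: "filterlim t F sequentially" and f: "(\<lambda>j::nat. f (t j)) \<longlonglongrightarrow> 0"
  shows "Liminf F f = 0"
proof (rule ccontr)
  assume "Liminf F f \<noteq> 0"
  then have "0 < Liminf F f" by (simp add: zero_less_iff_neq_zero)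
  then obtain e where e: "0 < e" "e < Liminf F f" using dense by blast
  have "\<forall>\<^sub>F j in sequentially. e < f (t j)"
    using less_LiminfD[OF e(2)] t by (auto simp: filterlim_iff)
  moreover have "\<forall>\<^sub>F j in sequentially. f (t j) < e" by (rule order_tendstoD(2)[OF f e(1)])
  ultimately have "\<forall>\<^sub>F j in sequentially. False" by eventually_elim auto
  then show False by simp
qed

lemma tendsto_zero_le_geometric:
  fixes r :: "nat \<Rightarrow> real"
  assumes "\<And>j. 0 < r j" "\<And>j. r j \<le> (1 / 2) ^ j"
  shows "r \<longlonglongrightarrow> 0"
  by (rule tendsto_sandwich[of "\<lambda>_. 0" _ _ "\<lambda>j. (1 / 2) ^ j"])
     (use assms in \<open>auto intro!: always_eventually less_imp_le LIMSEQ_realpow_zero\<close>)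

lemma filterlim_powr_seq:
  fixes r :: "nat \<Rightarrow> real"
  assumes r: "\<And>j. 0 < r j" "\<And>j. r j \<le> (1 / 2) ^ j" and \<eta>: "\<eta> > 0"
  shows "filterlim (\<lambda>j. r j powr \<eta>) (at_right 0) sequentially"
proof -
  have "((\<lambda>j. r j powr \<eta>) \<longlonglongrightarrow> 0 powr \<eta>)"
    by (rule tendsto_powr'[OF tendsto_zero_le_geometric[OF r] tendsto_const]) (use r \<eta> in \<open>auto intro!: always_eventually less_imp_le\<close>)
  then show ?thesis using r(1) by (auto simp: filterlim_at intro!: always_eventually less_imp_neq[symmetric])
qed

lemma summable_powr_le_geometric:
  fixes r :: "nat \<Rightarrow> real"
  assumes r: "\<And>j. 0 < r j" "\<And>j. r j \<le> (1 / 2) ^ j" and \<rho>: "\<rho> > 0"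
  shows "summable (\<lambda>j. r j powr \<rho>)"
proof (rule summable_comparison_test'[of "\<lambda>j. ((1 / 2) powr \<rho>) ^ j" 0])
  have "(1 / 2 :: real) powr \<rho> < 1 powr \<rho>" using \<rho> by (intro powr_less_mono2) auto
  then show "summable (\<lambda>j. ((1 / 2 :: real) powr \<rho>) ^ j)" by (intro summable_geometric) simp
  fix j :: nat
  have "r j powr \<rho> \<le> ((1 / 2) ^ j) powr \<rho>" using r[of j] \<rho> by (intro powr_mono2) auto
  also have "\<dots> = ((1 / 2) powr real j) powr \<rho>" by (simp add: powr_realpow)
  also have "\<dots> = ((1 / 2) powr \<rho>) powr real j" by (simp add: powr_powr mult.commute)
  also have "\<dots> = ((1 / 2) powr \<rho>) ^ j" by (simp add: powr_realpow)
  finally show "norm (r j powr \<rho>) \<le> ((1 / 2) powr \<rho>) ^ j" by simp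
qed

lemma running_sup_mono: "T \<le> T' \<Longrightarrow> running_sup X T \<omega> \<le> running_sup X T' \<omega>"
  unfolding running_sup_def by (rule SUP_subset_mono) auto

section \<open>The two indices, and almost sure bounds at the time changes along sequences of
  levels\<close>

context additive_vec
begin

text \<open>Below \<open>delta_index\<close> the lower bound holds at all small levels, which later
  gives a full limit.\<close>

lemma delta_index_less:
  assumes "0 \<le> \<eta>" "\<eta> < delta_index y b" and b: "b > 0"
  shows "\<exists>\<kappa>>0. \<exists>r0>0. \<forall>r. 0 < r \<and> r < r0 \<longrightarrow> \<kappa> \<le> r powr \<eta> * y b r"
proof (rule Liminf_at_right_pos)
  have "Liminf (at_right 0) (\<lambda>r. ereal (r powr \<eta> * y b r)) \<noteq> 0"
  proof
    assume "Liminf (at_right 0) (\<lambda>r. ereal (r powr \<eta> * y b r)) = 0"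
    then have "delta_index y b \<le> \<eta>"
      unfolding delta_index_def using assms(1) by (intro cInf_lower bdd_belowI[of _ 0]) auto
    then show False using assms(2) by simp
  qed
  moreover have "0 \<le> Liminf (at_right 0) (\<lambda>r. ereal (r powr \<eta> * y b r))"
  proof (rule Liminf_bounded)
    have "\<forall>\<^sub>F r in at_right (0::real). r < 1" by (intro order_tendstoD(2)[OF tendsto_ident_at]) auto
    then show "\<forall>\<^sub>F r in at_right 0. 0 \<le> ereal (r powr \<eta> * y b r)"
      using eventually_at_right_less[of "0::real"] by eventually_elim (use b in \<open>auto intro!: mult_nonneg_nonneg y_nonneg\<close>)
  qed
  ultimately show "0 < Liminf (at_right 0) (\<lambda>r. ereal (r powr \<eta> * y b r))" by simp
qed

text \<open>Below \<open>beta_index\<close> convergence to 0 fails, so the lower bound is available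
  only at some arbitrarily small levels; this is why the corresponding conclusion is a
  limsup.\<close>

lemma beta_index_less:
  assumes "0 \<le> \<eta>" "\<eta> < beta_index y b" and b: "b > 0"
  shows "\<exists>\<kappa>>0. \<forall>r0>0. \<exists>r. 0 < r \<and> r < r0 \<and> \<kappa> \<le> r powr \<eta> * y b r"
proof (rule ccontr)
  assume "\<not> ?thesis"
  then have neg: "\<exists>r0>0. \<forall>r. 0 < r \<and> r < r0 \<longrightarrow> r powr \<eta> * y b r < \<kappa>" if "\<kappa> > 0" for \<kappa> using that by (meson not_le)
  have "((\<lambda>r. r powr \<eta> * y b r) \<longlongrightarrow> 0) (at_right 0)"
  proof (rule tendstoI)
    fix e :: real assume "e > 0"
    then obtain r0 where r0: "r0 > 0" "\<And>r. 0 < r \<Longrightarrow> r < r0 \<Longrightarrow> r powr \<eta> * y b r < e" using neg by blast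
    show "\<forall>\<^sub>F r in at_right 0. dist (r powr \<eta> * y b r) 0 < e"
    proof (rule eventually_at_rightI[of 0 "min 1 r0"])
      fix r assume "r \<in> {0<..<min 1 r0}"
      then show "dist (r powr \<eta> * y b r) 0 < e" using r0(2)[of r] y_nonneg[of r b] b by (simp add: abs_mult)
    qed (use r0 in auto)
  qed
  then have "beta_index y b \<le> \<eta>"
    unfolding beta_index_def using assms(1) by (intro cInf_lower bdd_belowI[of _ 0]) auto
  then show False using assms(2) by simp
qed

text \<open>By \<open>y_growth\<close> any exponent above 2 would do. It shows that the sets
  defining both indices are non-empty, so that their infima are genuine.\<close>

lemma cube_y_tendsto: assumes b: "b > 0" shows "((\<lambda>r. r powr 3 * y b r) \<longlongrightarrow> 0) (at_right 0)"
proof -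
  obtain K where K: "\<And>r. 0 < r \<Longrightarrow> r \<le> 1 \<Longrightarrow> y b r \<le> K / r\<^sup>2" using y_growth[of b] b by auto
  have ev: "\<forall>\<^sub>F r in at_right (0::real). 0 < r \<and> r < 1"
    by (rule eventually_at_rightI[of 0 1]) auto
  show ?thesis
  proof (rule tendsto_sandwich[of "\<lambda>_. 0" _ _ "\<lambda>r. K * r"])
    show "\<forall>\<^sub>F r in at_right 0. 0 \<le> r powr 3 * y b r"
      using ev by eventually_elim (use b in \<open>auto intro!: mult_nonneg_nonneg y_nonneg\<close>)
    show "\<forall>\<^sub>F r in at_right 0. r powr 3 * y b r \<le> K * r"
      using ev
    proof eventually_elim
      case (elim r)
      have "r powr 3 * y b r \<le> r powr 3 * (K / r\<^sup>2)" using K[of r] elim by (intro mult_left_mono) auto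
      also have "\<dots> = K * r" using elim by (simp add: power3_eq_cube power2_eq_square)
      finally show ?case .
    qed
    show "((\<lambda>r. K * r) \<longlongrightarrow> 0) (at_right 0)" by (auto intro!: tendsto_eq_intros)
  qed simp
qed

text \<open>An exponent is taken from the defining set strictly below \<eta>. That it is not below
  the index later places exponents chosen above it in the range I of the time change.\<close>

lemma delta_index_greater:
  assumes "delta_index y b < \<eta>" and b: "b > 0"
  obtains \<eta>' where "0 \<le> \<eta>'" "\<eta>' < \<eta>" "delta_index y b \<le> \<eta>'"
    "\<And>r0. r0 > 0 \<Longrightarrow> \<exists>r. 0 < r \<and> r < r0 \<and> r powr \<eta>' * y b r \<le> 1"
proof -
  let ?S = "{\<eta>. \<eta> \<ge> 0 \<and> Liminf (at_right 0) (\<lambda>r. ereal (r powr \<eta> * y b r)) = 0}"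
  have "((\<lambda>r. ereal (r powr 3 * y b r)) \<longlongrightarrow> ereal 0) (at_right 0)" using cube_y_tendsto[OF b] by simp
  then have "Liminf (at_right 0) (\<lambda>r. ereal (r powr 3 * y b r)) = ereal 0" by (intro lim_imp_Liminf) auto
  then have "3 \<in> ?S" by simp
  then have ne: "?S \<noteq> {}" by blast
  obtain \<eta>' where \<eta>': "\<eta>' \<in> ?S" "\<eta>' < \<eta>" using cInf_lessD[OF ne] assms(1) unfolding delta_index_def by blast
  show ?thesis
  proof (rule that[of \<eta>'])
    show "delta_index y b \<le> \<eta>'"
      unfolding delta_index_def by (intro cInf_lower bdd_belowI[of _ 0] \<eta>') auto
    fix r0 :: real assume r0: "r0 > 0"
    show "\<exists>r. 0 < r \<and> r < r0 \<and> r powr \<eta>' * y b r \<le> 1"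
    proof (rule ccontr)
      assume "\<not> ?thesis"
      then have "\<forall>\<^sub>F r in at_right 0. 1 \<le> ereal (r powr \<eta>' * y b r)"
        using r0 by (intro eventually_at_rightI[of 0 r0]) (auto simp: one_ereal_def not_le intro: less_imp_le)
      then have "1 \<le> Liminf (at_right 0) (\<lambda>r. ereal (r powr \<eta>' * y b r))" by (rule Liminf_bounded)
      then show False using \<eta>' by simp
    qed
  qed (use \<eta>' in auto)
qed

lemma beta_index_greater:
  assumes "beta_index y b < \<eta>" and b: "b > 0"
  obtains \<eta>' r0 where "0 \<le> \<eta>'" "\<eta>' < \<eta>" "beta_index y b \<le> \<eta>'" "r0 > 0"
    "\<And>r. 0 < r \<Longrightarrow> r < r0 \<Longrightarrow> r powr \<eta>' * y b r \<le> 1"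
proof -
  let ?S = "{\<eta>. \<eta> \<ge> 0 \<and> ((\<lambda>r. r powr \<eta> * y b r) \<longlongrightarrow> 0) (at_right 0)}"
  have "3 \<in> ?S" using cube_y_tendsto[OF b] by simp
  then have ne: "?S \<noteq> {}" by blast
  obtain \<eta>' where \<eta>': "\<eta>' \<in> ?S" "\<eta>' < \<eta>" using cInf_lessD[OF ne] assms(1) unfolding beta_index_def by blast
  have "\<forall>\<^sub>F r in at_right 0. r powr \<eta>' * y b r < 1" using \<eta>' by (intro order_tendstoD(2)[of _ 0]) auto
  then obtain r0 where r0: "r0 > 0" "\<And>r. 0 < r \<Longrightarrow> r < r0 \<Longrightarrow> r powr \<eta>' * y b r < 1"
    unfolding eventually_at_right_field by blast
  show ?thesis
  proof (rule that[of \<eta>' r0])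
    show "beta_index y b \<le> \<eta>'"
      unfolding beta_index_def by (intro cInf_lower bdd_belowI[of _ 0] \<eta>') auto
  qed (use \<eta>' r0 in \<open>auto intro: less_imp_le\<close>)
qed

text \<open>For t = r j powr \<eta> with \<eta> in \<open>I\<close>, the defining condition at that
  one exponent is about the level r j. It forces \<open>y\<close> at that level above
  \<open>a j\<close>, a bound that does not depend on \<eta>, so one null set serves for all
  exponents at once.\<close>

lemma upper_time_AE:
  fixes r :: "nat \<Rightarrow> real"
  assumes c: "slow_function c" and b: "b > 0"
    and r: "\<And>j. 0 < r j" "\<And>j. r j \<le> (1 / 2) ^ j"
    and \<eta>: "0 < \<eta>1" "\<eta>1 \<le> \<eta>2" "\<eta>2 < \<eta>3"
    and \<kappa>: "\<kappa> > 0" "\<And>j. \<kappa> \<le> r j powr \<eta>3 * y b (r j)"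
  shows "AE \<omega> in M. \<forall>\<^sub>F j in sequentially. \<forall>\<eta>\<in>{\<eta>1..\<eta>2} \<inter> I.
    ennreal (r j) < running_sup X (upper_time y b c I (r j powr \<eta>)) \<omega>"
proof -
  \<comment> \<open>Half of the gap pays for the slow function, as \<eta> \<rho> / \<eta>2 <=
    \<rho>; the other half makes \<open>a j\<close> grow like r j to the power -\<rho>.\<close>
  define \<rho> where "\<rho> = (\<eta>3 - \<eta>2) / 2"
  have \<rho>: "\<rho> > 0" "\<rho> \<le> \<eta>3" using \<eta> by (auto simp: \<rho>_def)
  obtain \<kappa>' t0 where \<kappa>': "0 < \<kappa>'" "\<kappa>' \<le> 1" "t0 > 0"
      "\<And>t. 0 < t \<Longrightarrow> t < t0 \<Longrightarrow> \<kappa>' * t powr (\<rho> / \<eta>2) \<le> c t"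
    using slow_function_lower[OF c, of "\<rho> / \<eta>2"] \<rho> \<eta> by auto
  define a where "a j = \<kappa> * \<kappa>' * r j powr (- \<rho>)" for j
  have r1: "r j \<le> 1" for j using r(2)[of j] power_le_one[of "1/2::real" j] by simp
  have y_ge: "\<kappa> * r j powr (- \<eta>3) \<le> y b (r j)" for j
  proof -
    have "\<kappa> * r j powr (- \<eta>3) \<le> (r j powr \<eta>3 * y b (r j)) * r j powr (- \<eta>3)"
      using \<kappa> by (intro mult_right_mono) auto
    also have "\<dots> = y b (r j) * (r j powr \<eta>3 * r j powr (- \<eta>3))" by (simp add: mult_ac)
    also have "\<dots> = y b (r j)" using r(1)[of j] by (simp flip: powr_add)
    finally show ?thesis .
  qed
  have AE: "AE \<omega> in M. \<forall>\<^sub>F j in sequentially.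
    ennreal (r j) < running_sup X (Inf {ennreal s | s. s > 0 \<and> a j \<le> y s (r j)}) \<omega>"
  proof (rule running_sup_upper_AE[OF r(1) r1 _ _ b])
    show "0 < a j" for j using \<kappa> \<kappa>' r(1)[of j] by (simp add: a_def)
    have "1 / sqrt (a j) = 1 / sqrt (\<kappa> * \<kappa>') * r j powr (\<rho> / 2)" for j
    proof -
      have "sqrt (r j powr (- \<rho>)) = r j powr (- (\<rho> / 2))" by (simp add: powr_powr flip: powr_half_sqrt)
      then have "sqrt (a j) = sqrt (\<kappa> * \<kappa>') * r j powr (- (\<rho> / 2))"
        unfolding a_def real_sqrt_mult[of "\<kappa> * \<kappa>'"] by (simp only:)
      then show ?thesis by (simp only: powr_minus divide_inverse inverse_mult_distrib inverse_inverse_eq mult_1)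
    qed
    then show "summable (\<lambda>j. 1 / sqrt (a j))"
      using summable_powr_le_geometric[OF r, of "\<rho> / 2"] \<rho> by (simp add: summable_mult)
    show "a j \<le> y b (r j)" for j
    proof -
      have "a j \<le> \<kappa> * 1 * r j powr (- \<eta>3)"
        unfolding a_def using \<kappa> \<kappa>' \<rho> r(1)[of j] r1[of j] by (intro mult_mono powr_mono') auto
      then show ?thesis using y_ge[of j] by simp
    qed
  qed
  have ev: "\<forall>\<^sub>F j in sequentially. r j powr \<eta>1 < t0"
  proof -
    have "filterlim (\<lambda>j. r j powr \<eta>1) (at_right 0) sequentially" by (rule filterlim_powr_seq[OF r \<eta>(1)])
    then have "(\<lambda>j. r j powr \<eta>1) \<longlonglongrightarrow> 0" by (simp add: filterlim_at)
    then show ?thesis using \<kappa>'(3) by (intro order_tendstoD)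
  qed
  show ?thesis using AE
  proof eventually_elim
    case (elim \<omega>)
    show ?case using elim ev
    proof eventually_elim
      case (elim j)
      show ?case
      proof
        fix \<eta> assume \<eta>I: "\<eta> \<in> {\<eta>1..\<eta>2} \<inter> I"
        let ?t = "r j powr \<eta>"
        have \<eta>0: "\<eta> > 0" using \<eta>I \<eta> by auto
        have t: "0 < ?t" using r(1)[of j] by simp
        have "?t \<le> r j powr \<eta>1" using r(1)[of j] r1[of j] \<eta>I by (intro powr_mono') auto
        then have "?t < t0" using elim(2) by simp
        note c_ge = \<kappa>'(4)[OF t this]
        have root: "?t powr (1 / \<eta>) = r j" using r(1)[of j] \<eta>0 by (simp add: powr_powr)
        have "a j \<le> c ?t * ?t * y b (r j)"
        proof -
          have "\<eta> * (\<rho> / \<eta>2) + \<eta> - \<eta>3 \<le> - \<rho>"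
          proof -
            have "\<eta> * (\<rho> / \<eta>2) \<le> \<eta>2 * (\<rho> / \<eta>2)" using \<eta>I \<rho> \<eta> by (intro mult_right_mono) auto
            then have "\<eta> * (\<rho> / \<eta>2) \<le> \<rho>" using \<eta> by simp
            moreover have "\<eta>2 - \<eta>3 = - 2 * \<rho>" by (simp add: \<rho>_def field_simps)
            ultimately show ?thesis using \<eta>I by simp
          qed
          then have "r j powr (- \<rho>) \<le> r j powr (\<eta> * (\<rho> / \<eta>2) + \<eta> - \<eta>3)"
            using r(1)[of j] r1[of j] by (intro powr_mono') auto
          then have "a j \<le> \<kappa> * \<kappa>' * r j powr (\<eta> * (\<rho> / \<eta>2) + \<eta> - \<eta>3)"
            unfolding a_def using \<kappa> \<kappa>' by (intro mult_left_mono) auto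
          also have "\<dots> = (\<kappa>' * ?t powr (\<rho> / \<eta>2)) * ?t * (\<kappa> * r j powr (- \<eta>3))"
            using r(1)[of j] by (simp add: powr_powr powr_add powr_diff powr_minus divide_inverse)
          also have "\<dots> \<le> c ?t * ?t * y b (r j)"
            using c_ge y_ge[of j] \<kappa> \<kappa>' t order_trans[OF _ c_ge] by (intro mult_mono) auto
          finally show ?thesis .
        qed
        note a_le = this
        \<comment> \<open>Keeping only one exponent of the condition enlarges the set and lowers its
          infimum.\<close>
        have "Inf {ennreal s | s. s > 0 \<and> a j \<le> y s (r j)} \<le> upper_time y b c I ?t"
          unfolding upper_time_def
        proof (intro Inf_superset_mono subsetI)
          fix z assume "z \<in> {ennreal s | s. s > 0 \<and>
            (\<forall>\<eta>\<in>I. y s (?t powr (1 / \<eta>)) \<ge> c ?t * ?t * y b (?t powr (1 / \<eta>)))}"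
          then obtain s where s: "z = ennreal s" "s > 0"
            "\<forall>\<eta>\<in>I. y s (?t powr (1 / \<eta>)) \<ge> c ?t * ?t * y b (?t powr (1 / \<eta>))" by blast
          have "c ?t * ?t * y b (r j) \<le> y s (r j)" using bspec[OF s(3), of \<eta>] \<eta>I unfolding root by blast
          then have "a j \<le> y s (r j)" using a_le by linarith
          then show "z \<in> {ennreal s | s. s > 0 \<and> a j \<le> y s (r j)}" using s(1,2) by blast
        qed
        then show "ennreal (r j) < running_sup X (upper_time y b c I ?t) \<omega>"
          by (rule less_le_trans[OF elim(1) running_sup_mono])
      qed
    qed
  qed
qed

text \<open>Counterpart of \<open>upper_time_AE\<close>: one exponent of the condition forces
  \<open>y\<close> at level r j below \<open>a j\<close>, and keeping only that one can only raise
  the supremum. Here \<open>a j\<close> tends to 0 like a positive power of r j and is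
  summable.\<close>

lemma lower_time_AE:
  fixes r :: "nat \<Rightarrow> real"
  assumes c: "slow_function c" and b: "b > 0"
    and r: "\<And>j. 0 < r j" "\<And>j. r j \<le> (1 / 2) ^ j"
    and \<eta>: "0 \<le> \<eta>3" "\<eta>3 < \<eta>1" "\<eta>1 \<le> \<eta>2"
    and y1: "\<And>j. r j powr \<eta>3 * y b (r j) \<le> 1"
  shows "AE \<omega> in M. \<forall>\<^sub>F j in sequentially. \<forall>\<eta>\<in>{\<eta>1..\<eta>2} \<inter> I.
    running_sup X (lower_time y b c I (r j powr \<eta>)) \<omega> \<le> ennreal (6 * CARD('d) * r j)"
proof -
  \<comment> \<open>As above, half of the gap absorbs the inverse of the slow function, and the
    other half remains as decay of \<open>a j\<close>.\<close>
  define \<rho> where "\<rho> = (\<eta>1 - \<eta>3) / 2"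
  have \<rho>: "\<rho> > 0" using \<eta> by (auto simp: \<rho>_def)
  have \<eta>0: "\<eta>1 > 0" "\<eta>2 > 0" using \<eta> by auto
  obtain \<kappa>' t0 where \<kappa>': "0 < \<kappa>'" "\<kappa>' \<le> 1" "t0 > 0"
      "\<And>t. 0 < t \<Longrightarrow> t < t0 \<Longrightarrow> \<kappa>' * t powr (\<rho> / \<eta>2) \<le> c t"
    using slow_function_lower[OF c, of "\<rho> / \<eta>2"] \<rho> \<eta>0 by auto
  define a where "a j = inverse \<kappa>' * r j powr \<rho>" for j
  have r1: "r j \<le> 1" for j using r(2)[of j] power_le_one[of "1/2::real" j] by simp
  have y_le: "y b (r j) \<le> r j powr (- \<eta>3)" for j
  proof -
    have "y b (r j) = (r j powr \<eta>3 * r j powr (- \<eta>3)) * y b (r j)" using r(1)[of j] by (simp flip: powr_add)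
    also have "\<dots> = (r j powr \<eta>3 * y b (r j)) * r j powr (- \<eta>3)" by (simp add: mult_ac)
    also have "\<dots> \<le> 1 * r j powr (- \<eta>3)" by (intro mult_right_mono y1) auto
    finally show ?thesis by simp
  qed
  have AE: "AE \<omega> in M. \<forall>\<^sub>F j in sequentially.
    running_sup X (Sup {ennreal s | s. s > 0 \<and> y s (r j) \<le> a j}) \<omega> \<le> ennreal (6 * CARD('d) * r j)"
  proof (rule running_sup_lower_AE[OF r(1) r1])
    show "0 \<le> a j" for j using \<kappa>' by (simp add: a_def)
    show "summable a" unfolding a_def using \<rho> by (intro summable_mult summable_powr_le_geometric[OF r])
  qed
  have ev: "\<forall>\<^sub>F j in sequentially. r j powr \<eta>1 < t0"
  proof -
    have "filterlim (\<lambda>j. r j powr \<eta>1) (at_right 0) sequentially" by (rule filterlim_powr_seq[OF r \<eta>0(1)])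
    then have "(\<lambda>j. r j powr \<eta>1) \<longlonglongrightarrow> 0" by (simp add: filterlim_at)
    then show ?thesis using \<kappa>'(3) by (intro order_tendstoD)
  qed
  show ?thesis using AE
  proof eventually_elim
    case (elim \<omega>)
    show ?case using elim ev
    proof eventually_elim
      case (elim j)
      show ?case
      proof
        fix \<eta> assume \<eta>I: "\<eta> \<in> {\<eta>1..\<eta>2} \<inter> I"
        let ?t = "r j powr \<eta>"
        have \<eta>00: "\<eta> > 0" using \<eta>I \<eta>0 by auto
        have t: "0 < ?t" using r(1)[of j] by simp
        have "?t \<le> r j powr \<eta>1" using r(1)[of j] r1[of j] \<eta>I by (intro powr_mono') auto
        then have "?t < t0" using elim(2) by simp
        note c_ge = \<kappa>'(4)[OF t this]
        have c_pos: "0 < \<kappa>' * ?t powr (\<rho> / \<eta>2)" using \<kappa>' t by simp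
        have root: "?t powr (1 / \<eta>) = r j" using r(1)[of j] \<eta>00 by (simp add: powr_powr)
        have "inverse (c ?t) * ?t * y b (r j) \<le> a j"
        proof -
          have "inverse (c ?t) * ?t * y b (r j) \<le> inverse (\<kappa>' * ?t powr (\<rho> / \<eta>2)) * ?t * r j powr (- \<eta>3)"
            using le_imp_inverse_le[OF c_ge c_pos] y_le[of j] t c_pos y_nonneg[OF r(1) r1, of b j] b less_le_trans[OF c_pos c_ge]
            by (intro mult_mono mult_nonneg_nonneg) (auto simp del: inverse_mult_distrib)
          also have "\<dots> = inverse \<kappa>' * r j powr (\<eta> - \<eta> * (\<rho> / \<eta>2) - \<eta>3)"
            using r(1)[of j] by (simp add: powr_powr powr_diff powr_minus divide_inverse)
          also have "\<dots> \<le> a j"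
          proof -
            have "\<eta> * (\<rho> / \<eta>2) \<le> \<eta>2 * (\<rho> / \<eta>2)" using \<eta>I \<rho> \<eta>0 by (intro mult_right_mono) auto
            then have "\<eta> * (\<rho> / \<eta>2) \<le> \<rho>" using \<eta>0 by simp
            moreover have "\<eta>1 - \<eta>3 = 2 * \<rho>" by (simp add: \<rho>_def)
            ultimately have "\<rho> \<le> \<eta> - \<eta> * (\<rho> / \<eta>2) - \<eta>3" using \<eta>I by auto
            then show ?thesis unfolding a_def using r(1)[of j] r1[of j] \<kappa>' by (intro mult_left_mono powr_mono') auto
          qed
          finally show ?thesis .
        qed
        note le_a = this
        have "lower_time y b c I ?t \<le> Sup {ennreal s | s. s > 0 \<and> y s (r j) \<le> a j}"
          unfolding lower_time_def
        proof (intro Sup_subset_mono subsetI)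
          fix z assume "z \<in> {ennreal s | s. s > 0 \<and>
            (\<forall>\<eta>\<in>I. y s (?t powr (1 / \<eta>)) \<le> inverse (c ?t) * ?t * y b (?t powr (1 / \<eta>)))}"
          then obtain s where s: "z = ennreal s" "s > 0"
            "\<forall>\<eta>\<in>I. y s (?t powr (1 / \<eta>)) \<le> inverse (c ?t) * ?t * y b (?t powr (1 / \<eta>))" by blast
          have "y s (r j) \<le> inverse (c ?t) * ?t * y b (r j)" using bspec[OF s(3), of \<eta>] \<eta>I unfolding root by blast
          then have "y s (r j) \<le> a j" using le_a by linarith
          then show "z \<in> {ennreal s | s. s > 0 \<and> y s (r j) \<le> a j}" using s(1,2) by blast
        qed
        then show "running_sup X (lower_time y b c I ?t) \<omega> \<le> ennreal (6 * CARD('d) * r j)"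
          by (rule order_trans[OF running_sup_mono elim(1)])
      qed
    qed
  qed
qed

end


theorem theorem4p1:
  fixes M :: "'w measure"
    and X :: "real \<Rightarrow> 'w \<Rightarrow> real ^ 'd"
    and B C :: "'d \<Rightarrow> real \<Rightarrow> real"
    and \<nu> :: "'d \<Rightarrow> real \<Rightarrow> real measure"
    and y :: "real \<Rightarrow> real \<Rightarrow> real"
    and c :: "real \<Rightarrow> real"
    and b \<delta> \<beta> \<epsilon> :: real
  assumes "prob_space M"
    and "additive_components M X"
    and "\<And>i. has_characteristics M (\<lambda>t \<omega>. X t \<omega> $ i) (B i) (C i) (\<nu> i)"
    and "y = y_fun B C \<nu>"
    and "b > 0"
    and "\<delta> = delta_index y b"
    and "\<beta> = beta_index y b"
    and "\<epsilon> > 0"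
    and "slow_function c"
    and "continuous_on {0<..<1} c"
  shows
    "(\<forall>\<eta>>0. \<epsilon> < \<delta> \<and> \<eta> < \<delta> \<longrightarrow>
        (AE \<omega> in M. ((\<lambda>t. ennreal (t powr (- 1 / \<eta>)) *
            running_sup X (upper_time y b c {\<delta> - \<epsilon>..<\<delta>} t) \<omega>) \<longlongrightarrow> \<infinity>) (at_right 0))) \<and>
     (\<forall>\<eta>>0. \<eta> > \<delta> \<longrightarrow>
        (AE \<omega> in M. Liminf (at_right 0) (\<lambda>t. ennreal (t powr (- 1 / \<eta>)) *
            running_sup X (lower_time y b c {\<delta><..\<delta> + \<epsilon>} t) \<omega>) = 0)) \<and>
     (\<forall>\<eta>>0. \<epsilon> < \<beta> \<and> \<eta> < \<beta> \<longrightarrow>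
        (AE \<omega> in M. Limsup (at_right 0) (\<lambda>t. ennreal (t powr (- 1 / \<eta>)) *
            running_sup X (upper_time y b c {\<beta> - \<epsilon>..<\<beta>} t) \<omega>) = \<infinity>)) \<and>
     (\<forall>\<eta>>0. \<eta> > \<beta> \<longrightarrow>
        (AE \<omega> in M. ((\<lambda>t. ennreal (t powr (- 1 / \<eta>)) *
            running_sup X (lower_time y b c {\<beta><..\<beta> + \<epsilon>} t) \<omega>) \<longlongrightarrow> 0) (at_right 0)))"
proof -
  interpret additive_vec M X B C \<nu> y
  proof (rule additive_vec.intro)
    show "prob_space M" by fact
    show "additive_vec_axioms M X B C \<nu> y"
      using assms(1-4)
      by (intro additive_vec_axioms.intro additive_char.intro additive_char_axioms.intro)
         (auto simp: additive_components_def)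
  qed
  note b = \<open>b > 0\<close> and c = \<open>slow_function c\<close>
  have half: "(1 / 2 :: real) ^ (j + k) \<le> (1 / 2) ^ j" for j k :: nat
    by (rule power_decreasing) auto
  have small: "\<exists>k. (1 / 2 :: real) ^ k < e" if "e > 0" for e :: real
    using that by (intro real_arch_pow_inv) auto
  show ?thesis
  proof (intro conjI allI impI)
    fix \<eta> :: real assume \<eta>: "\<eta> > 0" "\<epsilon> < \<delta> \<and> \<eta> < \<delta>"
    define I where "I = {\<delta> - \<epsilon>..<\<delta>}"
    \<comment> \<open>The exponents between \<eta>1 and \<eta>2 parametrise t and must lie in
      \<open>I\<close>; \<eta>3 lies above them but below the index, so that \<open>y b\<close> has
      a lower bound of order r to the power -\<eta>3.\<close>
    obtain \<eta>1 where \<eta>1: "max \<eta> (\<delta> - \<epsilon>) < \<eta>1" "\<eta>1 < \<delta>"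
      using dense[of "max \<eta> (\<delta> - \<epsilon>)" \<delta>] \<eta> \<open>\<epsilon> > 0\<close> by auto
    obtain \<eta>2 where \<eta>2: "\<eta>1 < \<eta>2" "\<eta>2 < \<delta>" using dense[OF \<eta>1(2)] by auto
    obtain \<eta>3 where \<eta>3: "\<eta>2 < \<eta>3" "\<eta>3 < \<delta>" using dense[OF \<eta>2(2)] by auto
    have pos: "0 < \<eta>1" using \<eta> \<eta>1 by auto
    obtain \<kappa> r0 where \<kappa>: "\<kappa> > 0" "r0 > 0" "\<And>r. 0 < r \<Longrightarrow> r < r0 \<Longrightarrow> \<kappa> \<le> r powr \<eta>3 * y b r"
      using delta_index_less[OF _ _ b, of \<eta>3] \<eta>3 \<eta>2 pos \<open>\<delta> = delta_index y b\<close> by auto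
    \<comment> \<open>All dyadic levels are needed to reach every small t; shifting by k puts each
      of them in the range where the lower bound holds.\<close>
    obtain k where k: "(1 / 2 :: real) ^ k < r0" using small[OF \<kappa>(2)] by blast
    define r :: "nat \<Rightarrow> real" where "r j = (1 / 2) ^ (j + k)" for j
    have r: "0 < r j" "r j \<le> (1 / 2) ^ j" for j using half by (auto simp: r_def)
    have "r j < r0" for j using order_le_less_trans[OF half[of k j] k] by (simp add: r_def add.commute)
    then have "AE \<omega> in M. \<forall>\<^sub>F j in sequentially. \<forall>\<eta>\<in>{\<eta>1..\<eta>2} \<inter> I.
        ennreal (r j) < running_sup X (upper_time y b c I (r j powr \<eta>)) \<omega>"
      using \<kappa> r pos \<eta>2 \<eta>3 by (intro upper_time_AE[OF c b r]) auto
    then show "AE \<omega> in M. ((\<lambda>t. ennreal (t powr (- 1 / \<eta>)) *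
        running_sup X (upper_time y b c {\<delta> - \<epsilon>..<\<delta>} t) \<omega>) \<longlongrightarrow> \<infinity>) (at_right 0)"
      unfolding I_def[symmetric]
    proof eventually_elim
      case (elim \<omega>)
      then obtain J where J: "\<And>j \<eta>. j \<ge> J \<Longrightarrow> \<eta> \<in> {\<eta>1..\<eta>2} \<inter> I \<Longrightarrow>
          ennreal (r j) < running_sup X (upper_time y b c I (r j powr \<eta>)) \<omega>"
        unfolding eventually_sequentially by blast
      have ev1: "\<forall>\<^sub>F t in at_right (0::real). 0 < t \<and> t < 1" by (rule eventually_at_rightI[of 0 1]) auto
      have ev: "\<forall>\<^sub>F t in at_right 0. ennreal (t powr (1 / \<eta>1 - 1 / \<eta>)) \<le>
          ennreal (t powr (- 1 / \<eta>)) * running_sup X (upper_time y b c I t) \<omega>"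
        using eventually_dyadic_powr[OF pos \<eta>2(1), of "J + k"] ev1
      proof eventually_elim
        case (elim t)
        then obtain n \<eta>' where n: "n \<ge> J + k" "\<eta>' \<in> {\<eta>1..\<eta>2}" "t = ((1 / 2) ^ n) powr \<eta>'" by blast
        define j where "j = n - k"
        have j: "j \<ge> J" "r j = (1 / 2) ^ n" using n by (auto simp: j_def r_def)
        have \<eta>'0: "\<eta>' > 0" using n pos by auto
        have "\<eta>' \<in> I" using n \<eta>1 \<eta>2 by (auto simp: I_def)
        then have *: "ennreal (r j) < running_sup X (upper_time y b c I t) \<omega>" using J[OF j(1), of \<eta>'] n j by auto
        have "r j = t powr (1 / \<eta>')" using r(1)[of j] \<eta>'0 unfolding n(3) j(2)[symmetric] by (simp add: powr_powr)
        \<comment> \<open>The exponent varies with t; the worst case \<eta>1 still exceeds \<eta>,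
          so the normalised supremum is at least a negative power of t.\<close>
        moreover have "t powr (1 / \<eta>1) \<le> t powr (1 / \<eta>')"
          using elim n pos by (intro powr_mono') (auto simp: frac_le)
        ultimately have "ennreal (t powr (1 / \<eta>1)) \<le> running_sup X (upper_time y b c I t) \<omega>"
          using * by (metis ennreal_leI less_imp_le order_trans)
        then have "ennreal (t powr (- 1 / \<eta>)) * ennreal (t powr (1 / \<eta>1)) \<le>
            ennreal (t powr (- 1 / \<eta>)) * running_sup X (upper_time y b c I t) \<omega>" by (rule mult_left_mono) simp
        moreover have "t powr (- 1 / \<eta>) * t powr (1 / \<eta>1) = t powr (1 / \<eta>1 - 1 / \<eta>)"
          by (simp flip: powr_add)
        ultimately show ?case by (simp flip: ennreal_mult')
      qed
      show ?case
      proof (rule tendsto_sandwich[OF ev])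
        show "((\<lambda>t. ennreal (t powr (1 / \<eta>1 - 1 / \<eta>))) \<longlongrightarrow> \<infinity>) (at_right 0)"
          using \<eta> \<eta>1 by (intro ennreal_powr_top) (simp add: divide_strict_left_mono)
        show "((\<lambda>t::real. \<infinity> :: ennreal) \<longlongrightarrow> \<infinity>) (at_right 0)" by (rule tendsto_const)
      qed simp
    qed
  next
    fix \<eta> :: real assume \<eta>: "\<eta> > 0" "\<eta> > \<delta>"
    define I where "I = {\<delta><..\<delta> + \<epsilon>}"
    obtain \<eta>3 where \<eta>3: "0 \<le> \<eta>3" "\<eta>3 < min \<eta> (\<delta> + \<epsilon>)" "\<delta> \<le> \<eta>3"
      "\<And>r0. r0 > 0 \<Longrightarrow> \<exists>r. 0 < r \<and> r < r0 \<and> r powr \<eta>3 * y b r \<le> 1"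
      using delta_index_greater[OF _ b, of "min \<eta> (\<delta> + \<epsilon>)"] \<eta> \<open>\<epsilon> > 0\<close> \<open>\<delta> = delta_index y b\<close> by auto
    \<comment> \<open>For a liminf one sequence of times suffices, so a single exponent replaces the
      interval and the levels are chosen where \<open>y b\<close> is small.\<close>
    obtain \<eta>1 where \<eta>1: "\<eta>3 < \<eta>1" "\<eta>1 < min \<eta> (\<delta> + \<epsilon>)" using dense[OF \<eta>3(2)] by auto
    have pos: "0 < \<eta>1" and mem: "\<eta>1 \<in> I" using \<eta>3 \<eta>1 by (auto simp: I_def)
    have "\<forall>j::nat. \<exists>r. 0 < r \<and> r < (1 / 2) ^ j \<and> r powr \<eta>3 * y b r \<le> 1" using \<eta>3(4) by simp
    then obtain r where r': "\<And>j. 0 < r j" "\<And>j::nat. r j < (1 / 2) ^ j" "\<And>j. r j powr \<eta>3 * y b (r j) \<le> 1"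
      by metis
    then have r: "0 < r j" "r j \<le> (1 / 2) ^ j" for j by (auto intro: less_imp_le)
    have "AE \<omega> in M. \<forall>\<^sub>F j in sequentially. \<forall>\<eta>\<in>{\<eta>1..\<eta>1} \<inter> I.
        running_sup X (lower_time y b c I (r j powr \<eta>)) \<omega> \<le> ennreal (6 * CARD('d) * r j)"
      by (rule lower_time_AE[OF c b r \<eta>3(1) \<eta>1(1) order_refl r'(3)])
    then show "AE \<omega> in M. Liminf (at_right 0) (\<lambda>t. ennreal (t powr (- 1 / \<eta>)) *
        running_sup X (lower_time y b c {\<delta><..\<delta> + \<epsilon>} t) \<omega>) = 0"
      unfolding I_def[symmetric]
    proof eventually_elim
      case (elim \<omega>)
      have lim: "filterlim (\<lambda>j. r j powr \<eta>1) (at_right 0) sequentially" by (rule filterlim_powr_seq[OF r pos])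
      show ?case
      proof (rule Liminf_seq_zero[OF lim],
          rule tendsto_sandwich[of "\<lambda>_. 0" _ _ "\<lambda>j. ennreal (6 * CARD('d) * (r j powr \<eta>1) powr (1 / \<eta>1 - 1 / \<eta>))"])
        let ?f = "\<lambda>t. ennreal (t powr (- 1 / \<eta>)) * running_sup X (lower_time y b c I t) \<omega>"
        show "\<forall>\<^sub>F j in sequentially. ?f (r j powr \<eta>1) \<le> ennreal (6 * CARD('d) * (r j powr \<eta>1) powr (1 / \<eta>1 - 1 / \<eta>))"
          using elim
        proof eventually_elim
          case (elim j)
          then have *: "running_sup X (lower_time y b c I (r j powr \<eta>1)) \<omega> \<le> ennreal (6 * CARD('d) * r j)" using mem by auto
          have root: "(r j powr \<eta>1) powr (1 / \<eta>1) = r j" using r(1)[of j] pos by (simp add: powr_powr)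
          have "?f (r j powr \<eta>1) \<le> ennreal ((r j powr \<eta>1) powr (- 1 / \<eta>)) * ennreal (6 * CARD('d) * r j)"
            by (rule mult_left_mono[OF *]) simp
          also have "\<dots> = ennreal ((r j powr \<eta>1) powr (- 1 / \<eta>) * (6 * CARD('d) * r j))" by (simp add: ennreal_mult')
          also have "(r j powr \<eta>1) powr (- 1 / \<eta>) * (6 * CARD('d) * r j) =
              6 * CARD('d) * ((r j powr \<eta>1) powr (1 / \<eta>1) * (r j powr \<eta>1) powr (- 1 / \<eta>))" unfolding root by simp
          also have "(r j powr \<eta>1) powr (1 / \<eta>1) * (r j powr \<eta>1) powr (- 1 / \<eta>) = (r j powr \<eta>1) powr (1 / \<eta>1 - 1 / \<eta>)"
            by (simp flip: powr_add)
          finally show ?case .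
        qed
        show "(\<lambda>j. ennreal (6 * CARD('d) * (r j powr \<eta>1) powr (1 / \<eta>1 - 1 / \<eta>))) \<longlonglongrightarrow> 0"
          by (rule filterlim_compose[OF ennreal_powr_zero lim]) (use \<eta> \<eta>1 pos in \<open>simp add: divide_strict_left_mono\<close>)
      qed auto
    qed
  next
    fix \<eta> :: real assume \<eta>: "\<eta> > 0" "\<epsilon> < \<beta> \<and> \<eta> < \<beta>"
    define I where "I = {\<beta> - \<epsilon>..<\<beta>}"
    obtain \<eta>1 where \<eta>1: "max \<eta> (\<beta> - \<epsilon>) < \<eta>1" "\<eta>1 < \<beta>"
      using dense[of "max \<eta> (\<beta> - \<epsilon>)" \<beta>] \<eta> \<open>\<epsilon> > 0\<close> by auto
    obtain \<eta>3 where \<eta>3: "\<eta>1 < \<eta>3" "\<eta>3 < \<beta>" using dense[OF \<eta>1(2)] by auto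
    have pos: "0 < \<eta>1" and mem: "\<eta>1 \<in> I" using \<eta> \<eta>1 by (auto simp: I_def)
    \<comment> \<open>The levels are picked among those where \<open>y b\<close> is large, and again
      a single exponent converts them into times.\<close>
    obtain \<kappa> where \<kappa>: "\<kappa> > 0" "\<And>r0. r0 > 0 \<Longrightarrow> \<exists>r. 0 < r \<and> r < r0 \<and> \<kappa> \<le> r powr \<eta>3 * y b r"
      using beta_index_less[OF _ _ b, of \<eta>3] \<eta>3 pos \<open>\<beta> = beta_index y b\<close> by auto
    have "\<forall>j::nat. \<exists>r. 0 < r \<and> r < (1 / 2) ^ j \<and> \<kappa> \<le> r powr \<eta>3 * y b r" using \<kappa>(2) by simp
    then obtain r where r': "\<And>j. 0 < r j" "\<And>j::nat. r j < (1 / 2) ^ j" "\<And>j. \<kappa> \<le> r j powr \<eta>3 * y b (r j)"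
      by metis
    then have r: "0 < r j" "r j \<le> (1 / 2) ^ j" for j by (auto intro: less_imp_le)
    have "AE \<omega> in M. \<forall>\<^sub>F j in sequentially. \<forall>\<eta>\<in>{\<eta>1..\<eta>1} \<inter> I.
        ennreal (r j) < running_sup X (upper_time y b c I (r j powr \<eta>)) \<omega>"
      by (rule upper_time_AE[OF c b r pos order_refl \<eta>3(1) \<kappa>(1) r'(3)])
    then show "AE \<omega> in M. Limsup (at_right 0) (\<lambda>t. ennreal (t powr (- 1 / \<eta>)) *
        running_sup X (upper_time y b c {\<beta> - \<epsilon>..<\<beta>} t) \<omega>) = \<infinity>"
      unfolding I_def[symmetric]
    proof eventually_elim
      case (elim \<omega>)
      have lim: "filterlim (\<lambda>j. r j powr \<eta>1) (at_right 0) sequentially" by (rule filterlim_powr_seq[OF r pos])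
      let ?f = "\<lambda>t. ennreal (t powr (- 1 / \<eta>)) * running_sup X (upper_time y b c I t) \<omega>"
      have ev: "\<forall>\<^sub>F j in sequentially. ennreal ((r j powr \<eta>1) powr (1 / \<eta>1 - 1 / \<eta>)) \<le> ?f (r j powr \<eta>1)"
        using elim
      proof eventually_elim
        case (elim j)
        then have *: "ennreal (r j) \<le> running_sup X (upper_time y b c I (r j powr \<eta>1)) \<omega>" using mem by auto
        have root: "(r j powr \<eta>1) powr (1 / \<eta>1) = r j" using r(1)[of j] pos by (simp add: powr_powr)
        have "(r j powr \<eta>1) powr (1 / \<eta>1 - 1 / \<eta>) = (r j powr \<eta>1) powr (- 1 / \<eta>) * (r j powr \<eta>1) powr (1 / \<eta>1)"
          by (simp flip: powr_add)
        then have "ennreal ((r j powr \<eta>1) powr (1 / \<eta>1 - 1 / \<eta>)) = ennreal ((r j powr \<eta>1) powr (- 1 / \<eta>)) * ennreal (r j)"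
          unfolding root by (simp add: ennreal_mult')
        also have "\<dots> \<le> ?f (r j powr \<eta>1)" by (rule mult_left_mono[OF *]) simp
        finally show ?case .
      qed
      show ?case
      proof (rule Limsup_seq_infinity[OF lim], rule tendsto_sandwich[OF ev])
        show "(\<lambda>j. ennreal ((r j powr \<eta>1) powr (1 / \<eta>1 - 1 / \<eta>))) \<longlonglongrightarrow> \<infinity>"
          by (rule filterlim_compose[OF ennreal_powr_top lim]) (use \<eta> \<eta>1 pos in \<open>simp add: divide_strict_left_mono\<close>)
        show "(\<lambda>j. \<infinity> :: ennreal) \<longlonglongrightarrow> \<infinity>" by (rule tendsto_const)
      qed simp
    qed
  next
    fix \<eta> :: real assume \<eta>: "\<eta> > 0" "\<eta> > \<beta>"
    define I where "I = {\<beta><..\<beta> + \<epsilon>}"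
    obtain \<eta>3 r0 where \<eta>3: "0 \<le> \<eta>3" "\<eta>3 < min \<eta> (\<beta> + \<epsilon>)" "\<beta> \<le> \<eta>3" "r0 > 0"
      "\<And>r. 0 < r \<Longrightarrow> r < r0 \<Longrightarrow> r powr \<eta>3 * y b r \<le> 1"
      using beta_index_greater[OF _ b, of "min \<eta> (\<beta> + \<epsilon>)"] \<eta> \<open>\<epsilon> > 0\<close> \<open>\<beta> = beta_index y b\<close> by auto
    obtain \<eta>1 where \<eta>1: "\<eta>3 < \<eta>1" "\<eta>1 < min \<eta> (\<beta> + \<epsilon>)" using dense[OF \<eta>3(2)] by auto
    \<comment> \<open>Every small t must be reached, hence a whole interval of exponents inside
      \<open>I\<close>. Its upper end is the worst case here and must stay below \<eta>.\<close>
    obtain \<eta>2 where \<eta>2: "\<eta>1 < \<eta>2" "\<eta>2 < min \<eta> (\<beta> + \<epsilon>)" using dense[OF \<eta>1(2)] by auto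
    have pos: "0 < \<eta>1" using \<eta>3 \<eta>1 by auto
    obtain k where k: "(1 / 2 :: real) ^ k < r0" using small[OF \<eta>3(4)] by blast
    define r :: "nat \<Rightarrow> real" where "r j = (1 / 2) ^ (j + k)" for j
    have r: "0 < r j" "r j \<le> (1 / 2) ^ j" for j using half by (auto simp: r_def)
    have "r j < r0" for j using order_le_less_trans[OF half[of k j] k] by (simp add: r_def add.commute)
    then have "AE \<omega> in M. \<forall>\<^sub>F j in sequentially. \<forall>\<eta>\<in>{\<eta>1..\<eta>2} \<inter> I.
        running_sup X (lower_time y b c I (r j powr \<eta>)) \<omega> \<le> ennreal (6 * CARD('d) * r j)"
      using r \<eta>1 \<eta>2 \<eta>3 by (intro lower_time_AE[OF c b r \<eta>3(1)]) auto
    then show "AE \<omega> in M. ((\<lambda>t. ennreal (t powr (- 1 / \<eta>)) *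
        running_sup X (lower_time y b c {\<beta><..\<beta> + \<epsilon>} t) \<omega>) \<longlongrightarrow> 0) (at_right 0)"
      unfolding I_def[symmetric]
    proof eventually_elim
      case (elim \<omega>)
      then obtain J where J: "\<And>j \<eta>. j \<ge> J \<Longrightarrow> \<eta> \<in> {\<eta>1..\<eta>2} \<inter> I \<Longrightarrow>
          running_sup X (lower_time y b c I (r j powr \<eta>)) \<omega> \<le> ennreal (6 * CARD('d) * r j)"
        unfolding eventually_sequentially by blast
      have ev1: "\<forall>\<^sub>F t in at_right (0::real). 0 < t \<and> t < 1" by (rule eventually_at_rightI[of 0 1]) auto
      have ev: "\<forall>\<^sub>F t in at_right 0. ennreal (t powr (- 1 / \<eta>)) * running_sup X (lower_time y b c I t) \<omega> \<le>
          ennreal (6 * CARD('d) * t powr (1 / \<eta>2 - 1 / \<eta>))"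
        using eventually_dyadic_powr[OF pos \<eta>2(1), of "J + k"] ev1
      proof eventually_elim
        case (elim t)
        then obtain n \<eta>' where n: "n \<ge> J + k" "\<eta>' \<in> {\<eta>1..\<eta>2}" "t = ((1 / 2) ^ n) powr \<eta>'" by blast
        define j where "j = n - k"
        have j: "j \<ge> J" "r j = (1 / 2) ^ n" using n by (auto simp: j_def r_def)
        have \<eta>'0: "\<eta>' > 0" using n pos by auto
        have "\<eta>' \<in> I" using n \<eta>1 \<eta>2 \<eta>3 by (auto simp: I_def)
        then have *: "running_sup X (lower_time y b c I t) \<omega> \<le> ennreal (6 * CARD('d) * r j)" using J[OF j(1), of \<eta>'] n j by auto
        have "r j = t powr (1 / \<eta>')" using r(1)[of j] \<eta>'0 unfolding n(3) j(2)[symmetric] by (simp add: powr_powr)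
        also have "t powr (1 / \<eta>') \<le> t powr (1 / \<eta>2)"
          using elim n \<eta>'0 by (intro powr_mono') (auto simp: frac_le)
        finally have "6 * CARD('d) * r j \<le> 6 * CARD('d) * t powr (1 / \<eta>2)" by (intro mult_left_mono) auto
        then have "running_sup X (lower_time y b c I t) \<omega> \<le> ennreal (6 * CARD('d) * t powr (1 / \<eta>2))"
          using * ennreal_leI order_trans by blast
        then have "ennreal (t powr (- 1 / \<eta>)) * running_sup X (lower_time y b c I t) \<omega> \<le>
            ennreal (t powr (- 1 / \<eta>)) * ennreal (6 * CARD('d) * t powr (1 / \<eta>2))" by (rule mult_left_mono) simp
        also have "\<dots> = ennreal (6 * CARD('d) * (t powr (1 / \<eta>2) * t powr (- 1 / \<eta>)))"
          by (simp add: mult_ac flip: ennreal_mult')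
        also have "t powr (1 / \<eta>2) * t powr (- 1 / \<eta>) = t powr (1 / \<eta>2 - 1 / \<eta>)"
          by (simp flip: powr_add)
        finally show ?case .
      qed
      show ?case
      proof (rule tendsto_sandwich[of "\<lambda>_. 0", OF _ ev])
        show "((\<lambda>t. ennreal (6 * CARD('d) * t powr (1 / \<eta>2 - 1 / \<eta>))) \<longlongrightarrow> 0) (at_right 0)"
          using \<eta> \<eta>1 \<eta>2 pos by (intro ennreal_powr_zero) (simp add: divide_strict_left_mono)
      qed auto
    qed
  qed
qed

end
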